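(* Let $0<p,p_1,q,q_1\le\infty$, $s\in\mathbb{R}$. Then $W_{p,q}\hookrightarrow M_{p_1,q_1}^s$ if and only if $p_1\ge p$ and one of the following conditions is satisfied: (1) $q_1\ge\max\{p,q\}$, $s\le0$; (2) $q_1<\max\{p,q\}$, $s+\dfrac{d}{q_1}<\dfrac{d}{\max\{p,q\}}$.
   Context: All function spaces are on $\mathbb{R}^d$, $d\ge 1$; $1/\infty=0$; $\hookrightarrow$ denotes continuous embedding (inclusion with $\|f\|_Y\le C\|f\|_X$ for all $f\in X$); $\langle x\rangle=(1+|x|^2)^{1/2}$; $\mathscr{F}$ is the Fourier transform on $\mathscr{S}'(\mathbb{R}^d)$. Let $\sigma$ be a smooth function adapted to $[-1/2,1/2]^d$, vanishing outside $[-3/4,3/4]^d$, with $\sum_{k\in\mathbb{Z}^d}\sigma(\xi-k)=1$ for all $\xi$, and put $\Box_k=\mathscr{F}^{-1}\sigma(\cdot-k)\mathscr{F}$. For $0<p,q\le\infty$, $s\in\mathbb{R}$, the modulation space $M_{p,q}^s$ and Wiener amalgam space $W_{p,q}^s$ consist of all $f\in\mathscr{S}'$ with finite (quasi-)norm $\|f\|_{M_{p,q}^s}=\big\|\langle k\rangle^s\|\Box_kf\|_{L^p}\big\|_{\ell^q_{k\in\mathbb{Z}^d}}$, respectively $\|f\|_{W_{p,q}^s}=\big\|\,\|\langle k\rangle^s\Box_kf(x)\|_{\ell^q_{k\in\mathbb{Z}^d}}\big\|_{L^p_x}$ (independent of $\sigma$ up to equivalent norms); $W_{p,q}=W_{p,q}^0$.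 *)

theory Defs
  imports "HOL-Probability.Probability"
begin

section \<open>Schwartz functions and tempered distributions\<close>

definition japanese :: "real ^ 'n \<Rightarrow> real" where
  "japanese x = sqrt (1 + (norm x)\<^sup>2)"

definition partial_deriv :: "'n \<Rightarrow> (real ^ 'n \<Rightarrow> complex) \<Rightarrow> real ^ 'n \<Rightarrow> complex" where
  "partial_deriv j f x = frechet_derivative f (at x) (axis j 1)"

text \<open>Multi-indices are represented by lists of coordinate directions, the order of
  the derivative being the length of the list.\<close>

definition iter_partial :: "'n list \<Rightarrow> (real ^ 'n \<Rightarrow> complex) \<Rightarrow> real ^ 'n \<Rightarrow> complex" where
  "iter_partial js f = foldr partial_deriv js f"

definition smooth :: "(real ^ 'n \<Rightarrow> complex) \<Rightarrow> bool" where
  "smooth f \<longleftrightarrow> (\<forall>js x. iter_partial js f differentiable (at x))"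

definition schwartz :: "(real ^ 'n \<Rightarrow> complex) \<Rightarrow> bool" where
  "schwartz \<phi> \<longleftrightarrow> smooth \<phi> \<and>
     (\<forall>(N::nat) js. bdd_above (range (\<lambda>x. japanese x ^ N * cmod (iter_partial js \<phi> x))))"

text \<open>The increasing family of norms defining the Frechet topology of the Schwartz space.\<close>

definition schwartz_norm :: "nat \<Rightarrow> (real ^ 'n \<Rightarrow> complex) \<Rightarrow> real" where
  "schwartz_norm N \<phi> =
     (SUP (js, x) \<in> {js. length js \<le> N} \<times> UNIV. japanese x ^ N * cmod (iter_partial js \<phi> x))"

text \<open>A distribution is a functional on all functions of which only the restriction to
  the Schwartz space is used. Its continuity there means domination by one of
  the norms above.\<close>

type_synonym 'n distribution = "(real ^ 'n \<Rightarrow> complex) \<Rightarrow> complex"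

definition tempered :: "'n::finite distribution \<Rightarrow> bool" where
  "tempered u \<longleftrightarrow>
     (\<forall>\<phi> \<psi>. schwartz \<phi> \<longrightarrow> schwartz \<psi> \<longrightarrow> u (\<lambda>x. \<phi> x + \<psi> x) = u \<phi> + u \<psi>) \<and>
     (\<forall>c \<phi>. schwartz \<phi> \<longrightarrow> u (\<lambda>x. c * \<phi> x) = c * u \<phi>) \<and>
     (\<exists>C N. \<forall>\<phi>. schwartz \<phi> \<longrightarrow> cmod (u \<phi>) \<le> C * schwartz_norm N \<phi>)"

section \<open>Fourier transform and frequency-uniform decomposition\<close>

definition fourier :: "(real ^ 'n \<Rightarrow> complex) \<Rightarrow> real ^ 'n \<Rightarrow> complex" where
  "fourier \<phi> \<xi> = (LINT x|lborel. cis (- (2 * pi * (x \<bullet> \<xi>))) * \<phi> x)"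

definition inv_fourier :: "(real ^ 'n \<Rightarrow> complex) \<Rightarrow> real ^ 'n \<Rightarrow> complex" where
  "inv_fourier \<phi> x = (LINT \<xi>|lborel. cis (2 * pi * (x \<bullet> \<xi>)) * \<phi> \<xi>)"

definition dist_fourier :: "'n::finite distribution \<Rightarrow> 'n distribution" where
  "dist_fourier u = (\<lambda>\<phi>. u (fourier \<phi>))"

definition dist_inv_fourier :: "'n::finite distribution \<Rightarrow> 'n distribution" where
  "dist_inv_fourier u = (\<lambda>\<phi>. u (inv_fourier \<phi>))"

definition dist_mult :: "(real ^ 'n \<Rightarrow> complex) \<Rightarrow> 'n::finite distribution \<Rightarrow> 'n distribution" where
  "dist_mult g u = (\<lambda>\<phi>. u (\<lambda>\<xi>. g \<xi> * \<phi> \<xi>))"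

definition lattice_pt :: "int ^ 'n \<Rightarrow> real ^ 'n" where
  "lattice_pt k = (\<chi> i. real_of_int (k $ i))"

definition decomposition_window :: "(real ^ 'n \<Rightarrow> complex) \<Rightarrow> bool" where
  "decomposition_window \<sigma> \<longleftrightarrow>
     smooth \<sigma> \<and>
     (\<forall>\<xi>. \<xi> \<notin> cbox (\<chi> i. - 3 / 4) (\<chi> i. 3 / 4) \<longrightarrow> \<sigma> \<xi> = 0) \<and>
     (\<forall>\<xi>. ((\<lambda>k. \<sigma> (\<xi> - lattice_pt k)) has_sum 1) UNIV)"

definition box_dist ::
  "(real ^ 'n \<Rightarrow> complex) \<Rightarrow> int ^ 'n \<Rightarrow> 'n::finite distribution \<Rightarrow> 'n distribution" where
  "box_dist \<sigma> k f =
     dist_inv_fourier (dist_mult (\<lambda>\<xi>. \<sigma> (\<xi> - lattice_pt k)) (dist_fourier f))"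

definition represents :: "(real ^ 'n \<Rightarrow> complex) \<Rightarrow> 'n::finite distribution \<Rightarrow> bool" where
  "represents g u \<longleftrightarrow> continuous_on UNIV g \<and>
     (\<forall>\<phi>. schwartz \<phi> \<longrightarrow>
        integrable lborel (\<lambda>x. g x * \<phi> x) \<and> u \<phi> = (LINT x|lborel. g x * \<phi> x))"

text \<open>For a tempered f the distribution box_dist has compactly supported Fourier transform,
  hence is represented by a (unique) continuous, in fact smooth, function of at most
  polynomial growth.\<close>

definition box_fun ::
  "(real ^ 'n \<Rightarrow> complex) \<Rightarrow> int ^ 'n \<Rightarrow> 'n::finite distribution \<Rightarrow> real ^ 'n \<Rightarrow> complex" where
  "box_fun \<sigma> k f = (THE g. represents g (box_dist \<sigma> k f))"

section \<open>Mixed norms, modulation and Wiener amalgam spaces\<close>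

text \<open>Real powers on the extended half-line, for positive exponents only.\<close>

definition ennreal_powr :: "ennreal \<Rightarrow> real \<Rightarrow> ennreal" where
  "ennreal_powr x a = (if x = \<infinity> then \<infinity> else ennreal (enn2real x powr a))"

text \<open>Intended for exponents 0 < p. Values in the extended half-line allow nesting;
  over a counting measure this is the sequence norm.\<close>

definition Lp_norm :: "'a measure \<Rightarrow> ereal \<Rightarrow> ('a \<Rightarrow> ennreal) \<Rightarrow> ennreal" where
  "Lp_norm M p f =
     (if p = \<infinity> then esssup M f
      else ennreal_powr (\<integral>\<^sup>+ x. ennreal_powr (f x) (real_of_ereal p) \<partial>M) (1 / real_of_ereal p))"

definition modulation_norm ::
  "(real ^ 'n \<Rightarrow> complex) \<Rightarrow> ereal \<Rightarrow> ereal \<Rightarrow> real \<Rightarrow> 'n::finite distribution \<Rightarrow> ennreal" where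
  "modulation_norm \<sigma> p q s f =
     Lp_norm (count_space UNIV) q (\<lambda>k. ennreal (japanese (lattice_pt k) powr s) *
       Lp_norm lborel p (\<lambda>x. ennreal (cmod (box_fun \<sigma> k f x))))"

definition amalgam_norm ::
  "(real ^ 'n \<Rightarrow> complex) \<Rightarrow> ereal \<Rightarrow> ereal \<Rightarrow> real \<Rightarrow> 'n::finite distribution \<Rightarrow> ennreal" where
  "amalgam_norm \<sigma> p q s f =
     Lp_norm lborel p (\<lambda>x. Lp_norm (count_space UNIV) q
       (\<lambda>k. ennreal (japanese (lattice_pt k) powr s * cmod (box_fun \<sigma> k f x))))"

definition modulation_space ::
  "(real ^ 'n \<Rightarrow> complex) \<Rightarrow> ereal \<Rightarrow> ereal \<Rightarrow> real \<Rightarrow> 'n::finite distribution set" where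
  "modulation_space \<sigma> p q s = {f. tempered f \<and> modulation_norm \<sigma> p q s f < \<infinity>}"

definition amalgam_space ::
  "(real ^ 'n \<Rightarrow> complex) \<Rightarrow> ereal \<Rightarrow> ereal \<Rightarrow> real \<Rightarrow> 'n::finite distribution set" where
  "amalgam_space \<sigma> p q s = {f. tempered f \<and> amalgam_norm \<sigma> p q s f < \<infinity>}"

definition continuously_embedded ::
  "'a set \<Rightarrow> ('a \<Rightarrow> ennreal) \<Rightarrow> 'a set \<Rightarrow> ('a \<Rightarrow> ennreal) \<Rightarrow> bool" where
  "continuously_embedded X normX Y normY \<longleftrightarrow>
     X \<subseteq> Y \<and> (\<exists>C::real. \<forall>f\<in>X. normY f \<le> ennreal C * normX f)"

end

theory Submission
  imports Defs
begin

text \<open>The block \<open>\<box>\<^sub>k f\<close> of a tempered distribution \<open>f\<close> is the function \<open>g\<^sub>k(x) = f(G\<^sub>k(\<cdot> - x))\<close>, where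
  \<open>G\<^sub>k\<close> is the Fourier transform of \<open>\<sigma>(\<cdot> - k)\<close>. As a wider window equals 1 on the support of \<open>\<sigma>\<close>,
  Fourier inversion gives \<open>g\<^sub>k(x) = \<integral> T\<^sub>k(z) g\<^sub>k(x + z) dz\<close> with Schwartz functions \<open>T\<^sub>k\<close> whose
  modulus does not depend on \<open>k\<close>, hence Bernstein's inequality from \<open>L\<^sup>p\<close> to \<open>L\<^bsup>p\<^sub>1\<^esup>\<close> for \<open>p \<le> p\<^sub>1\<close>,
  uniformly in \<open>k\<close>. Together with Minkowski's inequality, which interchanges the \<open>L\<^sup>p\<close> and the
  \<open>\<ell>\<^sup>q\<close> norm at the price of replacing \<open>q\<close> by \<open>r = max(p, q)\<close>, the embedding is reduced to the
  embedding of \<open>\<ell>\<^sup>r\<close> into a weighted \<open>\<ell>\<^bsup>q\<^sub>1\<^esup>\<close> on the lattice.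

  Conversely, \<open>\<sigma> = 1\<close> near the origin and the other translates vanish there, so the blocks of
  sums of modulated copies of an atom \<open>\<gamma>\<close> with Fourier transform concentrated near the
  origin can be read off. A dilation of \<open>\<gamma>\<close> forces \<open>p \<le> p\<^sub>1\<close>. Modulating \<open>a\<^sub>k \<gamma>(x)\<close> if
  \<open>p \<le> q\<close>, and \<open>a\<^sub>k \<gamma>(x - k)\<close> if \<open>q < p\<close>, to the frequency \<open>k\<close> forces the embedding of sequence spaces, and
  the borderline case is excluded by \<open>a\<^sub>k = \<langle>k\<rangle>\<^bsup>-d/r\<^esup>\<close>.\<close>

section \<open>Smooth functions\<close>

text \<open>A block is given only by a definite description, and a distribution is a bare functional
  about which nothing is known but linearity and domination by one Schwartz seminorm. The central
  obstacle is therefore to interchange such a functional with an integral over translates of a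
  Schwartz function; it is overcome by comparing the integral with point masses on small sets. Every
  function on the frequency side is smooth with compact support, so the Fourier theory is developed
  for this class, whose transforms are Schwartz functions. Exponents below 1 rule out duality and
  Young's inequality: Minkowski's inequality is applied to p-th powers, and Bernstein's inequality
  for p < 1 follows from an estimate of a supremum by a smaller power of itself. In the converse
  direction only finite sums of atoms are tested, so that every test distribution is an integrable
  function. The maximum of p and q appears because the larger exponent belongs to the larger
  sequence space and so imposes the stronger condition.\<close>

lemma partial_deriv_eq: "(f has_derivative f') (at x) \<Longrightarrow> partial_deriv j f x = f' (axis j 1)"
  using frechet_derivative_at[of f f' x] by (simp add: partial_deriv_def)

text \<open>A derivative is linear, hence determined by the coordinate vectors. This form lets all
  later estimates of increments refer to \<open>partial_deriv\<close> only.\<close>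

lemma has_derivative_partial:
  fixes f :: "real ^ 'n::finite \<Rightarrow> complex"
  assumes "f differentiable (at x)"
  shows "(f has_derivative (\<lambda>v. \<Sum>j\<in>UNIV. of_real (v $ j) * partial_deriv j f x)) (at x)"
proof -
  define f' where "f' = frechet_derivative f (at x)"
  have f': "(f has_derivative f') (at x)"
    using assms by (simp add: f'_def frechet_derivative_works)
  then have lin: "linear f'"
    using has_derivative_linear by blast
  have "f' v = (\<Sum>j\<in>UNIV. of_real (v $ j) * partial_deriv j f x)" for v
  proof -
    have "v = (\<Sum>j\<in>UNIV. (v $ j) *\<^sub>R axis j 1)"
      using basis_expansion[of v] by (simp add: scalar_mult_eq_scaleR)
    then have "f' v = f' (\<Sum>j\<in>UNIV. (v $ j) *\<^sub>R axis j 1)" by simp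
    also have "\<dots> = (\<Sum>j\<in>UNIV. (v $ j) *\<^sub>R f' (axis j 1))"
      by (simp add: linear_sum[OF lin] linear_scale[OF lin])
    finally show ?thesis
      by (simp add: partial_deriv_eq[OF f'] scaleR_conv_of_real)
  qed
  then have "f' = (\<lambda>v. \<Sum>j\<in>UNIV. of_real (v $ j) * partial_deriv j f x)" by auto
  with f' show ?thesis by simp
qed

lemma iter_partial_Nil [simp]: "iter_partial [] f = f"
  and iter_partial_Cons: "iter_partial (j # js) f = partial_deriv j (iter_partial js f)"
  and iter_partial_snoc: "iter_partial (js @ [j]) f = iter_partial js (partial_deriv j f)"
  by (simp_all add: iter_partial_def)

lemma smooth_differentiable: "smooth f \<Longrightarrow> f differentiable (at x)"
  unfolding smooth_def by (metis iter_partial_Nil)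

lemma smooth_partial: "smooth f \<Longrightarrow> smooth (partial_deriv j f)"
  unfolding smooth_def by (metis iter_partial_snoc)

lemma smooth_iter_partial: "smooth f \<Longrightarrow> smooth (iter_partial js f)"
  by (induction js) (auto simp: iter_partial_Cons smooth_partial)

text \<open>Smoothness asks for one derivative at a time inside a class that is stable under
  \<open>partial_deriv\<close>. With a well chosen class no formula for iterated derivatives has to
  be written down.\<close>

lemma smooth_coinduct:
  assumes "P f" and "\<And>g x. P g \<Longrightarrow> g differentiable (at x)"
    and "\<And>g j. P g \<Longrightarrow> P (partial_deriv j g)"
  shows "smooth f"
proof -
  have "P (iter_partial js f)" for js
    by (induction js) (auto simp: iter_partial_Cons assms)
  then show ?thesis using assms(2) by (auto simp: smooth_def)
qed

lemma smooth_continuous_on: "smooth f \<Longrightarrow> continuous_on S f"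
  by (meson continuous_at_imp_continuous_on differentiable_imp_continuous_within
      smooth_differentiable)

lemma smooth_has_derivative:
  fixes f :: "real ^ 'n::finite \<Rightarrow> complex"
  shows "smooth f \<Longrightarrow> (f has_derivative (\<lambda>v. \<Sum>j\<in>UNIV. of_real (v $ j) * partial_deriv j f x)) (at x)"
  by (simp add: has_derivative_partial smooth_differentiable)

lemma smooth_measurable [measurable_dest]:
  "smooth f \<Longrightarrow> f \<in> borel_measurable borel"
  by (simp add: borel_measurable_continuous_onI smooth_continuous_on)

lemma partial_deriv_at:
  fixes f :: "real ^ 'n::finite \<Rightarrow> complex"
  assumes "\<And>x. (f has_derivative f' x) (at x)"
  shows "partial_deriv j f = (\<lambda>x. f' x (axis j 1))"
  using partial_deriv_eq[OF assms] by auto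

lemma axis_one_nth: "axis j (1::real) $ i = (if i = j then 1 else 0)"
  by (simp add: axis_def)

lemma sum_axis:
  fixes a :: "'n::finite \<Rightarrow> complex"
  shows "(\<Sum>i\<in>UNIV. of_real (axis j 1 $ i) * a i) = a j"
proof -
  have "(\<Sum>i\<in>UNIV. of_real (axis j 1 $ i) * a i) = (\<Sum>i\<in>UNIV. if i = j then a i else 0)"
    by (intro sum.cong) (auto simp: axis_one_nth)
  then show ?thesis by simp
qed

lemma partial_const: "partial_deriv j (\<lambda>_. c) = (\<lambda>_. 0)"
  by (subst partial_deriv_at[where f'="\<lambda>_ _. 0"]) auto

lemma smooth_const [simp]: "smooth (\<lambda>_. c)"
  by (rule smooth_coinduct[where P="\<lambda>g. \<exists>c. g = (\<lambda>_. c)"]) (auto simp: partial_const)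

lemma partial_coord: "partial_deriv j (\<lambda>x. complex_of_real (x $ i)) = (\<lambda>_. if i = j then 1 else 0)"
  by (subst partial_deriv_at[where f'="\<lambda>_ v. complex_of_real (v $ i)"])
     (auto simp: axis_one_nth intro!: derivative_eq_intros bounded_linear_imp_has_derivative
        bounded_linear_vec_nth bounded_linear_of_real bounded_linear_compose[OF bounded_linear_of_real])

lemma smooth_coord [simp]: "smooth (\<lambda>x::real ^ 'n::finite. complex_of_real (x $ i))"
proof (rule smooth_coinduct[where P="\<lambda>g. g = (\<lambda>x. complex_of_real (x $ i)) \<or> (\<exists>c. g = (\<lambda>_. c))"])
  fix g :: "real ^ 'n \<Rightarrow> complex" and x
  assume "g = (\<lambda>x. complex_of_real (x $ i)) \<or> (\<exists>c. g = (\<lambda>_. c))"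
  moreover have "(\<lambda>x::real ^ 'n. complex_of_real (x $ i)) differentiable (at x)"
    by (intro bounded_linear_imp_differentiable bounded_linear_compose[OF bounded_linear_of_real]
        bounded_linear_vec_nth)
  ultimately show "g differentiable (at x)" by auto
next
  fix g :: "real ^ 'n \<Rightarrow> complex" and j
  assume "g = (\<lambda>x. complex_of_real (x $ i)) \<or> (\<exists>c. g = (\<lambda>_. c))"
  then show "partial_deriv j g = (\<lambda>x. complex_of_real (x $ i)) \<or> (\<exists>c. partial_deriv j g = (\<lambda>_. c))"
    by (auto simp: partial_const partial_coord)
qed auto

lemma partial_add:
  "f differentiable (at x) \<Longrightarrow> g differentiable (at x) \<Longrightarrow>
    partial_deriv j (\<lambda>x. f x + g x) x = partial_deriv j f x + partial_deriv j g x"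
  using partial_deriv_eq[OF has_derivative_add[OF has_derivative_partial has_derivative_partial]]
  by (simp add: sum_axis)

lemma partial_mult:
  "f differentiable (at x) \<Longrightarrow> g differentiable (at x) \<Longrightarrow>
    partial_deriv j (\<lambda>x. f x * g x) x = partial_deriv j f x * g x + f x * partial_deriv j g x"
  using partial_deriv_eq[OF has_derivative_mult[OF has_derivative_partial[of f x] has_derivative_partial[of g x]], of j]
  by (simp add: sum_axis add.commute)

text \<open>The algebra generated by the smooth functions is closed under differentiation, so it
  consists of smooth functions.\<close>

inductive smooth_alg :: "(real ^ 'n::finite \<Rightarrow> complex) \<Rightarrow> bool" where
  base: "smooth f \<Longrightarrow> smooth_alg f"
| add: "smooth_alg f \<Longrightarrow> smooth_alg g \<Longrightarrow> smooth_alg (\<lambda>x. f x + g x)"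
| mult: "smooth_alg f \<Longrightarrow> smooth_alg g \<Longrightarrow> smooth_alg (\<lambda>x. f x * g x)"

lemma smooth_alg_differentiable: "smooth_alg f \<Longrightarrow> f differentiable (at x)"
  by (induction rule: smooth_alg.induct) (auto simp: smooth_differentiable)

lemma smooth_alg_partial: "smooth_alg f \<Longrightarrow> smooth_alg (partial_deriv j f)"
proof (induction rule: smooth_alg.induct)
  case (base f)
  then show ?case by (simp add: smooth_alg.base smooth_partial)
next
  case (add f g)
  then have "partial_deriv j (\<lambda>x. f x + g x) = (\<lambda>x. partial_deriv j f x + partial_deriv j g x)"
    by (auto simp: partial_add smooth_alg_differentiable)
  then show ?case using add by (simp add: smooth_alg.add)
next
  case (mult f g)
  then have "partial_deriv j (\<lambda>x. f x * g x) =
      (\<lambda>x. partial_deriv j f x * g x + f x * partial_deriv j g x)"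
    by (auto simp: partial_mult smooth_alg_differentiable)
  then show ?case using mult by (simp add: smooth_alg.add smooth_alg.mult)
qed

lemma smooth_alg_smooth: "smooth_alg f \<Longrightarrow> smooth f"
  by (rule smooth_coinduct[where P=smooth_alg])
     (auto simp: smooth_alg_differentiable smooth_alg_partial)

lemma smooth_add: "smooth f \<Longrightarrow> smooth g \<Longrightarrow> smooth (\<lambda>x. f x + g x)"
  by (simp add: smooth_alg.add smooth_alg.base smooth_alg_smooth)

lemma smooth_mult: "smooth f \<Longrightarrow> smooth g \<Longrightarrow> smooth (\<lambda>x. f x * g x)"
  by (simp add: smooth_alg.mult smooth_alg.base smooth_alg_smooth)

lemma smooth_sum: "(\<And>i. i \<in> I \<Longrightarrow> smooth (f i)) \<Longrightarrow> smooth (\<lambda>x. \<Sum>i\<in>I. f i x)"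
  by (induction I rule: infinite_finite_induct) (auto simp: smooth_add)

section \<open>Affine substitutions, characters and conjugation\<close>

lemma partial_affine:
  fixes f :: "real ^ 'n::finite \<Rightarrow> complex"
  assumes "smooth f"
  shows "((\<lambda>x. f (a *\<^sub>R x + b)) has_derivative
      (\<lambda>v. \<Sum>j\<in>UNIV. of_real (v $ j) * (of_real a * partial_deriv j f (a *\<^sub>R x + b)))) (at x)"
    and "partial_deriv j (\<lambda>x. f (a *\<^sub>R x + b)) = (\<lambda>x. of_real a * partial_deriv j f (a *\<^sub>R x + b))"
proof -
  show *: "((\<lambda>x. f (a *\<^sub>R x + b)) has_derivative
      (\<lambda>v. \<Sum>j\<in>UNIV. of_real (v $ j) * (of_real a * partial_deriv j f (a *\<^sub>R x + b)))) (at x)" for x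
  proof -
    have "((\<lambda>x. a *\<^sub>R x + b) has_derivative (\<lambda>v. a *\<^sub>R v)) (at x)"
      by (auto intro!: derivative_eq_intros)
    from has_derivative_compose[OF this smooth_has_derivative[OF assms]]
    show ?thesis by (simp add: mult_ac)
  qed
  show "partial_deriv j (\<lambda>x. f (a *\<^sub>R x + b)) = (\<lambda>x. of_real a * partial_deriv j f (a *\<^sub>R x + b))"
    by (subst partial_deriv_at[OF *]) (simp add: sum_axis)
qed

lemma smooth_affine:
  fixes f :: "real ^ 'n::finite \<Rightarrow> complex"
  assumes "smooth f"
  shows "smooth (\<lambda>x. f (a *\<^sub>R x + b))"
\<comment> \<open>The class contains scalar multiples because the chain rule produces a factor
  \<open>a\<close> at each step.\<close>
proof (rule smooth_coinduct[where P="\<lambda>g. \<exists>f c. smooth f \<and> g = (\<lambda>x. c * f (a *\<^sub>R x + b))"])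
  show "\<exists>f' c. smooth f' \<and> (\<lambda>x. f (a *\<^sub>R x + b)) = (\<lambda>x. c * f' (a *\<^sub>R x + b))"
    using assms by (intro exI[of _ f] exI[of _ 1]) simp
next
  fix g :: "real ^ 'n \<Rightarrow> complex" and x
  assume "\<exists>f c. smooth f \<and> g = (\<lambda>x. c * f (a *\<^sub>R x + b))"
  then obtain f c where f: "smooth f" and g: "g = (\<lambda>x. c * f (a *\<^sub>R x + b))" by auto
  show "g differentiable (at x)"
    unfolding g using partial_affine(1)[OF f, of a b x]
    by (intro differentiable_mult differentiable_const) (auto simp: differentiable_def)
next
  fix g :: "real ^ 'n \<Rightarrow> complex" and j
  assume "\<exists>f c. smooth f \<and> g = (\<lambda>x. c * f (a *\<^sub>R x + b))"
  then obtain f c where f: "smooth f" and g: "g = (\<lambda>x. c * f (a *\<^sub>R x + b))" by auto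
  have d: "(\<lambda>x. f (a *\<^sub>R x + b)) differentiable (at x)" for x
    using partial_affine(1)[OF f] by (auto simp: differentiable_def)
  have "partial_deriv j g = (\<lambda>x. (c * of_real a) * partial_deriv j f (a *\<^sub>R x + b))"
    unfolding g by (rule ext) (simp add: partial_mult[OF _ d] partial_const partial_affine(2)[OF f])
  then show "\<exists>f c. smooth f \<and> partial_deriv j g = (\<lambda>x. c * f (a *\<^sub>R x + b))"
    using smooth_partial[OF f] by blast
qed

lemma smooth_shift:
  fixes f :: "real ^ 'n::finite \<Rightarrow> complex"
  shows "smooth f \<Longrightarrow> smooth (\<lambda>x. f (x - b))"
  using smooth_affine[of f 1 "- b"] by simp

lemma partial_shift:
  fixes f :: "real ^ 'n::finite \<Rightarrow> complex"
  shows "smooth f \<Longrightarrow> partial_deriv j (\<lambda>x. f (x - b)) = (\<lambda>x. partial_deriv j f (x - b))"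
  using partial_affine(2)[of f j 1 "- b"] by simp

lemma iter_partial_shift:
  fixes f :: "real ^ 'n::finite \<Rightarrow> complex"
  shows "smooth f \<Longrightarrow> iter_partial js (\<lambda>x. f (x - b)) = (\<lambda>x. iter_partial js f (x - b))"
  by (induction js) (auto simp: iter_partial_Cons partial_shift smooth_iter_partial)

lemma partial_cis:
  fixes a :: "real ^ 'n::finite"
  shows "((\<lambda>\<xi>. cis (a \<bullet> \<xi>)) has_derivative
      (\<lambda>v. \<Sum>j\<in>UNIV. of_real (v $ j) * (\<i> * of_real (a $ j) * cis (a \<bullet> \<xi>)))) (at \<xi>)"
    and "partial_deriv j (\<lambda>\<xi>. cis (a \<bullet> \<xi>)) = (\<lambda>\<xi>. \<i> * of_real (a $ j) * cis (a \<bullet> \<xi>))"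
proof -
  show *: "((\<lambda>\<xi>. cis (a \<bullet> \<xi>)) has_derivative
      (\<lambda>v. \<Sum>j\<in>UNIV. of_real (v $ j) * (\<i> * of_real (a $ j) * cis (a \<bullet> \<xi>)))) (at \<xi>)" for \<xi>
  proof -
    have "(\<lambda>v. \<Sum>j\<in>UNIV. of_real (v $ j) * (\<i> * of_real (a $ j) * cis (a \<bullet> \<xi>))) =
        (\<lambda>v. \<i> * of_real (a \<bullet> v) * cis (a \<bullet> \<xi>))"
      by (rule ext) (simp add: inner_vec_def sum_distrib_left sum_distrib_right mult_ac)
    moreover have "((\<lambda>\<xi>. cis (a \<bullet> \<xi>)) has_derivative (\<lambda>v. \<i> * of_real (a \<bullet> v) * cis (a \<bullet> \<xi>))) (at \<xi>)"
    proof -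
      have h: "((\<lambda>\<xi>. \<i> * complex_of_real (a \<bullet> \<xi>)) has_derivative (\<lambda>v. \<i> * of_real (a \<bullet> v))) (at \<xi>)"
        by (intro bounded_linear_imp_has_derivative bounded_linear_const_mult
            bounded_linear_compose[OF bounded_linear_of_real] bounded_linear_inner_right)
      show ?thesis
        unfolding cis_conv_exp
        using has_derivative_compose[OF h DERIV_exp[unfolded has_field_derivative_def]]
        by (simp add: mult_ac)
    qed
    ultimately show ?thesis by simp
  qed
  show "partial_deriv j (\<lambda>\<xi>. cis (a \<bullet> \<xi>)) = (\<lambda>\<xi>. \<i> * of_real (a $ j) * cis (a \<bullet> \<xi>))"
    by (subst partial_deriv_at[OF *]) (simp add: sum_axis)
qed

lemma smooth_cis [simp]: "smooth (\<lambda>\<xi>::real ^ 'n::finite. cis (a \<bullet> \<xi>))"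
proof (rule smooth_coinduct[where P="\<lambda>g. \<exists>c. g = (\<lambda>\<xi>. c * cis (a \<bullet> \<xi>))"])
  show "\<exists>c. (\<lambda>\<xi>. cis (a \<bullet> \<xi>)) = (\<lambda>\<xi>. c * cis (a \<bullet> \<xi>))" by (intro exI[of _ 1]) simp
next
  have d: "(\<lambda>\<xi>. cis (a \<bullet> \<xi>)) differentiable (at x)" for x
    using partial_cis(1)[of a] by (auto simp: differentiable_def)
  fix g :: "real ^ 'n \<Rightarrow> complex" and x j
  assume "\<exists>c. g = (\<lambda>\<xi>. c * cis (a \<bullet> \<xi>))"
  then obtain c where g: "g = (\<lambda>\<xi>. c * cis (a \<bullet> \<xi>))" by auto
  show "g differentiable (at x)" unfolding g using d by auto
  have "partial_deriv j g = (\<lambda>\<xi>. (c * \<i> * of_real (a $ j)) * cis (a \<bullet> \<xi>))"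
    unfolding g by (rule ext) (simp add: partial_mult[OF _ d] partial_const partial_cis(2))
  then show "\<exists>c. partial_deriv j g = (\<lambda>\<xi>. c * cis (a \<bullet> \<xi>))" by blast
qed

lemma smooth_cnj:
  fixes f :: "real ^ 'n::finite \<Rightarrow> complex"
  assumes "smooth f" shows "smooth (\<lambda>x. cnj (f x))"
proof -
  have *: "((\<lambda>x. cnj (f x)) has_derivative
      (\<lambda>v. cnj (\<Sum>j\<in>UNIV. of_real (v $ j) * partial_deriv j f x))) (at x)" if "smooth f" for f x
    by (rule bounded_linear.has_derivative[OF bounded_linear_cnj smooth_has_derivative[OF that]])
  show ?thesis
  proof (rule smooth_coinduct[where P="\<lambda>g. \<exists>f. smooth f \<and> g = (\<lambda>x. cnj (f x))"])
    fix g :: "real ^ 'n \<Rightarrow> complex" and x j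
    assume "\<exists>f. smooth f \<and> g = (\<lambda>x. cnj (f x))"
    then obtain f where f: "smooth f" "g = (\<lambda>x. cnj (f x))" by auto
    show "g differentiable (at x)" using *[OF f(1)] f(2) by (auto simp: differentiable_def)
    have "partial_deriv j g = (\<lambda>x. cnj (partial_deriv j f x))"
      unfolding f(2) by (subst partial_deriv_at[OF *[OF f(1)]]) (simp only: sum_axis)
    then show "\<exists>f. smooth f \<and> partial_deriv j g = (\<lambda>x. cnj (f x))"
      using smooth_partial[OF f(1)] by blast
  qed (use assms in auto)
qed

section \<open>Mean value and second-order Taylor estimates\<close>

lemma lipschitz_partial:
  fixes f :: "real ^ 'n::finite \<Rightarrow> complex"
  assumes "smooth f" "convex S" "\<And>j x. x \<in> S \<Longrightarrow> cmod (partial_deriv j f x) \<le> M"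
    and "x \<in> S" "y \<in> S"
  shows "cmod (f x - f y) \<le> real CARD('n) * M * norm (x - y)"
proof (rule differentiable_bound[OF assms(2) _ _ assms(4,5)])
  fix z assume "z \<in> S"
  show "(f has_derivative (\<lambda>v. \<Sum>j\<in>UNIV. of_real (v $ j) * partial_deriv j f z)) (at z within S)"
    by (rule has_derivative_at_withinI[OF smooth_has_derivative[OF assms(1)]])
  show "onorm (\<lambda>v. \<Sum>j\<in>UNIV. complex_of_real (v $ j) * partial_deriv j f z) \<le> real CARD('n) * M"
  proof (rule onorm_le)
    fix v :: "real ^ 'n"
    have "cmod (\<Sum>j\<in>UNIV. of_real (v $ j) * partial_deriv j f z) \<le>
        (\<Sum>j\<in>(UNIV::'n set). norm v * M)"
      using \<open>z \<in> S\<close> assms(3)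
      by (intro sum_norm_le) (auto simp: norm_mult intro!: mult_mono component_le_norm_cart)
    then show "cmod (\<Sum>j\<in>UNIV. of_real (v $ j) * partial_deriv j f z) \<le> real CARD('n) * M * norm v"
      by (simp add: mult_ac)
  qed
qed

text \<open>The mean value inequality for the difference of \<open>f\<close> and its linearisation
  at \<open>x\<close>: along the segment the derivative of this difference is governed by increments
  of the first partials, which are Lipschitz. Each of the two summations over coordinates costs a
  factor \<open>CARD('n)\<close>.\<close>

lemma quadratic_remainder:
  fixes f :: "real ^ 'n::finite \<Rightarrow> complex"
  assumes "smooth f" "\<And>i j x. cmod (partial_deriv i (partial_deriv j f) x) \<le> M"
  shows "cmod (f (x + v) - f x - (\<Sum>j\<in>UNIV. of_real (v $ j) * partial_deriv j f x))
    \<le> (real CARD('n))\<^sup>2 * M * (norm v)\<^sup>2"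
proof -
  have M: "0 \<le> M" using assms(2) norm_ge_zero order_trans by blast
  let ?f' = "\<lambda>z v. \<Sum>j\<in>UNIV. complex_of_real (v $ j) * partial_deriv j f z"
  let ?N = "real CARD('n)"
  have "norm (f (x + v) - f x - ?f' x ((x + v) - x)) \<le> norm ((x + v) - x) * (?N * (?N * M * norm v))"
  proof (rule differentiable_bound_linearization[where S="closed_segment x (x + v)"])
    show "x + t *\<^sub>R (x + v - x) \<in> closed_segment x (x + v)" if "t \<in> {0..1}" for t
      using that by (auto simp: in_segment algebra_simps)
    show "(f has_derivative ?f' z) (at z within closed_segment x (x + v))" for z
      by (rule has_derivative_at_withinI[OF smooth_has_derivative[OF assms(1)]])
    fix z assume z: "z \<in> closed_segment x (x + v)"
    have nz: "norm (z - x) \<le> norm v" using segment_bound[OF z] by (simp add: norm_minus_commute)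
    have d: "cmod (partial_deriv j f z - partial_deriv j f x) \<le> ?N * M * norm v" for j
      using lipschitz_partial[OF smooth_partial[OF assms(1)] convex_UNIV assms(2), of z x j] nz
      by (meson UNIV_I M mult_left_mono mult_nonneg_nonneg of_nat_0_le_iff order_trans)
    show "onorm (?f' z - ?f' x) \<le> ?N * (?N * M * norm v)"
    proof (rule onorm_le)
      fix w :: "real ^ 'n"
      have "(?f' z - ?f' x) w = (\<Sum>j\<in>UNIV. of_real (w $ j) * (partial_deriv j f z - partial_deriv j f x))"
        by (simp add: sum_subtractf right_diff_distrib)
      also have "cmod \<dots> \<le> (\<Sum>j\<in>(UNIV::'n set). norm w * (?N * M * norm v))"
        using d by (intro sum_norm_le) (auto simp: norm_mult intro!: mult_mono component_le_norm_cart)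
      finally show "norm ((?f' z - ?f' x) w) \<le> ?N * (?N * M * norm v) * norm w"
        by (simp add: mult_ac)
    qed
  qed auto
  then show ?thesis by (simp add: power2_eq_square mult_ac)
qed

section \<open>Differentiation under the integral sign\<close>

lemma norm_integral_le:
  fixes f :: "'a \<Rightarrow> complex"
  assumes "integrable M g" "\<And>x. x \<in> space M \<Longrightarrow> norm (f x) \<le> g x"
  shows "norm (\<integral>x. f x \<partial>M) \<le> (\<integral>x. g x \<partial>M)"
proof -
  have "norm (\<integral>x. f x \<partial>M) \<le> (\<integral>x. norm (f x) \<partial>M)" by (rule integral_norm_bound)
  also have "\<dots> \<le> (\<integral>x. g x \<partial>M)"
    using assms by (intro integral_mono') (auto intro: order_trans[OF norm_ge_zero])
  finally show ?thesis .
qed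

text \<open>Second-order smallness of the remainder avoids a dominated convergence argument.\<close>

lemma has_derivative_integral:
  fixes K :: "'a \<Rightarrow> real ^ 'n::finite \<Rightarrow> complex"
  assumes K: "\<And>y. integrable M (\<lambda>x. K x y)" and k: "\<And>j. integrable M (k j)"
    and B: "integrable M B"
    and bound: "\<And>x v. norm v \<le> 1 \<Longrightarrow>
      cmod (K x (y + v) - K x y - (\<Sum>j\<in>UNIV. of_real (v $ j) * k j x)) \<le> B x * (norm v)\<^sup>2"
  shows "((\<lambda>y. \<integral>x. K x y \<partial>M) has_derivative
    (\<lambda>v. \<Sum>j\<in>UNIV. of_real (v $ j) * (\<integral>x. k j x \<partial>M))) (at y)"
  unfolding has_derivative_at
proof (intro conjI)
  let ?L = "\<lambda>v. \<Sum>j\<in>UNIV. complex_of_real (v $ j) * (\<integral>x. k j x \<partial>M)"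
  show "bounded_linear ?L"
    by (intro bounded_linear_sum bounded_linear_mult_const
        bounded_linear_compose[OF bounded_linear_of_real] bounded_linear_vec_nth)
  define b where "b = (\<integral>x. B x \<partial>M)"
  have *: "cmod ((\<integral>x. K x (y + v) \<partial>M) - (\<integral>x. K x y \<partial>M) - ?L v) \<le> b * (norm v)\<^sup>2"
    if "norm v \<le> 1" for v
  proof -
    have "(\<integral>x. K x (y + v) \<partial>M) - (\<integral>x. K x y \<partial>M) - ?L v =
        (\<integral>x. K x (y + v) - K x y - (\<Sum>j\<in>UNIV. of_real (v $ j) * k j x) \<partial>M)"
      using K k by simp
    also have "cmod \<dots> \<le> (\<integral>x. B x * (norm v)\<^sup>2 \<partial>M)"
      using bound[OF that] B by (intro norm_integral_le) auto
    finally show ?thesis by (simp add: b_def)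
  qed
  show "(\<lambda>v. norm ((\<integral>x. K x (y + v) \<partial>M) - (\<integral>x. K x y \<partial>M) - ?L v) / norm v) \<midarrow>0\<rightarrow> 0"
  proof (rule Lim_null_comparison)
    show "\<forall>\<^sub>F v in at 0. norm (norm ((\<integral>x. K x (y + v) \<partial>M) - (\<integral>x. K x y \<partial>M) - ?L v) / norm v) \<le> b * norm v"
      unfolding eventually_at
    proof (intro exI[of _ 1] conjI ballI impI)
      fix v :: "real ^ 'n" assume "v \<noteq> 0 \<and> dist v 0 < 1"
      then show "norm (norm ((\<integral>x. K x (y + v) \<partial>M) - (\<integral>x. K x y \<partial>M) - ?L v) / norm v) \<le> b * norm v"
        using *[of v] by (simp add: divide_le_eq power2_eq_square mult_ac)
    qed simp
    show "((\<lambda>v. b * norm v) \<longlongrightarrow> 0) (at (0::real ^ 'n))"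
      by (auto intro!: tendsto_eq_intros)
  qed
qed

section \<open>Compactly supported smooth functions\<close>

text \<open>The class C_c^infinity. The radius may be negative (then \<open>h\<close> vanishes
  identically), which is why \<open>\<bar>R\<bar>\<close> appears in the estimates below.\<close>

definition test_fun :: "(real ^ 'n::finite \<Rightarrow> complex) \<Rightarrow> bool" where
  "test_fun h \<longleftrightarrow> smooth h \<and> (\<exists>R. \<forall>x. R < norm x \<longrightarrow> h x = 0)"

lemma test_fun_smooth: "test_fun h \<Longrightarrow> smooth h"
  by (simp add: test_fun_def)

lemma partial_zero_on_open:
  fixes f :: "real ^ 'n::finite \<Rightarrow> complex"
  assumes "open S" "\<And>x. x \<in> S \<Longrightarrow> f x = 0" "x \<in> S"
  shows "partial_deriv j f x = 0"
proof -
  have "((\<lambda>_. 0) has_derivative (\<lambda>_. 0)) (at x)" by simp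
  then have "(f has_derivative (\<lambda>_. 0)) (at x)"
    by (rule has_derivative_transform_within_open[OF _ assms(1,3)]) (simp add: assms(2))
  then show ?thesis by (rule partial_deriv_eq)
qed

lemma test_fun_partial:
  assumes "test_fun h" shows "test_fun (partial_deriv j h)"
proof -
  obtain R where R: "\<And>x. R < norm x \<Longrightarrow> h x = 0" using assms by (auto simp: test_fun_def)
  have "partial_deriv j h x = 0" if "R < norm x" for x
  proof (rule partial_zero_on_open[where S="{x. R < norm x}"])
    show "open {x :: real ^ 'a. R < norm x}" by (intro open_Collect_less continuous_intros)
  qed (use that R in auto)
  then show ?thesis using assms by (auto simp: test_fun_def smooth_partial)
qed

lemma test_fun_mult: "smooth f \<Longrightarrow> test_fun g \<Longrightarrow> test_fun (\<lambda>x. f x * g x)"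
  by (auto simp: test_fun_def smooth_mult)

lemma test_fun_add:
  assumes "test_fun f" "test_fun g" shows "test_fun (\<lambda>x. f x + g x)"
proof -
  obtain R S where "\<And>x. R < norm x \<Longrightarrow> f x = 0" "\<And>x. S < norm x \<Longrightarrow> g x = 0"
    using assms by (auto simp: test_fun_def)
  then have "f x + g x = 0" if "max R S < norm x" for x using that by auto
  then have "\<exists>R. \<forall>x. R < norm x \<longrightarrow> f x + g x = 0" by blast
  then show ?thesis using assms by (simp add: test_fun_def smooth_add)
qed

lemma test_fun_zero [simp]: "test_fun (\<lambda>_. 0)"
  by (auto simp: test_fun_def)

lemma test_fun_sum: "(\<And>i. i \<in> I \<Longrightarrow> test_fun (f i)) \<Longrightarrow> test_fun (\<lambda>x. \<Sum>i\<in>I. f i x)"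
  by (induction I rule: infinite_finite_induct) (auto simp: test_fun_add)

lemma test_fun_affine:
  fixes h :: "real ^ 'n::finite \<Rightarrow> complex"
  assumes "test_fun h" "a \<noteq> 0" shows "test_fun (\<lambda>x. h (a *\<^sub>R x + b))"
proof -
  obtain R where R: "\<And>x. R < norm x \<Longrightarrow> h x = 0" using assms by (auto simp: test_fun_def)
  have "h (a *\<^sub>R x + b) = 0" if "(\<bar>R\<bar> + norm b) / \<bar>a\<bar> < norm x" for x
  proof (rule R)
    have "\<bar>R\<bar> + norm b < \<bar>a\<bar> * norm x" using that assms(2) by (simp add: divide_less_eq mult.commute)
    also have "\<dots> = norm ((a *\<^sub>R x + b) - b)" by simp
    also have "\<dots> \<le> norm (a *\<^sub>R x + b) + norm b" by (rule norm_triangle_ineq4)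
    finally show "R < norm (a *\<^sub>R x + b)" by simp
  qed
  then show ?thesis using assms smooth_affine[of h a b] by (auto simp: test_fun_def)
qed

lemma test_fun_shift:
  fixes h :: "real ^ 'n::finite \<Rightarrow> complex"
  shows "test_fun h \<Longrightarrow> test_fun (\<lambda>x. h (x - b))"
  using test_fun_affine[of h 1 "- b"] by simp

lemma test_fun_bounded:
  fixes h :: "real ^ 'n::finite \<Rightarrow> complex"
  assumes "test_fun h"
  obtains C where "0 \<le> C" "\<And>x. cmod (h x) \<le> C"
proof -
  obtain R where R: "\<And>x. R < norm x \<Longrightarrow> h x = 0" using assms by (auto simp: test_fun_def)
  have "compact (h ` cball 0 R)"
    using assms by (intro compact_continuous_image smooth_continuous_on) (auto simp: test_fun_def)
  then obtain C where C: "\<And>x. x \<in> cball 0 R \<Longrightarrow> cmod (h x) \<le> C"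
    by (metis bounded_iff compact_imp_bounded imageI)
  have "cmod (h x) \<le> max 0 C" for x
    using C[of x] R[of x] by (cases "norm x \<le> R") auto
  then show ?thesis using that[of "max 0 C"] by simp
qed

lemma test_fun_integrable:
  fixes h :: "real ^ 'n::finite \<Rightarrow> complex"
  assumes "test_fun h" shows "integrable lborel h"
proof -
  obtain R where R: "\<And>x. R < norm x \<Longrightarrow> h x = 0" using assms by (auto simp: test_fun_def)
  have "integrable lborel (\<lambda>x. indicator (cball 0 R) x *\<^sub>R h x)"
    using assms by (intro borel_integrable_compact smooth_continuous_on) (auto simp: test_fun_def)
  moreover have "(\<lambda>x. indicator (cball 0 R) x *\<^sub>R h x) = h"
    using R by (auto simp: indicator_def fun_eq_iff not_le)
  ultimately show ?thesis by simp
qed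

lemma test_fun_measurable [measurable_dest]: "test_fun h \<Longrightarrow> h \<in> borel_measurable borel"
  by (auto simp: test_fun_def smooth_measurable)

section \<open>Affine substitutions and Fubini's theorem\<close>

lemma lborel_affine_substitution:
  fixes t :: "'a::euclidean_space"
  assumes c: "c \<noteq> 0"
  shows lborel_nn_integral_affine: "g \<in> borel_measurable borel \<Longrightarrow>
      (\<integral>\<^sup>+x. g x \<partial>lborel) = ennreal (\<bar>c\<bar> ^ DIM('a)) * (\<integral>\<^sup>+x. g (t + c *\<^sub>R x) \<partial>lborel)"
    and lborel_integral_affine: "f \<in> borel_measurable borel \<Longrightarrow>
      (\<integral>x. f x \<partial>lborel) = \<bar>c\<bar> ^ DIM('a) *\<^sub>R (\<integral>x. (f (t + c *\<^sub>R x) :: 'b::{banach, second_countable_topology}) \<partial>lborel)"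
    and lborel_integrable_affine: "integrable lborel f \<Longrightarrow> integrable lborel (\<lambda>x. f (t + c *\<^sub>R x))"
proof -
  let ?D = "density (distr lborel borel (\<lambda>x. t + c *\<^sub>R x)) (\<lambda>_. ennreal (\<bar>c\<bar> ^ DIM('a)))"
  have D: "lborel = ?D" by (rule lborel_affine[OF c])
  show "(\<integral>\<^sup>+x. g x \<partial>lborel) = ennreal (\<bar>c\<bar> ^ DIM('a)) * (\<integral>\<^sup>+x. g (t + c *\<^sub>R x) \<partial>lborel)"
    if [measurable]: "g \<in> borel_measurable borel"
  proof -
    have "(\<integral>\<^sup>+x. g x \<partial>lborel) = (\<integral>\<^sup>+x. g x \<partial>?D)" using D by (rule arg_cong)
    also have "\<dots> = ennreal (\<bar>c\<bar> ^ DIM('a)) * (\<integral>\<^sup>+x. g (t + c *\<^sub>R x) \<partial>lborel)"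
      by (simp add: nn_integral_density nn_integral_distr nn_integral_cmult)
    finally show ?thesis .
  qed
  show "(\<integral>x. f x \<partial>lborel) = \<bar>c\<bar> ^ DIM('a) *\<^sub>R (\<integral>x. f (t + c *\<^sub>R x) \<partial>lborel)"
    if [measurable]: "f \<in> borel_measurable borel"
  proof -
    have "(\<integral>x. f x \<partial>lborel) = (\<integral>x. f x \<partial>?D)" using D by (rule arg_cong)
    also have "\<dots> = \<bar>c\<bar> ^ DIM('a) *\<^sub>R (\<integral>x. f (t + c *\<^sub>R x) \<partial>lborel)"
      by (simp add: integral_density integral_distr)
    finally show ?thesis .
  qed
  show "integrable lborel (\<lambda>x. f (t + c *\<^sub>R x))" if f: "integrable lborel f"
  proof -
    have [measurable]: "f \<in> borel_measurable borel" using f by auto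
    have "integrable ?D f" using f D by metis
    then have "integrable lborel (\<lambda>x. \<bar>c\<bar> ^ DIM('a) *\<^sub>R f (t + c *\<^sub>R x))"
      by (simp add: integrable_density integrable_distr_eq)
    then have "integrable lborel (\<lambda>x. (1 / \<bar>c\<bar> ^ DIM('a)) *\<^sub>R (\<bar>c\<bar> ^ DIM('a) *\<^sub>R f (t + c *\<^sub>R x)))"
      by (rule integrable_scaleR_right)
    then show ?thesis using c by simp
  qed
qed

lemma lborel_nn_integral_shift:
  fixes t :: "'a::euclidean_space"
  shows "g \<in> borel_measurable borel \<Longrightarrow> (\<integral>\<^sup>+x. g (t + x) \<partial>lborel) = (\<integral>\<^sup>+x. g x \<partial>lborel)"
  using lborel_nn_integral_affine[of 1 g t] by simp

lemma lborel_integral_shift: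
  fixes t :: "'a::euclidean_space" and f :: "'a \<Rightarrow> 'b::{banach, second_countable_topology}"
  shows "f \<in> borel_measurable borel \<Longrightarrow> (\<integral>x. f (t + x) \<partial>lborel) = (\<integral>x. f x \<partial>lborel)"
  using lborel_integral_affine[of 1 f t] by simp

lemma lborel_integrable_shift:
  fixes t :: "'a::euclidean_space" and f :: "'a \<Rightarrow> 'b::{banach, second_countable_topology}"
  shows "integrable lborel f \<Longrightarrow> integrable lborel (\<lambda>x. f (t + x))"
  using lborel_integrable_affine[of 1 f t] by simp

lemma integrable_tensor:
  fixes a :: "'a::euclidean_space \<Rightarrow> complex" and b :: "'b::euclidean_space \<Rightarrow> complex"
    and k :: "'a \<Rightarrow> 'b \<Rightarrow> complex"
  assumes a: "integrable lborel a" and b: "integrable lborel b"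
    and k[measurable]: "(\<lambda>(x, y). k x y) \<in> borel_measurable (borel \<Otimes>\<^sub>M borel)"
    and bound: "\<And>x y. cmod (k x y) \<le> B"
  shows "integrable (lborel \<Otimes>\<^sub>M lborel) (\<lambda>(x, y). a x * b y * k x y)"
proof -
  have [measurable]: "a \<in> borel_measurable borel" "b \<in> borel_measurable borel" using a b by auto
  have k': "(\<lambda>z. k (fst z) (snd z)) \<in> borel_measurable (borel \<Otimes>\<^sub>M borel)"
    using k by (simp add: case_prod_beta')
  have "integrable (lborel \<Otimes>\<^sub>M lborel) (\<lambda>(x, y). a x * b y)"
  proof (rule lborel_pair.Fubini_integrable)
    show "integrable lborel (\<lambda>x. \<integral>y. norm (case (x, y) of (x, y) \<Rightarrow> a x * b y) \<partial>lborel)"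
      using a by (simp add: norm_mult)
    show "AE x in lborel. integrable lborel (\<lambda>y. case (x, y) of (x, y) \<Rightarrow> a x * b y)"
      using b by simp
  qed measurable
  then have i: "integrable (lborel \<Otimes>\<^sub>M lborel) (\<lambda>z. of_real B * (a (fst z) * b (snd z)))"
    by (intro integrable_mult_right) (simp add: case_prod_beta')
  have "integrable (lborel \<Otimes>\<^sub>M lborel) (\<lambda>z. a (fst z) * b (snd z) * k (fst z) (snd z))"
  proof (rule Bochner_Integration.integrable_bound[OF i])
    have "cmod (a x * b y * k x y) \<le> cmod (of_real B * (a x * b y))" for x y
    proof -
      have "cmod (k x y) \<le> \<bar>B\<bar>" using bound[of x y] by linarith
      then show ?thesis by (simp add: norm_mult mult.commute mult_right_mono)
    qed
    then show "AE z in lborel \<Otimes>\<^sub>M lborel. cmod (a (fst z) * b (snd z) * k (fst z) (snd z))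
        \<le> cmod (of_real B * (a (fst z) * b (snd z)))" by simp
  qed (use k' in \<open>simp add: borel_measurable_times measurable_compose[OF measurable_fst] measurable_compose[OF measurable_snd]\<close>)
  then show ?thesis by (simp add: case_prod_beta')
qed

text \<open>In the applications the kernel \<open>k\<close> is a character, so \<open>B\<close> is
  1; a bounded kernel leaves the integrability of the tensor product \<open>a x * b y\<close>
  intact.\<close>

lemma fubini_tensor:
  fixes a :: "'a::euclidean_space \<Rightarrow> complex" and b :: "'b::euclidean_space \<Rightarrow> complex"
    and k :: "'a \<Rightarrow> 'b \<Rightarrow> complex"
  assumes "integrable lborel a" and "integrable lborel b"
    and "(\<lambda>(x, y). k x y) \<in> borel_measurable (borel \<Otimes>\<^sub>M borel)"
    and "\<And>x y. cmod (k x y) \<le> B"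
  shows "(\<integral>x. a x * (\<integral>y. k x y * b y \<partial>lborel) \<partial>lborel) = (\<integral>y. b y * (\<integral>x. k x y * a x \<partial>lborel) \<partial>lborel)"
proof -
  have "(\<integral>y. (\<integral>x. a x * b y * k x y \<partial>lborel) \<partial>lborel) = (\<integral>x. (\<integral>y. a x * b y * k x y \<partial>lborel) \<partial>lborel)"
    by (rule lborel_pair.Fubini_integral[OF integrable_tensor[OF assms]])
  moreover have "(\<integral>x. a x * b y * k x y \<partial>lborel) = b y * (\<integral>x. k x y * a x \<partial>lborel)" for y
    by (subst integral_mult_right_zero[symmetric]) (simp add: mult_ac)
  moreover have "(\<integral>y. a x * b y * k x y \<partial>lborel) = a x * (\<integral>y. k x y * b y \<partial>lborel)" for x
    by (subst integral_mult_right_zero[symmetric]) (simp add: mult_ac)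
  ultimately show ?thesis by simp
qed

section \<open>Fourier transforms of test functions\<close>

text \<open>The integral of \<open>u (x + y)\<close> over \<open>x\<close> does not depend on
  \<open>y\<close>. Differentiating under the integral sign at \<open>y = 0\<close> therefore gives
  zero, which replaces integration along coordinate lines.\<close>

lemma integral_partial_test_fun:
  fixes u :: "real ^ 'n::finite \<Rightarrow> complex"
  assumes u: "test_fun u"
  shows "(\<integral>x. partial_deriv j u x \<partial>lborel) = 0"
proof -
  obtain R where R: "\<And>x. R < norm x \<Longrightarrow> u x = 0" using u by (auto simp: test_fun_def)
  have "\<exists>C. \<forall>x. cmod (partial_deriv i (partial_deriv j u) x) \<le> C" for i j
    using test_fun_bounded[OF test_fun_partial[OF test_fun_partial[OF u]]] by metis
  then obtain C where C: "\<And>i j x. cmod (partial_deriv i (partial_deriv j u) x) \<le> C i j" by metis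
  define M where "M = (\<Sum>i\<in>UNIV. \<Sum>j\<in>UNIV. C i j)"
  have C0: "0 \<le> C i j" for i j using C norm_ge_zero order_trans by blast
  have M: "cmod (partial_deriv i (partial_deriv j u) x) \<le> M" for i j x
  proof -
    have "C i j \<le> (\<Sum>j\<in>UNIV. C i j)" using C0 by (intro member_le_sum) auto
    also have "\<dots> \<le> M" unfolding M_def using C0 by (intro member_le_sum sum_nonneg) auto
    finally show ?thesis using C order_trans by blast
  qed
  have pz: "partial_deriv j u x = 0" if "R < norm x" for j x
    using R that by (intro partial_zero_on_open[where S="{x. R < norm x}"])
      (auto intro!: open_Collect_less continuous_intros)
  have "((\<lambda>y. \<integral>x. u (x + y) \<partial>lborel) has_derivative
      (\<lambda>v. \<Sum>j\<in>UNIV. of_real (v $ j) * (\<integral>x. partial_deriv j u x \<partial>lborel))) (at 0)"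
  proof (rule has_derivative_integral)
    show "integrable lborel (\<lambda>x. u (x + y))" for y
      using lborel_integrable_shift[OF test_fun_integrable[OF u], of y] by (simp add: add.commute)
    show "integrable lborel (partial_deriv j u)" for j
      by (intro test_fun_integrable test_fun_partial u)
    \<comment> \<open>The constant bound of the remainder becomes integrable after a cut-off. The
      extra 1 in the radius accounts for the shift by \<open>v\<close> of norm at most 1.\<close>
    show "integrable lborel (\<lambda>x::real ^ 'n. (real CARD('n))\<^sup>2 * M * indicator (cball 0 (\<bar>R\<bar> + 1)) x :: real)"
      using emeasure_bounded_finite[OF bounded_cball, of "0::real ^ 'n" "\<bar>R\<bar> + 1"]
      by (intro integrable_mult_right integrable_real_indicator) auto
    fix x v :: "real ^ 'n" assume v: "norm v \<le> 1"
    show "cmod (u (x + (0 + v)) - u (x + 0) - (\<Sum>j\<in>UNIV. of_real (v $ j) * partial_deriv j u x))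
        \<le> (real CARD('n))\<^sup>2 * M * indicator (cball 0 (\<bar>R\<bar> + 1)) x * (norm v)\<^sup>2"
    proof (cases "norm x \<le> \<bar>R\<bar> + 1")
      case True
      then show ?thesis using quadratic_remainder[OF test_fun_smooth[OF u] M, of x v] by simp
    next
      case False
      then have "R < norm x" by linarith
      moreover have "norm x \<le> norm (x + v) + norm v" using norm_triangle_ineq4[of "x + v" v] by simp
      then have "R < norm (x + v)" using False v by linarith
      ultimately show ?thesis using False by (simp add: R pz)
    qed
  qed
  moreover have "(\<integral>x. u (x + y) \<partial>lborel) = (\<integral>x. u x \<partial>lborel)" for y
    using lborel_integral_shift[of u y] test_fun_measurable[OF u] by (simp add: add.commute)
  ultimately have "((\<lambda>y. \<integral>x. u x \<partial>lborel) has_derivative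
      (\<lambda>v::real ^ 'n. \<Sum>j\<in>UNIV. of_real (v $ j) * (\<integral>x. partial_deriv j u x \<partial>lborel))) (at 0)" by simp
  moreover have "((\<lambda>y. \<integral>x. u x \<partial>lborel) has_derivative (\<lambda>_::real ^ 'n. 0)) (at 0)" by simp
  ultimately have "(\<lambda>v::real ^ 'n. \<Sum>j\<in>UNIV. of_real (v $ j) * (\<integral>x. partial_deriv j u x \<partial>lborel)) = (\<lambda>_. 0)"
    by (rule has_derivative_unique)
  from fun_cong[OF this, of "axis j 1"] show ?thesis by (simp add: sum_axis)
qed

lemma cis_remainder: "cmod (cis t - 1 - \<i> * of_real t) \<le> t\<^sup>2"
proof -
  have "2 * cmod (cis t - 1 - \<i> * of_real t) \<le> t\<^sup>2"
    using iexp_approx1[of t 1] by (simp add: cis_conv_exp numeral_2_eq_2 algebra_simps)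
  then show ?thesis using norm_ge_zero[of "cis t - 1 - \<i> * of_real t"] by linarith
qed

lemma inv_fourier_eq: "inv_fourier h x = fourier h (- x)"
  by (simp add: inv_fourier_def fourier_def inner_commute)

lemma smooth_cis_neg [simp]: "smooth (\<lambda>x::real ^ 'n::finite. cis (- (2 * pi * (x \<bullet> y))))"
  using smooth_cis[of "(- (2 * pi)) *\<^sub>R y"] by (simp add: inner_commute)

lemma partial_cis_neg:
  fixes y :: "real ^ 'n::finite"
  shows "partial_deriv j (\<lambda>x. cis (- (2 * pi * (x \<bullet> y)))) =
      (\<lambda>x. - (2 * pi * \<i> * of_real (y $ j)) * cis (- (2 * pi * (x \<bullet> y))))"
  using partial_cis(2)[of j "(- (2 * pi)) *\<^sub>R y"] by (simp add: inner_commute mult_ac)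

lemma measurable_cis [measurable]: "cis \<in> borel_measurable borel"
  by (intro borel_measurable_continuous_onI continuous_intros)

lemma integrable_cis_mult:
  fixes h :: "'a::euclidean_space \<Rightarrow> complex"
  assumes h: "integrable lborel h" and [measurable]: "t \<in> borel_measurable borel"
  shows "integrable lborel (\<lambda>x. cis (t x) * h x)"
proof (rule Bochner_Integration.integrable_bound[OF h])
  have [measurable]: "h \<in> borel_measurable borel" using h by auto
  show "(\<lambda>x. cis (t x) * h x) \<in> borel_measurable lborel" by measurable
qed (simp add: norm_mult)

lemma fourier_bounded:
  fixes h :: "real ^ 'n::finite \<Rightarrow> complex"
  assumes "integrable lborel h" shows "cmod (fourier h x) \<le> (\<integral>x. cmod (h x) \<partial>lborel)"
  unfolding fourier_def using assms by (intro norm_integral_le) (auto simp: norm_mult)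

text \<open>The second-order error of the character exp(-2 pi i x . y) in \<open>y\<close> is at
  most 4 pi^2 |x|^2 |v|^2, and compact support makes |x|^2 h(x) integrable.\<close>

lemma fourier_has_derivative:
  fixes h :: "real ^ 'n::finite \<Rightarrow> complex"
  assumes h: "test_fun h"
  shows "(fourier h has_derivative (\<lambda>v. \<Sum>j\<in>UNIV. of_real (v $ j) *
      fourier (\<lambda>\<xi>. - (2 * pi * \<i>) * of_real (\<xi> $ j) * h \<xi>) y)) (at y)"
proof -
  have th: "test_fun (\<lambda>\<xi>. - (2 * pi * \<i>) * of_real (\<xi> $ j) * h \<xi>)" for j
    by (intro test_fun_mult smooth_mult h) auto
  \<comment> \<open>The square of the norm is written as a polynomial in the coordinates, which
    makes its smoothness visible.\<close>
  have tn: "test_fun (\<lambda>\<xi>. (\<Sum>i\<in>UNIV. of_real (\<xi> $ i) * of_real (\<xi> $ i)) * h \<xi>)"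
    by (intro test_fun_mult smooth_sum smooth_mult h) auto
  have "(\<Sum>i\<in>UNIV. complex_of_real (\<xi> $ i) * of_real (\<xi> $ i)) = of_real ((norm \<xi>)\<^sup>2)" for \<xi> :: "real ^ 'n"
    by (simp add: power2_norm_eq_inner inner_vec_def)
  with test_fun_integrable[OF tn] have "integrable lborel (\<lambda>\<xi>. of_real ((norm \<xi>)\<^sup>2) * h \<xi>)" by simp
  then have i2: "integrable lborel (\<lambda>\<xi>. 4 * pi\<^sup>2 * cmod (of_real ((norm \<xi>)\<^sup>2) * h \<xi>))"
    by (intro integrable_mult_right integrable_norm)
  have "((\<lambda>y. \<integral>x. cis (- (2 * pi * (x \<bullet> y))) * h x \<partial>lborel) has_derivative (\<lambda>v. \<Sum>j\<in>UNIV. of_real (v $ j) *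
      (\<integral>x. cis (- (2 * pi * (x \<bullet> y))) * (- (2 * pi * \<i>) * of_real (x $ j) * h x) \<partial>lborel))) (at y)"
  proof (rule has_derivative_integral[OF _ _ i2])
    show "integrable lborel (\<lambda>x. cis (- (2 * pi * (x \<bullet> y))) * h x)" for y
      by (intro integrable_cis_mult test_fun_integrable h) auto
    show "integrable lborel (\<lambda>x. cis (- (2 * pi * (x \<bullet> y))) * (- (2 * pi * \<i>) * of_real (x $ j) * h x))" for j
      by (rule integrable_cis_mult[OF test_fun_integrable[OF th]]) auto
    fix x v :: "real ^ 'n"
    let ?t = "- (2 * pi * (x \<bullet> v))"
    have "(\<Sum>j\<in>UNIV. of_real (v $ j) * (cis (- (2 * pi * (x \<bullet> y))) * (- (2 * pi * \<i>) * of_real (x $ j) * h x)))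
        = cis (- (2 * pi * (x \<bullet> y))) * h x * (\<i> * of_real ?t)"
      by (simp add: inner_vec_def sum_distrib_left sum_negf mult_ac)
    moreover have "cis (- (2 * pi * (x \<bullet> (y + v)))) = cis (- (2 * pi * (x \<bullet> y))) * cis ?t"
      by (simp add: cis_mult inner_add_right algebra_simps)
    ultimately have "cis (- (2 * pi * (x \<bullet> (y + v)))) * h x - cis (- (2 * pi * (x \<bullet> y))) * h x -
        (\<Sum>j\<in>UNIV. of_real (v $ j) * (cis (- (2 * pi * (x \<bullet> y))) * (- (2 * pi * \<i>) * of_real (x $ j) * h x)))
        = cis (- (2 * pi * (x \<bullet> y))) * h x * (cis ?t - 1 - \<i> * of_real ?t)"
      by (simp add: algebra_simps)
    also have "cmod \<dots> \<le> cmod (h x) * ?t\<^sup>2"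
      using cis_remainder[of ?t] by (simp add: norm_mult mult_left_mono)
    also have "\<dots> \<le> cmod (h x) * (4 * pi\<^sup>2 * ((norm x)\<^sup>2 * (norm v)\<^sup>2))"
    proof -
      have "(x \<bullet> v)\<^sup>2 \<le> (norm x)\<^sup>2 * (norm v)\<^sup>2"
        using Cauchy_Schwarz_ineq[of x v] by (simp add: power2_norm_eq_inner)
      then show ?thesis by (intro mult_left_mono) (simp_all add: power_mult_distrib)
    qed
    finally show "cmod (cis (- (2 * pi * (x \<bullet> (y + v)))) * h x - cis (- (2 * pi * (x \<bullet> y))) * h x -
        (\<Sum>j\<in>UNIV. of_real (v $ j) * (cis (- (2 * pi * (x \<bullet> y))) * (- (2 * pi * \<i>) * of_real (x $ j) * h x))))
        \<le> 4 * pi\<^sup>2 * cmod (of_real ((norm x)\<^sup>2) * h x) * (norm v)\<^sup>2"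
      by (simp add: norm_mult mult_ac norm_power)
  qed
  then show ?thesis by (simp add: fourier_def[abs_def])
qed

lemma partial_fourier:
  fixes h :: "real ^ 'n::finite \<Rightarrow> complex"
  assumes "test_fun h"
  shows "partial_deriv j (fourier h) = fourier (\<lambda>\<xi>. - (2 * pi * \<i>) * of_real (\<xi> $ j) * h \<xi>)"
  by (subst partial_deriv_at[OF fourier_has_derivative[OF assms]]) (simp add: sum_axis)

text \<open>Multiplication by a coordinate preserves compactly supported smooth functions. Hence
  bounds on all derivatives of a Fourier transform follow from bounds on Fourier transforms
  themselves.\<close>

lemma iter_partial_fourier:
  fixes h :: "real ^ 'n::finite \<Rightarrow> complex"
  assumes "test_fun h"
  shows "\<exists>h'. test_fun h' \<and> iter_partial js (fourier h) = fourier h'"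
proof (induction js)
  case Nil
  then show ?case using assms by auto
next
  case (Cons j js)
  then obtain h' where h': "test_fun h'" "iter_partial js (fourier h) = fourier h'" by auto
  show ?case
    by (intro exI[of _ "\<lambda>\<xi>. - (2 * pi * \<i>) * of_real (\<xi> $ j) * h' \<xi>"] conjI test_fun_mult smooth_mult)
       (auto simp: iter_partial_Cons h' partial_fourier)
qed

lemma smooth_fourier:
  fixes h :: "real ^ 'n::finite \<Rightarrow> complex"
  assumes "test_fun h" shows "smooth (fourier h)"
proof -
  have "fourier h' differentiable (at x)" if "test_fun h'" for h' :: "real ^ 'n \<Rightarrow> complex" and x
    using fourier_has_derivative[OF that] by (auto simp: differentiable_def)
  then show ?thesis using iter_partial_fourier[OF assms] unfolding smooth_def by metis
qed

text \<open>Integration by parts: the integral of the derivative of the character times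
  \<open>h\<close> vanishes, and the product rule splits it into the two sides.\<close>

lemma fourier_partial:
  fixes h :: "real ^ 'n::finite \<Rightarrow> complex"
  assumes h: "test_fun h"
  shows "fourier (partial_deriv j h) y = 2 * pi * \<i> * of_real (y $ j) * fourier h y"
proof -
  let ?e = "\<lambda>x. cis (- (2 * pi * (x \<bullet> y)))"
  have "partial_deriv j (\<lambda>x. ?e x * h x) =
      (\<lambda>x. - (2 * pi * \<i> * of_real (y $ j)) * (?e x * h x) + ?e x * partial_deriv j h x)"
    by (rule ext) (simp add: partial_mult smooth_differentiable test_fun_smooth[OF h] partial_cis_neg)
  then have "0 = (\<integral>x. - (2 * pi * \<i> * of_real (y $ j)) * (?e x * h x) + ?e x * partial_deriv j h x \<partial>lborel)"
    using integral_partial_test_fun[OF test_fun_mult[OF smooth_cis_neg h], of j y] by simp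
  also have "\<dots> = (\<integral>x. - (2 * pi * \<i> * of_real (y $ j)) * (?e x * h x) \<partial>lborel) + (\<integral>x. ?e x * partial_deriv j h x \<partial>lborel)"
    by (intro Bochner_Integration.integral_add integrable_mult_right integrable_cis_mult
        test_fun_integrable test_fun_partial h) auto
  also have "\<dots> = - (2 * pi * \<i> * of_real (y $ j)) * fourier h y + fourier (partial_deriv j h) y"
    unfolding fourier_def by simp
  finally show ?thesis by (simp add: algebra_simps)
qed

lemma fourier_add:
  fixes f g :: "real ^ 'n::finite \<Rightarrow> complex"
  assumes "integrable lborel f" "integrable lborel g"
  shows "fourier (\<lambda>x. f x + g x) y = fourier f y + fourier g y"
proof -
  have *: "integrable lborel (\<lambda>x. cis (- (2 * pi * (x \<bullet> y))) * f x)" if "integrable lborel f"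
    for f :: "real ^ 'n \<Rightarrow> complex"
    by (rule integrable_cis_mult[OF that]) auto
  show ?thesis unfolding fourier_def using *[OF assms(1)] *[OF assms(2)] by (simp add: distrib_left)
qed

lemma fourier_sum:
  fixes f :: "'i \<Rightarrow> real ^ 'n::finite \<Rightarrow> complex"
  assumes "\<And>i. i \<in> I \<Longrightarrow> integrable lborel (f i)"
  shows "fourier (\<lambda>x. \<Sum>i\<in>I. f i x) y = (\<Sum>i\<in>I. fourier (f i) y)"
  using assms
proof (induction I rule: infinite_finite_induct)
  case (insert i I)
  then have "fourier (\<lambda>x. \<Sum>i\<in>insert i I. f i x) y = fourier (\<lambda>x. f i x + (\<Sum>i\<in>I. f i x)) y" by simp
  also have "\<dots> = fourier (f i) y + fourier (\<lambda>x. \<Sum>i\<in>I. f i x) y"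
    using insert by (intro fourier_add) auto
  finally show ?case using insert by simp
qed (simp_all add: fourier_def)

lemma fourier_cmult: "fourier (\<lambda>x. c * f x) y = c * fourier f y"
  unfolding fourier_def by (subst integral_mult_right_zero[symmetric]) (simp add: mult_ac)

text \<open>The operator 1 - \<Delta>/(4 pi^2). In the present normalisation of the Fourier
  transform its symbol is exactly \<langle>y\<rangle>^2, so its powers generate the weights of the
  Schwartz seminorms.\<close>

definition bessel_op :: "(real ^ 'n::finite \<Rightarrow> complex) \<Rightarrow> real ^ 'n \<Rightarrow> complex" where
  "bessel_op h x = h x + (\<Sum>j\<in>UNIV. - (1 / (4 * pi\<^sup>2)) * partial_deriv j (partial_deriv j h) x)"

lemma test_fun_bessel_op: "test_fun h \<Longrightarrow> test_fun (bessel_op h)"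
  unfolding bessel_op_def[abs_def]
  by (intro test_fun_add test_fun_sum test_fun_mult test_fun_partial) auto

lemma japanese_squared: "(japanese x)\<^sup>2 = 1 + (norm x)\<^sup>2"
  unfolding japanese_def by (rule real_sqrt_pow2) (simp add: add_nonneg_nonneg)

lemma fourier_bessel_op:
  fixes h :: "real ^ 'n::finite \<Rightarrow> complex"
  assumes h: "test_fun h"
  shows "fourier (bessel_op h) y = of_real ((japanese y)\<^sup>2) * fourier h y"
proof -
  have i: "test_fun (\<lambda>x. - (1 / (4 * pi\<^sup>2)) * partial_deriv j (partial_deriv j h) x)" for j
    by (intro test_fun_mult test_fun_partial h) auto
  have "fourier (bessel_op h) y = fourier h y +
      (\<Sum>j\<in>UNIV. fourier (\<lambda>x. - (1 / (4 * pi\<^sup>2)) * partial_deriv j (partial_deriv j h) x) y)"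
    unfolding bessel_op_def[abs_def] using h test_fun_integrable[OF i]
    by (subst fourier_add)
      (auto simp del: mult_minus_left mult_minus_right times_divide_eq_left simp: test_fun_integrable
        intro!: fourier_sum)
  also have "(\<Sum>j\<in>UNIV. fourier (\<lambda>x. - (1 / (4 * pi\<^sup>2)) * partial_deriv j (partial_deriv j h) x) y)
      = (\<Sum>j\<in>UNIV. of_real (y $ j * y $ j) * fourier h y)"
  proof (rule sum.cong[OF refl])
    fix j
    let ?y = "complex_of_real (y $ j)"
    have "(2 * pi * \<i> * ?y) * ((2 * pi * \<i> * ?y) * fourier h y) = - (4 * pi\<^sup>2) * (?y * ?y * fourier h y)"
      by (simp add: power2_eq_square)
    then show "fourier (\<lambda>x. - (1 / (4 * pi\<^sup>2)) * partial_deriv j (partial_deriv j h) x) y =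
        of_real (y $ j * y $ j) * fourier h y"
      by (simp only: fourier_cmult fourier_partial[OF h] fourier_partial[OF test_fun_partial[OF h]]) simp
  qed
  also have "\<dots> = of_real ((norm y)\<^sup>2) * fourier h y"
    by (simp add: power2_norm_eq_inner inner_vec_def sum_distrib_right)
  finally show ?thesis by (simp add: japanese_squared algebra_simps)
qed

lemma japanese_ge_1: "1 \<le> japanese x"
  unfolding japanese_def by simp

lemma japanese_pos [simp]: "0 < japanese x"
  using japanese_ge_1[of x] by linarith

lemma japanese_nonneg [simp]: "0 \<le> japanese x"
  by (rule less_imp_le) simp

lemma japanese_neq_0 [simp]: "japanese x \<noteq> 0"
  using japanese_pos[of x] by linarith

lemma fourier_rapid_decay:
  fixes h :: "real ^ 'n::finite \<Rightarrow> complex"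
  assumes h: "test_fun h"
  obtains C where "\<And>x. japanese x ^ N * cmod (fourier h x) \<le> C"
proof -
  have t: "test_fun ((bessel_op ^^ m) h)" for m by (induction m) (auto simp: test_fun_bessel_op h)
  have e: "fourier ((bessel_op ^^ m) h) y = of_real (japanese y ^ (2 * m)) * fourier h y" for m y
    by (induction m) (auto simp: fourier_bessel_op t power_mult mult_ac power2_eq_square power_mult_distrib)
  \<comment> \<open>\<open>N\<close> applications of the operator give the weight of order 2N, which
    dominates the one of order \<open>N\<close>; this treats odd \<open>N\<close> as well.\<close>
  have "japanese y ^ N * cmod (fourier h y) \<le> (\<integral>x. cmod ((bessel_op ^^ N) h x) \<partial>lborel)" for y
  proof -
    have "japanese y ^ N * cmod (fourier h y) \<le> japanese y ^ (2 * N) * cmod (fourier h y)"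
      by (intro mult_right_mono power_increasing) (auto simp: japanese_ge_1)
    also have "\<dots> = cmod (fourier ((bessel_op ^^ N) h) y)"
      by (simp add: e norm_mult norm_power less_imp_le)
    also have "\<dots> \<le> (\<integral>x. cmod ((bessel_op ^^ N) h x) \<partial>lborel)"
      by (rule fourier_bounded[OF test_fun_integrable[OF t]])
    finally show ?thesis .
  qed
  then show ?thesis by (rule that)
qed

lemma schwartz_fourier:
  fixes h :: "real ^ 'n::finite \<Rightarrow> complex"
  assumes h: "test_fun h" shows "schwartz (fourier h)"
  unfolding schwartz_def
proof (intro conjI allI smooth_fourier h)
  fix N js
  obtain h' where h': "test_fun h'" "iter_partial js (fourier h) = fourier h'"
    using iter_partial_fourier[OF h] by blast
  then obtain C where "\<And>x. japanese x ^ N * cmod (fourier h' x) \<le> C"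
    using fourier_rapid_decay by metis
  then show "bdd_above (range (\<lambda>x. japanese x ^ N * cmod (iter_partial js (fourier h) x)))"
    unfolding h'(2) by (auto simp: bdd_above_def)
qed

section \<open>Schwartz functions\<close>

text \<open>A form of Peetre's inequality. It trades a weight at \<open>y\<close> for weights at
  \<open>x\<close> and at \<open>y - x\<close>, at the price of a factor 2.\<close>

lemma japanese_add: "japanese (x + y) \<le> 2 * japanese x * japanese y"
proof (rule power2_le_imp_le)
  have "(norm (x + y))\<^sup>2 \<le> (norm x + norm y)\<^sup>2"
    by (intro power_mono norm_triangle_ineq) simp
  also have "\<dots> \<le> 2 * (norm x)\<^sup>2 + 2 * (norm y)\<^sup>2"
    using sum_squares_bound[of "norm x" "norm y"] by (simp add: power2_sum)
  finally have "1 + (norm (x + y))\<^sup>2 \<le> 2 * ((1 + (norm x)\<^sup>2) * (1 + (norm y)\<^sup>2))"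
    by (simp add: algebra_simps) (smt (verit) mult_nonneg_nonneg zero_le_power2)
  also have "\<dots> \<le> 4 * ((1 + (norm x)\<^sup>2) * (1 + (norm y)\<^sup>2))" by simp
  finally show "(japanese (x + y))\<^sup>2 \<le> (2 * japanese x * japanese y)\<^sup>2"
    by (simp add: power_mult_distrib japanese_squared mult.assoc)
qed (simp add: less_imp_le)

lemma japanese_minus [simp]: "japanese (- x) = japanese x"
  by (simp add: japanese_def)

lemma japanese_add_power: "japanese (x + y) ^ N \<le> 2 ^ N * japanese x ^ N * japanese y ^ N"
  using power_mono[OF japanese_add[of x y], of N] by (simp add: power_mult_distrib less_imp_le)

lemma japanese_power_ge_1: "1 \<le> japanese x ^ N"
  by (simp add: japanese_ge_1)

lemma continuous_on_japanese [continuous_intros]: "continuous_on S japanese"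
  unfolding japanese_def[abs_def] by (intro continuous_intros)

lemma measurable_japanese [measurable]: "japanese \<in> borel_measurable borel"
  by (intro borel_measurable_continuous_onI continuous_intros)

lemma norm_le_japanese: "norm x \<le> japanese x"
  by (rule power2_le_imp_le) (simp_all add: japanese_squared less_imp_le)

lemma integrable_inverse_one_plus_square: "integrable lborel (\<lambda>x::real. 1 / (1 + x\<^sup>2))"
  using integrable_inverse_1_plus_square by (simp add: set_integrable_def inverse_eq_divide)

text \<open>The exponent 2d allows a comparison with the product of the functions 1/(1 + t^2) over
  the coordinates, whose integral factorises.\<close>

lemma integrable_inverse_japanese:
  "integrable lborel (\<lambda>x::real ^ 'n::finite. 1 / japanese x ^ (2 * CARD('n)))"
proof (rule integrableI_nonneg)
  have "(\<integral>\<^sup>+(x::real ^ 'n). ennreal (1 / japanese x ^ (2 * CARD('n))) \<partial>lborel) \<le>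
      (\<integral>\<^sup>+(x::real ^ 'n). (\<Prod>b\<in>Basis. ennreal (1 / (1 + (x \<bullet> b)\<^sup>2))) \<partial>lborel)"
  proof (intro nn_integral_mono)
    fix x :: "real ^ 'n"
    have "(\<Prod>b\<in>Basis. 1 + (x \<bullet> b)\<^sup>2) \<le> (\<Prod>b\<in>(Basis :: (real ^ 'n) set). (japanese x)\<^sup>2)"
    proof (intro prod_mono conjI)
      fix b :: "real ^ 'n" assume "b \<in> Basis"
      then have "\<bar>x \<bullet> b\<bar>\<^sup>2 \<le> (norm x)\<^sup>2" by (intro power_mono Basis_le_norm) auto
      then show "1 + (x \<bullet> b)\<^sup>2 \<le> (japanese x)\<^sup>2" by (simp add: japanese_squared)
    qed (simp add: add_nonneg_nonneg)
    also have "\<dots> = japanese x ^ (2 * CARD('n))" by (simp add: power_mult)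
    finally have "1 / japanese x ^ (2 * CARD('n)) \<le> 1 / (\<Prod>b\<in>Basis. 1 + (x \<bullet> b)\<^sup>2)"
      by (intro divide_left_mono mult_pos_pos prod_pos) (auto simp: add_pos_nonneg)
    also have "\<dots> = (\<Prod>b\<in>Basis. 1 / (1 + (x \<bullet> b)\<^sup>2))" by (simp add: prod_dividef)
    finally have "ennreal (1 / japanese x ^ (2 * CARD('n))) \<le> ennreal (\<Prod>b\<in>Basis. 1 / (1 + (x \<bullet> b)\<^sup>2))"
      by (rule ennreal_leI)
    then show "ennreal (1 / japanese x ^ (2 * CARD('n))) \<le> (\<Prod>b\<in>Basis. ennreal (1 / (1 + (x \<bullet> b)\<^sup>2)))"
      by (simp add: prod_ennreal)
  qed
  also have "\<dots> = (\<Prod>b\<in>(Basis :: (real ^ 'n) set). \<integral>\<^sup>+x. ennreal (1 / (1 + x\<^sup>2)) \<partial>lborel)"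
    by (rule nn_integral_lborel_prod) auto
  also have "\<dots> < \<infinity>"
  proof -
    have "(\<integral>\<^sup>+x. ennreal (1 / (1 + x\<^sup>2)) \<partial>lborel) < \<infinity>"
      using integrable_inverse_one_plus_square by (subst (asm) integrable_iff_bounded) simp
    then show ?thesis by (simp add: power_less_top_ennreal)
  qed
  finally show "(\<integral>\<^sup>+(x::real ^ 'n). ennreal (1 / japanese x ^ (2 * CARD('n))) \<partial>lborel) < \<infinity>" .
qed auto

lemma schwartz_smooth: "schwartz \<phi> \<Longrightarrow> smooth \<phi>"
  by (simp add: schwartz_def)

lemma schwartz_decay:
  assumes "schwartz \<phi>"
  obtains C where "0 \<le> C" "\<And>x. japanese x ^ N * cmod (iter_partial js \<phi> x) \<le> C"
proof -
  obtain C where C: "\<And>x. japanese x ^ N * cmod (iter_partial js \<phi> x) \<le> C"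
    using assms unfolding schwartz_def bdd_above_def by (metis rangeI)
  then have "0 \<le> C"
    by (meson japanese_pos less_imp_le mult_nonneg_nonneg norm_ge_zero order_trans zero_le_power)
  with C show ?thesis using that by blast
qed

lemma schwartzI:
  assumes "smooth \<phi>" "\<And>N js. \<exists>C. \<forall>x. japanese x ^ N * cmod (iter_partial js \<phi> x) \<le> C"
  shows "schwartz \<phi>"
  unfolding schwartz_def
proof (intro conjI allI assms(1))
  fix N js
  obtain C where "\<And>x. japanese x ^ N * cmod (iter_partial js \<phi> x) \<le> C" using assms(2) by blast
  then show "bdd_above (range (\<lambda>x. japanese x ^ N * cmod (iter_partial js \<phi> x)))"
    by (auto simp: bdd_above_def)
qed

lemma iter_partial_append: "iter_partial (js @ ks) f = iter_partial js (iter_partial ks f)"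
  by (induction js) (auto simp: iter_partial_Cons)

lemma schwartz_iter_partial: "schwartz \<phi> \<Longrightarrow> schwartz (iter_partial ks \<phi>)"
  unfolding schwartz_def by (metis iter_partial_append smooth_iter_partial)

lemma schwartz_partial: "schwartz \<phi> \<Longrightarrow> schwartz (partial_deriv j \<phi>)"
  using schwartz_iter_partial[of \<phi> "[j]"] by (simp add: iter_partial_Cons)

text \<open>There are finitely many lists of length at most \<open>m\<close> over a finite alphabet,
  so the sum of the individual constants serves for all of them.\<close>

lemma schwartz_decay_uniform:
  fixes \<phi> :: "real ^ 'n::finite \<Rightarrow> complex"
  assumes "schwartz \<phi>"
  obtains C where "0 \<le> C"
    "\<And>js x. length js \<le> m \<Longrightarrow> japanese x ^ N * cmod (iter_partial js \<phi> x) \<le> C"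
proof -
  have "\<forall>js. \<exists>C. 0 \<le> C \<and> (\<forall>x. japanese x ^ N * cmod (iter_partial js \<phi> x) \<le> C)"
    using schwartz_decay[OF assms] by metis
  then obtain C where "\<forall>js. 0 \<le> C js \<and> (\<forall>x. japanese x ^ N * cmod (iter_partial js \<phi> x) \<le> C js)"
    by (rule choice[THEN exE])
  then have C: "\<And>js. 0 \<le> C js" "\<And>js x. japanese x ^ N * cmod (iter_partial js \<phi> x) \<le> C js"
    by auto
  let ?S = "{js :: 'n list. set js \<subseteq> UNIV \<and> length js \<le> m}"
  have "finite ?S" by (rule finite_lists_length_le) simp
  then have "C js \<le> sum C ?S" if "length js \<le> m" for js
    using that C(1) by (intro member_le_sum) auto
  then have "japanese x ^ N * cmod (iter_partial js \<phi> x) \<le> sum C ?S" if "length js \<le> m" for js x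
    using C(2) that order_trans by blast
  moreover have "0 \<le> sum C ?S" using C(1) by (intro sum_nonneg) auto
  ultimately show ?thesis using that by blast
qed

lemma schwartz_measurable [measurable_dest]: "schwartz \<phi> \<Longrightarrow> \<phi> \<in> borel_measurable borel"
  by (simp add: schwartz_def smooth_measurable)

text \<open>Functions with finite moments are the natural left factors in convolutions with
  Schwartz functions.\<close>

definition moments :: "(real ^ 'n::finite \<Rightarrow> complex) \<Rightarrow> bool" where
  "moments \<phi> \<longleftrightarrow> \<phi> \<in> borel_measurable borel \<and>
     (\<forall>N. integrable lborel (\<lambda>x. cmod (\<phi> x) * japanese x ^ N))"

lemma moments_measurable [measurable_dest]: "moments \<phi> \<Longrightarrow> \<phi> \<in> borel_measurable borel"
  by (simp add: moments_def)

lemma moments_integrable_norm: "moments \<phi> \<Longrightarrow> integrable lborel (\<lambda>x. cmod (\<phi> x) * japanese x ^ N)"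
  by (simp add: moments_def)

lemma moments_integrable_mult:
  fixes \<phi> :: "real ^ 'n::finite \<Rightarrow> complex"
  assumes \<phi>: "moments \<phi>" and [measurable]: "g \<in> borel_measurable borel"
    and g: "\<And>x. cmod (g x) \<le> C * japanese x ^ N"
  shows "integrable lborel (\<lambda>x. \<phi> x * g x)"
proof (rule Bochner_Integration.integrable_bound)
  show "integrable lborel (\<lambda>x. C * (cmod (\<phi> x) * japanese x ^ N))"
    by (intro integrable_mult_right moments_integrable_norm \<phi>)
  have [measurable]: "\<phi> \<in> borel_measurable borel" using \<phi> by measurable
  show "(\<lambda>x. \<phi> x * g x) \<in> borel_measurable lborel" by simp
  have "cmod (\<phi> x * g x) \<le> norm (C * (cmod (\<phi> x) * japanese x ^ N))" for x
  proof -
    have "cmod (\<phi> x) * cmod (g x) \<le> cmod (\<phi> x) * (C * japanese x ^ N)"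
      using g by (intro mult_left_mono) auto
    also have "\<dots> \<le> norm (C * (cmod (\<phi> x) * japanese x ^ N))" by (simp add: mult_ac abs_le_iff)
    finally show ?thesis by (simp add: norm_mult)
  qed
  then show "AE x in lborel. cmod (\<phi> x * g x) \<le> norm (C * (cmod (\<phi> x) * japanese x ^ N))" by simp
qed

lemma moments_integrable: "moments \<phi> \<Longrightarrow> integrable lborel \<phi>"
  using moments_integrable_mult[of \<phi> "\<lambda>_. 1" 1 0] by simp

lemma schwartz_moments:
  fixes \<phi> :: "real ^ 'n::finite \<Rightarrow> complex"
  assumes \<phi>: "schwartz \<phi>" shows "moments \<phi>"
  unfolding moments_def
proof (intro conjI allI)
  show [measurable]: "\<phi> \<in> borel_measurable borel" using \<phi> by measurable
  fix N
  \<comment> \<open>The surplus of 2d powers of decay pays for integrability.\<close>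
  obtain C where C: "\<And>x. japanese x ^ (N + 2 * CARD('n)) * cmod (\<phi> x) \<le> C"
    using schwartz_decay[OF \<phi>, of "N + 2 * CARD('n)" "[]"] by (metis iter_partial_Nil)
  show "integrable lborel (\<lambda>x. cmod (\<phi> x) * japanese x ^ N)"
  proof (rule Bochner_Integration.integrable_bound)
    show "integrable lborel (\<lambda>x::real ^ 'n. C * (1 / japanese x ^ (2 * CARD('n))))"
      by (intro integrable_mult_right integrable_inverse_japanese)
    have "cmod (\<phi> x) * japanese x ^ N \<le> C * (1 / japanese x ^ (2 * CARD('n)))" for x
      using C[of x] by (simp add: pos_le_divide_eq power_add mult_ac)
    then show "AE x in lborel. norm (cmod (\<phi> x) * japanese x ^ N) \<le> norm (C * (1 / japanese x ^ (2 * CARD('n))))"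
      by (intro AE_I2) (metis abs_of_nonneg abs_ge_self japanese_pos less_imp_le mult_nonneg_nonneg
          norm_ge_zero order_trans real_norm_def zero_le_power)
  qed simp
qed

lemma test_fun_iter_partial: "test_fun h \<Longrightarrow> test_fun (iter_partial js h)"
  by (induction js) (auto simp: iter_partial_Cons test_fun_partial)

lemma schwartz_test_fun:
  fixes h :: "real ^ 'n::finite \<Rightarrow> complex"
  assumes h: "test_fun h" shows "schwartz h"
proof (rule schwartzI[OF test_fun_smooth[OF h]])
  fix N js
  let ?f = "iter_partial js h"
  obtain R where R: "\<And>x. R < norm x \<Longrightarrow> ?f x = 0"
    using test_fun_iter_partial[OF h, of js] by (auto simp: test_fun_def)
  obtain C where C: "0 \<le> C" "\<And>x. cmod (?f x) \<le> C"
    using test_fun_bounded[OF test_fun_iter_partial[OF h]] by blast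
  have "japanese x ^ N * cmod (?f x) \<le> (1 + \<bar>R\<bar>) ^ N * C" for x
  proof (cases "R < norm x")
    case True
    then show ?thesis using R C(1) by simp
  next
    case False
    have "(japanese x)\<^sup>2 \<le> (1 + norm x)\<^sup>2" by (simp add: japanese_squared power2_sum)
    then have "japanese x \<le> 1 + norm x" by (rule power2_le_imp_le) simp
    then have "japanese x \<le> 1 + \<bar>R\<bar>" using False by linarith
    then show ?thesis using C by (intro mult_mono power_mono) (auto simp: less_imp_le)
  qed
  then show "\<exists>C. \<forall>x. japanese x ^ N * cmod (?f x) \<le> C" by blast
qed

lemma schwartz_shift:
  fixes \<phi> :: "real ^ 'n::finite \<Rightarrow> complex"
  assumes \<phi>: "schwartz \<phi>" shows "schwartz (\<lambda>y. \<phi> (y - x))"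
proof (rule schwartzI)
  show "smooth (\<lambda>y. \<phi> (y - x))" using smooth_shift schwartz_smooth[OF \<phi>] by blast
  fix N js
  obtain C where C: "\<And>x. japanese x ^ N * cmod (iter_partial js \<phi> x) \<le> C"
    using schwartz_decay[OF \<phi>] by metis
  have "japanese y ^ N * cmod (iter_partial js \<phi> (y - x)) \<le> 2 ^ N * japanese x ^ N * C" for y
  proof -
    have "japanese y ^ N * cmod (iter_partial js \<phi> (y - x)) \<le>
        (2 ^ N * japanese x ^ N * japanese (y - x) ^ N) * cmod (iter_partial js \<phi> (y - x))"
      using japanese_add_power[of x "y - x" N] by (intro mult_right_mono) auto
    also have "\<dots> = 2 ^ N * japanese x ^ N * (japanese (y - x) ^ N * cmod (iter_partial js \<phi> (y - x)))"
      by simp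
    also have "\<dots> \<le> 2 ^ N * japanese x ^ N * C"
      using C by (intro mult_left_mono) (auto simp: less_imp_le)
    finally show ?thesis .
  qed
  then show "\<exists>C. \<forall>y. japanese y ^ N * cmod (iter_partial js (\<lambda>y. \<phi> (y - x)) y) \<le> C"
    by (auto simp: iter_partial_shift schwartz_smooth[OF \<phi>])
qed

lemma iter_partial_add:
  fixes f g :: "real ^ 'n::finite \<Rightarrow> complex"
  assumes "smooth f" "smooth g"
  shows "iter_partial js (\<lambda>x. f x + g x) = (\<lambda>x. iter_partial js f x + iter_partial js g x)"
proof (induction js)
  case (Cons j js)
  show ?case
    unfolding iter_partial_Cons Cons
    by (rule ext) (simp add: partial_add smooth_differentiable smooth_iter_partial assms)
qed simp

lemma iter_partial_cmult:
  fixes f :: "real ^ 'n::finite \<Rightarrow> complex"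
  assumes "smooth f"
  shows "iter_partial js (\<lambda>x. c * f x) = (\<lambda>x. c * iter_partial js f x)"
proof (induction js)
  case (Cons j js)
  show ?case
    unfolding iter_partial_Cons Cons
    by (rule ext) (simp add: partial_mult partial_const smooth_differentiable smooth_iter_partial assms)
qed simp

lemma schwartz_add:
  fixes f g :: "real ^ 'n::finite \<Rightarrow> complex"
  assumes f: "schwartz f" and g: "schwartz g" shows "schwartz (\<lambda>x. f x + g x)"
proof (rule schwartzI)
  show "smooth (\<lambda>x. f x + g x)" using f g by (simp add: smooth_add schwartz_smooth)
  fix N js
  obtain C D where CD: "\<And>x. japanese x ^ N * cmod (iter_partial js f x) \<le> C"
    "\<And>x. japanese x ^ N * cmod (iter_partial js g x) \<le> D"
    using schwartz_decay[OF f] schwartz_decay[OF g] by metis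
  have "japanese x ^ N * cmod (iter_partial js f x + iter_partial js g x) \<le> C + D" for x
  proof -
    have "japanese x ^ N * cmod (iter_partial js f x + iter_partial js g x) \<le>
        japanese x ^ N * (cmod (iter_partial js f x) + cmod (iter_partial js g x))"
      by (intro mult_left_mono norm_triangle_ineq) (simp add: less_imp_le)
    then show ?thesis using CD[of x] by (simp add: distrib_left)
  qed
  then show "\<exists>C. \<forall>x. japanese x ^ N * cmod (iter_partial js (\<lambda>x. f x + g x) x) \<le> C"
    using f g by (auto simp: iter_partial_add schwartz_smooth)
qed

lemma schwartz_cmult:
  fixes f :: "real ^ 'n::finite \<Rightarrow> complex"
  assumes f: "schwartz f" shows "schwartz (\<lambda>x. c * f x)"
proof (rule schwartzI)
  show "smooth (\<lambda>x. c * f x)" using f by (intro smooth_mult) (auto simp: schwartz_smooth)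
  fix N js
  obtain C where C: "\<And>x. japanese x ^ N * cmod (iter_partial js f x) \<le> C"
    using schwartz_decay[OF f] by metis
  have "japanese x ^ N * cmod (c * iter_partial js f x) \<le> cmod c * C" for x
    using mult_left_mono[OF C[of x] norm_ge_zero[of c]] by (simp add: norm_mult mult_ac)
  then show "\<exists>C. \<forall>x. japanese x ^ N * cmod (iter_partial js (\<lambda>x. c * f x) x) \<le> C"
    using f by (auto simp: iter_partial_cmult schwartz_smooth)
qed

text \<open>The seminorm is a supremum of real numbers; any common upper bound \<open>B\<close> of
  its members can take its place. The constant from \<open>tempered\<close> has no prescribed sign,
  hence the passage to \<open>\<bar>C\<bar>\<close>, which relies on the seminorm being
  nonnegative.\<close>

lemma tempered_bound:
  fixes u :: "'n::finite distribution"
  assumes "tempered u"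
  obtains C N where "0 \<le> C"
    "\<And>\<Phi> B. schwartz \<Phi> \<Longrightarrow> (\<And>js x. length js \<le> N \<Longrightarrow> japanese x ^ N * cmod (iter_partial js \<Phi> x) \<le> B)
      \<Longrightarrow> cmod (u \<Phi>) \<le> C * B"
proof -
  obtain C N where C: "\<And>\<phi>. schwartz \<phi> \<Longrightarrow> cmod (u \<phi>) \<le> C * schwartz_norm N \<phi>"
    using assms unfolding tempered_def by blast
  have "cmod (u \<Phi>) \<le> \<bar>C\<bar> * B" if \<Phi>: "schwartz \<Phi>"
    and B: "\<And>js x. length js \<le> N \<Longrightarrow> japanese x ^ N * cmod (iter_partial js \<Phi> x) \<le> B" for \<Phi> B
  proof -
    let ?S = "{js :: 'n list. length js \<le> N} \<times> (UNIV :: (real ^ 'n) set)"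
    let ?f = "\<lambda>(js, x). japanese x ^ N * cmod (iter_partial js \<Phi> x)"
    have le: "schwartz_norm N \<Phi> \<le> B"
      unfolding schwartz_norm_def by (rule cSUP_least) (use B in \<open>auto intro: exI[of _ "[]"]\<close>)
    have "([], 0) \<in> ?S" by simp
    moreover have "bdd_above (?f ` ?S)" using B by (intro bdd_aboveI[of _ B]) auto
    ultimately have "?f ([], 0) \<le> schwartz_norm N \<Phi>"
      unfolding schwartz_norm_def by (rule cSUP_upper)
    moreover have "0 \<le> ?f ([], 0)" by (simp add: less_imp_le)
    ultimately have "0 \<le> schwartz_norm N \<Phi>" by linarith
    then have "C * schwartz_norm N \<Phi> \<le> \<bar>C\<bar> * B"
      using le by (intro mult_mono) auto
    then show ?thesis using C[OF \<Phi>] by linarith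
  qed
  then show ?thesis using that[of "\<bar>C\<bar>" N] by auto
qed

section \<open>Fourier inversion\<close>

lemma lborel_integral_prod:
  fixes f :: "'a::euclidean_space \<Rightarrow> real \<Rightarrow> complex"
  assumes f: "\<And>b. b \<in> Basis \<Longrightarrow> integrable lborel (f b)"
  shows "integrable lborel (\<lambda>x. \<Prod>b\<in>Basis. f b (x \<bullet> b))"
    and "(\<integral>x. (\<Prod>b\<in>Basis. f b (x \<bullet> b)) \<partial>lborel) = (\<Prod>b\<in>Basis. \<integral>x. f b x \<partial>lborel)"
proof -
  interpret product_sigma_finite "\<lambda>_::'a. lborel :: real measure" ..
  have [measurable]: "b \<in> Basis \<Longrightarrow> f b \<in> borel_measurable borel" for b using f by auto
  have e: "(\<Prod>b\<in>Basis. f b ((\<Sum>c\<in>Basis. g c *\<^sub>R c) \<bullet> b)) = (\<Prod>b\<in>Basis. f b (g b))" for g :: "'a \<Rightarrow> real"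
    by (intro prod.cong) auto
  show "integrable lborel (\<lambda>x. \<Prod>b\<in>Basis. f b (x \<bullet> b))"
    by (subst lborel_eq, subst integrable_distr_eq)
      (auto simp: e intro!: product_integrable_prod f)
  show "(\<integral>x. (\<Prod>b\<in>Basis. f b (x \<bullet> b)) \<partial>lborel) = (\<Prod>b\<in>Basis. \<integral>x. f b x \<partial>lborel)"
    by (subst lborel_eq, subst integral_distr)
      (auto simp: e intro!: product_integral_prod f)
qed

text \<open>The scaling is that of the standard normal density, whose characteristic function then
  supplies the Fourier transform. The factor 2 pi of \<open>fourier\<close> is carried by the
  argument.\<close>

definition gauss :: "real \<Rightarrow> 'a::euclidean_space \<Rightarrow> real" where
  "gauss \<epsilon> x = exp (- (\<epsilon>\<^sup>2 * (x \<bullet> x)) / 2)"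

lemma gauss_1D:
  fixes \<epsilon> s :: real
  assumes "0 < \<epsilon>"
  shows "integrable lborel (\<lambda>x. cis (s * x) * of_real (exp (- (\<epsilon>\<^sup>2 * x\<^sup>2) / 2)))"
    and "(\<integral>x. cis (s * x) * of_real (exp (- (\<epsilon>\<^sup>2 * x\<^sup>2) / 2)) \<partial>lborel) =
      of_real (sqrt (2 * pi) / \<epsilon> * exp (- (s\<^sup>2) / (2 * \<epsilon>\<^sup>2)))"
proof -
  let ?f = "\<lambda>s x. complex_of_real (std_normal_density x) * cis (s * x)"
  have "integrable lborel (\<lambda>x. complex_of_real (std_normal_density x))" by simp
  from integrable_cis_mult[OF this, of "(*) s" for s]
  have i: "integrable lborel (?f s)" for s by (subst mult.commute) auto
  have v: "(\<integral>x. ?f s x \<partial>lborel) = of_real (exp (- s\<^sup>2 / 2))" for s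
  proof -
    have "char std_normal_distribution s = (\<integral>x. ?f s x \<partial>lborel)"
      unfolding char_def by (subst integral_density) (auto simp: scaleR_conv_of_real cis_conv_exp)
    then show ?thesis by (simp add: char_std_normal_distribution)
  qed
  have e: "cis (s * x) * of_real (exp (- (\<epsilon>\<^sup>2 * x\<^sup>2) / 2)) =
      of_real (sqrt (2 * pi)) * ?f (s / \<epsilon>) (0 + \<epsilon> * x)" for x
    using assms by (simp add: std_normal_density_def power_mult_distrib mult_ac)
  show "integrable lborel (\<lambda>x. cis (s * x) * of_real (exp (- (\<epsilon>\<^sup>2 * x\<^sup>2) / 2)))"
    unfolding e by (intro integrable_mult_right lborel_integrable_real_affine i) (use assms in auto)
  have "(\<integral>x. ?f (s / \<epsilon>) x \<partial>lborel) = \<bar>\<epsilon>\<bar> *\<^sub>R (\<integral>x. ?f (s / \<epsilon>) (0 + \<epsilon> * x) \<partial>lborel)"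
    using assms by (intro lborel_integral_real_affine) simp
  then have "(\<integral>x. ?f (s / \<epsilon>) (0 + \<epsilon> * x) \<partial>lborel) = of_real (exp (- (s / \<epsilon>)\<^sup>2 / 2) / \<epsilon>)"
    unfolding v using assms by (simp add: scaleR_conv_of_real field_simps)
  then show "(\<integral>x. cis (s * x) * of_real (exp (- (\<epsilon>\<^sup>2 * x\<^sup>2) / 2)) \<partial>lborel) =
      of_real (sqrt (2 * pi) / \<epsilon> * exp (- (s\<^sup>2) / (2 * \<epsilon>\<^sup>2)))"
    unfolding e by (subst integral_mult_right_zero) (simp add: power_divide mult_ac)
qed

lemma cis_sum: "finite I \<Longrightarrow> cis (\<Sum>i\<in>I. f i) = (\<Prod>i\<in>I. cis (f i))"
  by (induction I rule: finite_induct) (auto simp: cis_mult[symmetric])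

lemma gauss_fourier:
  fixes y :: "'a::euclidean_space"
  assumes "0 < \<epsilon>"
  shows "integrable lborel (\<lambda>x. cis (y \<bullet> x) * of_real (gauss \<epsilon> x))"
    and "(\<integral>x. cis (y \<bullet> x) * of_real (gauss \<epsilon> x) \<partial>lborel) =
      of_real ((sqrt (2 * pi) / \<epsilon>) ^ DIM('a) * gauss (1 / \<epsilon>) y)"
proof -
  let ?f = "\<lambda>b t. cis ((y \<bullet> b) * t) * complex_of_real (exp (- (\<epsilon>\<^sup>2 * t\<^sup>2) / 2))"
  have e: "cis (y \<bullet> x) * of_real (gauss \<epsilon> x) = (\<Prod>b\<in>Basis. ?f b (x \<bullet> b))" for x
  proof -
    have "- (\<epsilon>\<^sup>2 * (x \<bullet> x)) / 2 = (\<Sum>b\<in>Basis. - (\<epsilon>\<^sup>2 * (x \<bullet> b)\<^sup>2) / 2)"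
      by (subst euclidean_inner) (simp add: sum_distrib_left sum_divide_distrib sum_negf power2_eq_square)
    then have "gauss \<epsilon> x = (\<Prod>b\<in>Basis. exp (- (\<epsilon>\<^sup>2 * (x \<bullet> b)\<^sup>2) / 2))"
      by (simp add: gauss_def exp_sum)
    moreover have "cis (y \<bullet> x) = (\<Prod>b\<in>Basis. cis ((y \<bullet> b) * (x \<bullet> b)))"
      by (subst euclidean_inner) (rule cis_sum, simp)
    ultimately show ?thesis by (simp add: prod.distrib)
  qed
  show "integrable lborel (\<lambda>x. cis (y \<bullet> x) * of_real (gauss \<epsilon> x))"
    unfolding e by (intro lborel_integral_prod gauss_1D assms)
  have g: "gauss (1 / \<epsilon>) y = (\<Prod>b\<in>Basis. exp (- ((y \<bullet> b)\<^sup>2) / (2 * \<epsilon>\<^sup>2)))"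
  proof -
    have "- ((1 / \<epsilon>)\<^sup>2 * (y \<bullet> y)) / 2 = (\<Sum>b\<in>Basis. - ((y \<bullet> b)\<^sup>2) / (2 * \<epsilon>\<^sup>2))"
      by (subst euclidean_inner)
        (simp add: sum_distrib_left sum_divide_distrib sum_negf power2_eq_square field_simps)
    then show ?thesis by (simp add: gauss_def exp_sum)
  qed
  have "(\<integral>x. cis (y \<bullet> x) * of_real (gauss \<epsilon> x) \<partial>lborel) = (\<Prod>b\<in>Basis. \<integral>t. ?f b t \<partial>lborel)"
    unfolding e by (intro lborel_integral_prod gauss_1D assms)
  also have "\<dots> = (\<Prod>b\<in>Basis. of_real (sqrt (2 * pi) / \<epsilon> * exp (- ((y \<bullet> b)\<^sup>2) / (2 * \<epsilon>\<^sup>2))))"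
    by (simp only: gauss_1D(2)[OF assms])
  also have "\<dots> = of_real ((sqrt (2 * pi) / \<epsilon>) ^ DIM('a) * gauss (1 / \<epsilon>) y)"
    unfolding g by (simp only: of_real_prod[symmetric] prod.distrib prod_constant)
  finally show "(\<integral>x. cis (y \<bullet> x) * of_real (gauss \<epsilon> x) \<partial>lborel) =
      of_real ((sqrt (2 * pi) / \<epsilon>) ^ DIM('a) * gauss (1 / \<epsilon>) y)" .
qed

lemma measurable_gauss [measurable]: "gauss \<epsilon> \<in> borel_measurable borel"
  unfolding gauss_def[abs_def] by measurable

lemma gauss_nonneg [simp]: "0 \<le> gauss \<epsilon> x"
  by (simp add: gauss_def)

lemma gauss_le_1: "gauss \<epsilon> x \<le> 1"
  by (simp add: gauss_def)

text \<open>The double integral behind the left side need not converge absolutely, so a Gaussian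
  factor is inserted before the order is exchanged. This turns the left side into an average of
  \<open>h\<close> over a Gaussian centred at \<xi> with width proportional to
  \<open>\<epsilon> n\<close>; both sides then pass to the limit by dominated convergence.\<close>

theorem fourier_inversion:
  fixes h :: "real ^ 'n::finite \<Rightarrow> complex"
  assumes h: "test_fun h"
  shows "inv_fourier (fourier h) = h"
proof
  fix \<xi> :: "real ^ 'n"
  define H where "H = fourier h"
  have H: "integrable lborel H"
    unfolding H_def by (intro moments_integrable schwartz_moments schwartz_fourier h)
  have [measurable]: "H \<in> borel_measurable borel" "h \<in> borel_measurable borel"
    using H h by (auto simp: test_fun_measurable)
  define \<epsilon> where "\<epsilon> n = 1 / real (Suc n)" for n
  have \<epsilon>: "0 < \<epsilon> n" "\<epsilon> \<longlonglongrightarrow> 0" for n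
    unfolding \<epsilon>_def[abs_def] using LIMSEQ_inverse_real_of_nat by (auto simp: inverse_eq_divide)
  obtain C where C: "0 \<le> C" "\<And>x. cmod (h x) \<le> C" using test_fun_bounded[OF h] by blast
  let ?e = "\<lambda>x::real ^ 'n. cis (2 * pi * (\<xi> \<bullet> x))"
  have gi: "integrable lborel (\<lambda>x::real ^ 'n. complex_of_real (gauss c x))" if "0 < c" for c
    using gauss_fourier(1)[OF that, of "0::real ^ 'n"] by simp
  have main: "(\<integral>x. ?e x * of_real (gauss (\<epsilon> n) x) * H x \<partial>lborel) =
      of_real (1 / sqrt (2 * pi) ^ CARD('n)) *
      (\<integral>u. h (\<xi> + (\<epsilon> n / (2 * pi)) *\<^sub>R u) * of_real (gauss 1 u) \<partial>lborel)" for n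
  proof -
    let ?c = "\<epsilon> n" and ?N = "CARD('n)"
    have c: "0 < ?c" by (rule \<epsilon>)
    have "(\<integral>x. ?e x * of_real (gauss ?c x) * H x \<partial>lborel) =
        (\<integral>x. (?e x * of_real (gauss ?c x)) * (\<integral>\<eta>. cis (- (2 * pi * (\<eta> \<bullet> x))) * h \<eta> \<partial>lborel) \<partial>lborel)"
      by (simp add: H_def fourier_def)
    also have "\<dots> = (\<integral>\<eta>. h \<eta> * (\<integral>x. cis (- (2 * pi * (\<eta> \<bullet> x))) * (?e x * of_real (gauss ?c x)) \<partial>lborel) \<partial>lborel)"
    proof (rule fubini_tensor[where B=1])
      show "integrable lborel (\<lambda>x. ?e x * of_real (gauss ?c x))"
        by (intro integrable_cis_mult gi c) simp
    qed (use test_fun_integrable[OF h] in auto)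
    also have "\<dots> = (\<integral>\<eta>. h \<eta> * of_real ((sqrt (2 * pi) / ?c) ^ ?N * gauss (1 / ?c) ((2 * pi) *\<^sub>R (\<xi> - \<eta>))) \<partial>lborel)"
    proof (intro Bochner_Integration.integral_cong refl arg_cong2[where f="(*)"])
      fix \<eta>
      have "cis (- (2 * pi * (\<eta> \<bullet> x))) * (?e x * of_real (gauss ?c x)) =
          cis (((2 * pi) *\<^sub>R (\<xi> - \<eta>)) \<bullet> x) * of_real (gauss ?c x)" for x
        by (simp only: mult.assoc[symmetric] cis_mult) (simp add: inner_diff_left right_diff_distrib)
      then show "(\<integral>x. cis (- (2 * pi * (\<eta> \<bullet> x))) * (?e x * of_real (gauss ?c x)) \<partial>lborel) =
          of_real ((sqrt (2 * pi) / ?c) ^ ?N * gauss (1 / ?c) ((2 * pi) *\<^sub>R (\<xi> - \<eta>)))"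
        by (simp only: gauss_fourier(2)[OF c]) simp
    qed
    \<comment> \<open>The substitution \<eta> = \<xi> + (c / 2 pi) u makes the Gaussian independent
      of \<open>n\<close> and moves the limit into the argument of \<open>h\<close>.\<close>
    also have "\<dots> = \<bar>?c / (2 * pi)\<bar> ^ DIM(real ^ 'n) *\<^sub>R
        (\<integral>u. h (\<xi> + (?c / (2 * pi)) *\<^sub>R u) * of_real ((sqrt (2 * pi) / ?c) ^ ?N *
          gauss (1 / ?c) ((2 * pi) *\<^sub>R (\<xi> - (\<xi> + (?c / (2 * pi)) *\<^sub>R u)))) \<partial>lborel)"
      by (rule lborel_integral_affine[where t=\<xi> and c="?c / (2 * pi)" and f="\<lambda>\<eta>. h \<eta> *
          of_real ((sqrt (2 * pi) / ?c) ^ ?N * gauss (1 / ?c) ((2 * pi) *\<^sub>R (\<xi> - \<eta>)))"])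
        (use c in auto)
    also have "\<dots> = \<bar>?c / (2 * pi)\<bar> ^ ?N *\<^sub>R
        (\<integral>u. of_real ((sqrt (2 * pi) / ?c) ^ ?N) * (h (\<xi> + (?c / (2 * pi)) *\<^sub>R u) * of_real (gauss 1 u)) \<partial>lborel)"
    proof -
      have "gauss (1 / ?c) ((2 * pi) *\<^sub>R (\<xi> - (\<xi> + (?c / (2 * pi)) *\<^sub>R u))) = gauss 1 u" for u
        using c by (simp add: gauss_def power2_eq_square)
      then show ?thesis by (simp add: mult_ac)
    qed
    also have "\<dots> = of_real ((?c / (2 * pi)) ^ ?N * (sqrt (2 * pi) / ?c) ^ ?N) *
        (\<integral>u. h (\<xi> + (?c / (2 * pi)) *\<^sub>R u) * of_real (gauss 1 u) \<partial>lborel)"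
      using c by (subst integral_mult_right_zero) (simp add: scaleR_conv_of_real mult_ac)
    also have "(?c / (2 * pi)) ^ ?N * (sqrt (2 * pi) / ?c) ^ ?N = 1 / sqrt (2 * pi) ^ ?N"
    proof -
      have "(?c / (2 * pi)) * (sqrt (2 * pi) / ?c) = 1 / sqrt (2 * pi)"
        using c real_sqrt_mult_self[of "2 * pi"] by (simp add: field_simps del: real_sqrt_mult_self)
      then show ?thesis by (simp add: power_mult_distrib[symmetric] power_one_over)
    qed
    finally show ?thesis .
  qed
  have tg: "(\<lambda>n. gauss (\<epsilon> n) x) \<longlonglongrightarrow> 1" for x :: "real ^ 'n"
  proof -
    have "(\<lambda>n. gauss (\<epsilon> n) x) \<longlonglongrightarrow> exp (- (0\<^sup>2 * (x \<bullet> x)) / 2)"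
      unfolding gauss_def by (intro tendsto_intros \<epsilon>) simp
    then show ?thesis by simp
  qed
  have L: "(\<lambda>n. \<integral>x. ?e x * of_real (gauss (\<epsilon> n) x) * H x \<partial>lborel) \<longlonglongrightarrow> (\<integral>x. ?e x * of_real 1 * H x \<partial>lborel)"
  proof (rule integral_dominated_convergence)
    show "integrable lborel (\<lambda>x. cmod (H x))" using H by simp
    show "AE x in lborel. (\<lambda>n. ?e x * of_real (gauss (\<epsilon> n) x) * H x) \<longlonglongrightarrow> ?e x * of_real 1 * H x"
      by (intro AE_I2 tendsto_intros tg)
    show "AE x in lborel. cmod (?e x * of_real (gauss (\<epsilon> n) x) * H x) \<le> cmod (H x)" for n
      by (intro AE_I2) (simp add: norm_mult mult_left_le_one_le gauss_le_1)
  qed simp_all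
  have R: "(\<lambda>n. \<integral>u. h (\<xi> + (\<epsilon> n / (2 * pi)) *\<^sub>R u) * of_real (gauss 1 u) \<partial>lborel) \<longlonglongrightarrow>
      (\<integral>(u::real ^ 'n). h \<xi> * of_real (gauss 1 u) \<partial>lborel)"
  proof (rule integral_dominated_convergence)
    show "integrable lborel (\<lambda>u::real ^ 'n. C * gauss 1 u)"
      using gi[of 1] by (intro integrable_mult_right) (simp add: complex_of_real_integrable_eq)
    have "(\<lambda>n. h (\<xi> + (\<epsilon> n / (2 * pi)) *\<^sub>R u)) \<longlonglongrightarrow> h \<xi>" for u
    proof -
      have "(\<lambda>n. \<xi> + (\<epsilon> n / (2 * pi)) *\<^sub>R u) \<longlonglongrightarrow> \<xi> + (0 / (2 * pi)) *\<^sub>R u"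
        by (intro tendsto_intros \<epsilon>) simp
      moreover have "isCont h \<xi>"
        by (meson differentiable_imp_continuous_within h smooth_differentiable test_fun_smooth)
      ultimately show ?thesis by (intro isCont_tendsto_compose[of \<xi> h]) simp_all
    qed
    then show "AE u in lborel. (\<lambda>n. h (\<xi> + (\<epsilon> n / (2 * pi)) *\<^sub>R u) * of_real (gauss 1 u)) \<longlonglongrightarrow> h \<xi> * of_real (gauss 1 u)"
      by (intro AE_I2 tendsto_intros)
    show "AE u in lborel. cmod (h (\<xi> + (\<epsilon> n / (2 * pi)) *\<^sub>R u) * of_real (gauss 1 u)) \<le> C * gauss 1 u" for n
      by (intro AE_I2) (simp add: norm_mult mult_right_mono C)
  qed simp_all
  have G: "(\<integral>(u::real ^ 'n). h \<xi> * of_real (gauss 1 u) \<partial>lborel) = h \<xi> * of_real (sqrt (2 * pi) ^ CARD('n))"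
    using gauss_fourier(2)[of 1 "0::real ^ 'n"] by (simp add: gauss_def)
  have "(\<lambda>n. \<integral>x. ?e x * of_real (gauss (\<epsilon> n) x) * H x \<partial>lborel) \<longlonglongrightarrow>
      of_real (1 / sqrt (2 * pi) ^ CARD('n)) * (h \<xi> * of_real (sqrt (2 * pi) ^ CARD('n)))"
    unfolding main using R unfolding G by (intro tendsto_mult tendsto_const)
  then have "(\<lambda>n. \<integral>x. ?e x * of_real (gauss (\<epsilon> n) x) * H x \<partial>lborel) \<longlonglongrightarrow> h \<xi>"
    by (simp add: mult_ac)
  from LIMSEQ_unique[OF L this] show "inv_fourier (fourier h) \<xi> = h \<xi>"
    by (simp add: inv_fourier_def H_def)
qed

section \<open>Convolutions and tempered distributions\<close>

definition conv :: "(real ^ 'n::finite \<Rightarrow> complex) \<Rightarrow> (real ^ 'n \<Rightarrow> complex) \<Rightarrow> real ^ 'n \<Rightarrow> complex" where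
  "conv \<phi> G y = (\<integral>x. \<phi> x * G (y - x) \<partial>lborel)"

lemma schwartz_bounded:
  fixes G :: "real ^ 'n::finite \<Rightarrow> complex"
  assumes "schwartz G" obtains C where "\<And>x. cmod (G x) \<le> C"
  using schwartz_decay[OF assms, of 0 "[]"] by simp metis

lemma integrable_conv:
  fixes G :: "real ^ 'n::finite \<Rightarrow> complex"
  assumes \<phi>: "moments \<phi>" and G: "schwartz G"
  shows "integrable lborel (\<lambda>x. \<phi> x * G (y - x))"
proof -
  obtain C where C: "\<And>x. cmod (G x) \<le> C" using schwartz_bounded[OF G] by blast
  have [measurable]: "G \<in> borel_measurable borel" using G by (rule schwartz_measurable)
  show ?thesis by (rule moments_integrable_mult[OF \<phi>, where C=C and N=0]) (auto simp: C)
qed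

lemma conv_has_derivative:
  fixes G :: "real ^ 'n::finite \<Rightarrow> complex"
  assumes \<phi>: "moments \<phi>" and G: "schwartz G"
  shows "(conv \<phi> G has_derivative (\<lambda>v. \<Sum>j\<in>UNIV. of_real (v $ j) * conv \<phi> (partial_deriv j G) y)) (at y)"
proof -
  obtain M where M: "\<And>js x. length js \<le> 2 \<Longrightarrow> japanese x ^ 0 * cmod (iter_partial js G x) \<le> M"
    using schwartz_decay_uniform[OF G] by metis
  have M2: "cmod (partial_deriv i (partial_deriv j G) x) \<le> M" for i j x
    using M[of "[i, j]" x] by (simp add: iter_partial_Cons)
  have "((\<lambda>y. \<integral>x. \<phi> x * G (y - x) \<partial>lborel) has_derivative
      (\<lambda>v. \<Sum>j\<in>UNIV. of_real (v $ j) * (\<integral>x. \<phi> x * partial_deriv j G (y - x) \<partial>lborel))) (at y)"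
  proof (rule has_derivative_integral)
    show "integrable lborel (\<lambda>x. (real CARD('n))\<^sup>2 * M * cmod (\<phi> x))"
      by (intro integrable_mult_right integrable_norm moments_integrable \<phi>)
    fix x v :: "real ^ 'n"
    have "\<phi> x * G (y + v - x) - \<phi> x * G (y - x) -
        (\<Sum>j\<in>UNIV. of_real (v $ j) * (\<phi> x * partial_deriv j G (y - x))) =
        \<phi> x * (G ((y - x) + v) - G (y - x) - (\<Sum>j\<in>UNIV. of_real (v $ j) * partial_deriv j G (y - x)))"
      by (simp add: right_diff_distrib sum_distrib_left mult_ac algebra_simps)
    also have "cmod \<dots> \<le> cmod (\<phi> x) * ((real CARD('n))\<^sup>2 * M * (norm v)\<^sup>2)"
      unfolding norm_mult
      by (intro mult_left_mono quadratic_remainder schwartz_smooth G M2 norm_ge_zero)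
    finally show "cmod (\<phi> x * G (y + v - x) - \<phi> x * G (y - x) -
        (\<Sum>j\<in>UNIV. of_real (v $ j) * (\<phi> x * partial_deriv j G (y - x)))) \<le>
        (real CARD('n))\<^sup>2 * M * cmod (\<phi> x) * (norm v)\<^sup>2" by (simp add: mult_ac)
  qed (intro integrable_conv \<phi> G schwartz_partial)+
  then show ?thesis by (simp add: conv_def[abs_def])
qed

text \<open>All derivatives fall on \<open>G\<close>. This is what allows \<open>\<phi>\<close> to
  be cut off sharply to measurable sets in the exchange argument below.\<close>

lemma iter_partial_conv:
  fixes G :: "real ^ 'n::finite \<Rightarrow> complex"
  assumes "moments \<phi>" "schwartz G"
  shows "iter_partial js (conv \<phi> G) = conv \<phi> (iter_partial js G)"
proof (induction js)
  case (Cons j js)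
  have "partial_deriv j (conv \<phi> (iter_partial js G)) = conv \<phi> (partial_deriv j (iter_partial js G))"
    by (subst partial_deriv_at[OF conv_has_derivative[OF assms(1) schwartz_iter_partial[OF assms(2)]]])
      (simp add: sum_axis)
  then show ?case by (simp add: iter_partial_Cons Cons)
qed simp

lemma weighted_shift_bound:
  assumes "\<And>z. japanese z ^ N * cmod (H z) \<le> C"
  shows "japanese y ^ N * cmod (H (y - x)) \<le> 2 ^ N * C * japanese x ^ N"
proof -
  have "japanese y ^ N * cmod (H (y - x)) \<le> (2 ^ N * japanese x ^ N * japanese (y - x) ^ N) * cmod (H (y - x))"
    using japanese_add_power[of x "y - x" N] by (intro mult_right_mono) auto
  also have "\<dots> = 2 ^ N * japanese x ^ N * (japanese (y - x) ^ N * cmod (H (y - x)))" by simp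
  also have "\<dots> \<le> 2 ^ N * japanese x ^ N * C"
    using assms by (intro mult_left_mono) (auto simp: less_imp_le)
  finally show ?thesis by (simp add: mult_ac)
qed

text \<open>The kernel form of this estimate also covers the local error terms in the exchange of
  a distribution with a convolution integral.\<close>

lemma weighted_integral_bound:
  fixes K :: "real ^ 'n::finite \<Rightarrow> complex"
  assumes \<phi>: "moments \<phi>" and K: "\<And>x. \<phi> x \<noteq> 0 \<Longrightarrow> w * cmod (K x) \<le> C * japanese x ^ N" and w: "0 \<le> w"
  shows "w * cmod (\<integral>x. \<phi> x * K x \<partial>lborel) \<le> C * (\<integral>x. cmod (\<phi> x) * japanese x ^ N \<partial>lborel)"
proof -
  have "w * cmod (\<integral>x. \<phi> x * K x \<partial>lborel) = cmod (\<integral>x. of_real w * (\<phi> x * K x) \<partial>lborel)"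
    using w by (simp add: norm_mult)
  also have "\<dots> \<le> (\<integral>x. C * (cmod (\<phi> x) * japanese x ^ N) \<partial>lborel)"
  proof (rule norm_integral_le)
    show "integrable lborel (\<lambda>x. C * (cmod (\<phi> x) * japanese x ^ N))"
      by (intro integrable_mult_right moments_integrable_norm \<phi>)
    fix x
    show "cmod (of_real w * (\<phi> x * K x)) \<le> C * (cmod (\<phi> x) * japanese x ^ N)"
    proof (cases "\<phi> x = 0")
      case False
      from mult_left_mono[OF K[OF this] norm_ge_zero[of "\<phi> x"]] show ?thesis
        using w by (simp add: norm_mult mult_ac)
    qed simp
  qed
  finally show ?thesis by simp
qed

lemma schwartz_conv:
  fixes G :: "real ^ 'n::finite \<Rightarrow> complex"
  assumes \<phi>: "moments \<phi>" and G: "schwartz G"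
  shows "schwartz (conv \<phi> G)"
proof (rule schwartzI)
  show "smooth (conv \<phi> G)"
    unfolding smooth_def iter_partial_conv[OF assms] differentiable_def
    using conv_has_derivative[OF \<phi> schwartz_iter_partial[OF G]] by blast
  fix N js
  obtain C where C: "\<And>z. japanese z ^ N * cmod (iter_partial js G z) \<le> C"
    using schwartz_decay[OF G] by metis
  have "japanese y ^ N * cmod (conv \<phi> (iter_partial js G) y) \<le>
      2 ^ N * C * (\<integral>x. cmod (\<phi> x) * japanese x ^ N \<partial>lborel)" for y
    unfolding conv_def
    by (rule weighted_integral_bound[OF \<phi>]) (use weighted_shift_bound[OF C] in \<open>auto simp: less_imp_le\<close>)
  then show "\<exists>C. \<forall>x. japanese x ^ N * cmod (iter_partial js (conv \<phi> G) x) \<le> C"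
    unfolding iter_partial_conv[OF assms] by blast
qed

lemma conv_add:
  fixes G :: "real ^ 'n::finite \<Rightarrow> complex"
  assumes "moments \<phi>" "moments \<psi>" "schwartz G"
  shows "conv (\<lambda>x. \<phi> x + \<psi> x) G = (\<lambda>y. conv \<phi> G y + conv \<psi> G y)"
  unfolding conv_def using integrable_conv[OF assms(1,3)] integrable_conv[OF assms(2,3)]
  by (simp add: distrib_right)

lemma tempered_add:
  "tempered u \<Longrightarrow> schwartz \<phi> \<Longrightarrow> schwartz \<psi> \<Longrightarrow> u (\<lambda>x. \<phi> x + \<psi> x) = u \<phi> + u \<psi>"
  unfolding tempered_def by blast

lemma tempered_cmult: "tempered u \<Longrightarrow> schwartz \<phi> \<Longrightarrow> u (\<lambda>x. c * \<phi> x) = c * u \<phi>"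
  unfolding tempered_def by blast

lemma tempered_diff:
  assumes "tempered u" "schwartz \<phi>" "schwartz \<psi>"
  shows "u (\<lambda>x. \<phi> x - c * \<psi> x) = u \<phi> - c * u \<psi>"
  using tempered_add[OF assms(1,2) schwartz_cmult[OF assms(3), of "- c"]]
    tempered_cmult[OF assms(1,3), of "- c"] by simp

lemma iter_partial_diff:
  fixes f g :: "real ^ 'n::finite \<Rightarrow> complex"
  assumes "smooth f" "smooth g"
  shows "iter_partial js (\<lambda>x. f x - c * g x) = (\<lambda>x. iter_partial js f x - c * iter_partial js g x)"
proof -
  have "smooth (\<lambda>x. - c * g x)" using assms by (intro smooth_mult) auto
  from iter_partial_add[OF assms(1) this] show ?thesis
    using iter_partial_cmult[OF assms(2), of js "- c"] by simp
qed

lemma schwartz_diff: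
  fixes f g :: "real ^ 'n::finite \<Rightarrow> complex"
  assumes "schwartz f" "schwartz g" shows "schwartz (\<lambda>x. f x - c * g x)"
  using schwartz_add[OF assms(1) schwartz_cmult[OF assms(2), of "- c"]] by simp

text \<open>The mean value inequality on the segment from \<open>y - x\<close> to
  \<open>y - x'\<close>. As the segment has length at most 1, the weight at \<open>y\<close> is
  controlled by the weights at \<open>x\<close> and at any point of the segment.\<close>

lemma weighted_lipschitz:
  fixes H :: "real ^ 'n::finite \<Rightarrow> complex"
  assumes H: "schwartz H"
  obtains L where "0 \<le> L"
    "\<And>x x' y. norm (x - x') \<le> 1 \<Longrightarrow>
      japanese y ^ N * cmod (H (y - x) - H (y - x')) \<le> L * norm (x - x') * japanese x ^ N"
proof -
  obtain C where C: "0 \<le> C" "\<And>js x. length js \<le> 1 \<Longrightarrow> japanese x ^ N * cmod (iter_partial js H x) \<le> C"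
    by (rule schwartz_decay_uniform[OF H, of 1 N]) (blast intro: that)
  have C1: "japanese x ^ N * cmod (partial_deriv j H x) \<le> C" for j x
    using C(2)[of "[j]" x] by (simp add: iter_partial_Cons)
  \<comment> \<open>For \<open>w\<close> on the segment, \<langle>y - w\<rangle> \<le> 2 \<langle>y
    - w - x\<rangle> \<langle>x\<rangle> \<le> 4 \<langle>x\<rangle> and \<langle>y\<rangle> \<le> 2
    \<langle>y - w\<rangle> \<langle>w\<rangle>, which gives the factor 8.\<close>
  let ?L = "real CARD('n) * (8 ^ N * C)"
  have "japanese y ^ N * cmod (H (y - x) - H (y - x')) \<le> ?L * norm (x - x') * japanese x ^ N"
    if d: "norm (x - x') \<le> 1" for x x' y
  proof -
    have pos: "0 < japanese y ^ N" by simp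
    have "cmod (H (y - x) - H (y - x')) \<le>
        real CARD('n) * (8 ^ N * C * japanese x ^ N / japanese y ^ N) * norm ((y - x) - (y - x'))"
    proof (rule lipschitz_partial[OF schwartz_smooth[OF H], where S="closed_segment (y - x) (y - x')"])
      fix j w assume w: "w \<in> closed_segment (y - x) (y - x')"
      have "norm (y - x - w) \<le> 1"
        using segment_bound(1)[OF w] d by (simp add: norm_minus_commute)
      then have "(norm (y - x - w))\<^sup>2 \<le> 1" by (simp add: power_le_one)
      then have "(japanese (y - x - w))\<^sup>2 \<le> 2\<^sup>2" by (simp add: japanese_squared)
      then have "japanese (y - x - w) \<le> 2" by (rule power2_le_imp_le) simp
      moreover have "y - w - x = y - x - w" by simp
      ultimately have "japanese (y - w - x) \<le> 2" by metis
      then have "japanese (y - w - x) * japanese x \<le> 2 * japanese x"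
        by (rule mult_right_mono) (simp add: less_imp_le)
      moreover have "japanese (y - w) \<le> 2 * japanese (y - w - x) * japanese x"
        using japanese_add[of "y - w - x" x] by simp
      ultimately have "japanese (y - w) \<le> 4 * japanese x" by linarith
      then have "japanese (y - w) ^ N \<le> (4 * japanese x) ^ N"
        by (intro power_mono) (simp_all add: less_imp_le)
      moreover have "japanese y ^ N \<le> 2 ^ N * japanese (y - w) ^ N * japanese w ^ N"
        using japanese_add_power[of "y - w" w N] by simp
      moreover from calculation(1) have "2 ^ N * japanese (y - w) ^ N * japanese w ^ N \<le>
          2 ^ N * (4 * japanese x) ^ N * japanese w ^ N"
        by (intro mult_right_mono mult_left_mono) (simp_all add: less_imp_le)
      ultimately have "japanese y ^ N \<le> 2 ^ N * (4 * japanese x) ^ N * japanese w ^ N"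
        by linarith
      also have "\<dots> = 8 ^ N * japanese x ^ N * japanese w ^ N"
      proof -
        have "(8 :: real) ^ N = 2 ^ N * 4 ^ N" by (subst power_mult_distrib[symmetric]) simp
        then show ?thesis by (simp add: power_mult_distrib)
      qed
      finally have "japanese y ^ N * cmod (partial_deriv j H w) \<le>
          8 ^ N * japanese x ^ N * japanese w ^ N * cmod (partial_deriv j H w)"
        by (rule mult_right_mono) simp
      also have "\<dots> = 8 ^ N * japanese x ^ N * (japanese w ^ N * cmod (partial_deriv j H w))"
        by simp
      also have "\<dots> \<le> 8 ^ N * japanese x ^ N * C"
        by (intro mult_left_mono C1) (simp add: less_imp_le)
      finally show "cmod (partial_deriv j H w) \<le> 8 ^ N * C * japanese x ^ N / japanese y ^ N"
        using pos by (simp add: pos_le_divide_eq mult_ac)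
    qed auto
    also have "norm ((y - x) - (y - x')) = norm (x - x')" by (simp add: norm_minus_commute)
    finally show ?thesis using pos by (simp add: pos_le_divide_eq mult_ac)
  qed
  moreover have "0 \<le> ?L" using C(1) by simp
  ultimately show ?thesis using that by blast
qed

lemma weighted_lipschitz_uniform:
  fixes G :: "real ^ 'n::finite \<Rightarrow> complex"
  assumes G: "schwartz G"
  obtains L where "0 \<le> L"
    "\<And>js x x' y. length js \<le> m \<Longrightarrow> norm (x - x') \<le> 1 \<Longrightarrow>
      japanese y ^ N * cmod (iter_partial js G (y - x) - iter_partial js G (y - x')) \<le>
        L * norm (x - x') * japanese x ^ N"
proof -
  have "\<forall>js. \<exists>L. 0 \<le> L \<and> (\<forall>x x' y. norm (x - x') \<le> 1 \<longrightarrow>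
      japanese y ^ N * cmod (iter_partial js G (y - x) - iter_partial js G (y - x')) \<le>
        L * norm (x - x') * japanese x ^ N)"
  proof
    fix js
    show "\<exists>L. 0 \<le> L \<and> (\<forall>x x' y. norm (x - x') \<le> 1 \<longrightarrow>
        japanese y ^ N * cmod (iter_partial js G (y - x) - iter_partial js G (y - x')) \<le>
          L * norm (x - x') * japanese x ^ N)"
      by (rule weighted_lipschitz[OF schwartz_iter_partial[OF G], of N js]) blast
  qed
  then obtain L where "\<forall>js. 0 \<le> L js \<and> (\<forall>x x' y. norm (x - x') \<le> 1 \<longrightarrow>
      japanese y ^ N * cmod (iter_partial js G (y - x) - iter_partial js G (y - x')) \<le>
        L js * norm (x - x') * japanese x ^ N)"
    by (rule choice[THEN exE])
  then have L: "\<And>js. 0 \<le> L js" "\<And>js x x' y. norm (x - x') \<le> 1 \<Longrightarrow>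
      japanese y ^ N * cmod (iter_partial js G (y - x) - iter_partial js G (y - x')) \<le>
        L js * norm (x - x') * japanese x ^ N"
    by auto
  let ?S = "{js :: 'n list. set js \<subseteq> UNIV \<and> length js \<le> m}"
  have fin: "finite ?S" by (rule finite_lists_length_le) simp
  have "japanese y ^ N * cmod (iter_partial js G (y - x) - iter_partial js G (y - x')) \<le>
        sum L ?S * norm (x - x') * japanese x ^ N"
    if js: "length js \<le> m" and d: "norm (x - x') \<le> 1" for js x x' y
  proof -
    have "L js \<le> sum L ?S" using js L(1) fin by (intro member_le_sum) auto
    then have "L js * norm (x - x') * japanese x ^ N \<le> sum L ?S * norm (x - x') * japanese x ^ N"
      by (intro mult_right_mono) (auto simp: less_imp_le)
    then show ?thesis using L(2)[OF d, of y js] by linarith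
  qed
  moreover have "0 \<le> sum L ?S" using L(1) by (intro sum_nonneg) auto
  ultimately show ?thesis using that by blast
qed

lemma moments_restrict:
  fixes \<phi> :: "real ^ 'n::finite \<Rightarrow> complex"
  assumes \<phi>: "moments \<phi>" and A[measurable]: "A \<in> sets borel"
  shows "moments (\<lambda>x. \<phi> x * of_bool (x \<in> A))"
proof -
  have [measurable]: "\<phi> \<in> borel_measurable borel" using \<phi> by (rule moments_measurable)
  have m: "(\<lambda>x. \<phi> x * of_bool (x \<in> A)) \<in> borel_measurable borel" by measurable
  have "integrable lborel (\<lambda>x. cmod (\<phi> x * of_bool (x \<in> A)) * japanese x ^ N)" for N
    by (rule Bochner_Integration.integrable_bound[OF moments_integrable_norm[OF \<phi>, of N]])
      (use m in \<open>auto simp: less_imp_le\<close>)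
  with m show ?thesis by (simp add: moments_def)
qed

text \<open>All four estimates come from the one seminorm that dominates \<open>u\<close>, so they
  share \<open>K\<close> and \<open>N\<close>: growth and local Lipschitz continuity of
  \<open>g\<close>, boundedness of \<open>u\<close> on convolutions, and the error made when
  \<open>\<phi>\<close>, concentrated near \<open>x\<^sub>0\<close>, is replaced by a point mass of
  the same integral. The last one drives the exchange of \<open>u\<close> with the convolution
  integral.\<close>

lemma tempered_translates:
  fixes u :: "'n::finite distribution" and G :: "real ^ 'n \<Rightarrow> complex"
  assumes u: "tempered u" and G: "schwartz G"
  defines "g \<equiv> \<lambda>x. u (\<lambda>y. G (y - x))"
  shows "\<exists>K N. 0 \<le> K \<and>
    (\<forall>x. cmod (g x) \<le> K * japanese x ^ N) \<and>
    (\<forall>x x'. norm (x - x') \<le> 1 \<longrightarrow> cmod (g x - g x') \<le> K * norm (x - x') * japanese x ^ N) \<and>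
    (\<forall>\<phi>. moments \<phi> \<longrightarrow> cmod (u (conv \<phi> G)) \<le> K * (\<integral>x. cmod (\<phi> x) * japanese x ^ N \<partial>lborel)) \<and>
    (\<forall>\<phi> x\<^sub>0 \<delta>. moments \<phi> \<longrightarrow> \<delta> \<le> 1 \<longrightarrow> (\<forall>x. \<phi> x \<noteq> 0 \<longrightarrow> norm (x - x\<^sub>0) \<le> \<delta>) \<longrightarrow>
      cmod (u (conv \<phi> G) - (\<integral>x. \<phi> x \<partial>lborel) * g x\<^sub>0) \<le>
        K * \<delta> * (\<integral>x. cmod (\<phi> x) * japanese x ^ N \<partial>lborel))"
proof -
  obtain C N where C: "0 \<le> C"
    "\<And>\<Phi> B. schwartz \<Phi> \<Longrightarrow> (\<And>js x. length js \<le> N \<Longrightarrow> japanese x ^ N * cmod (iter_partial js \<Phi> x) \<le> B)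
      \<Longrightarrow> cmod (u \<Phi>) \<le> C * B"
    by (rule tempered_bound[OF u]) (blast intro: that)
  obtain A where A: "0 \<le> A" "\<And>js x. length js \<le> N \<Longrightarrow> japanese x ^ N * cmod (iter_partial js G x) \<le> A"
    by (rule schwartz_decay_uniform[OF G, of N N]) (blast intro: that)
  obtain L where L: "0 \<le> L"
    "\<And>js x x' y. length js \<le> N \<Longrightarrow> norm (x - x') \<le> 1 \<Longrightarrow>
      japanese y ^ N * cmod (iter_partial js G (y - x) - iter_partial js G (y - x')) \<le>
        L * norm (x - x') * japanese x ^ N"
    by (rule weighted_lipschitz_uniform[OF G, of N N]) (blast intro: that)
  have GS: "schwartz (\<lambda>y. G (y - x))" for x by (rule schwartz_shift[OF G])
  have sG: "smooth G" by (rule schwartz_smooth[OF G])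
  have J: "0 \<le> (\<integral>x. cmod (\<phi> x) * japanese x ^ N \<partial>lborel)" for \<phi> :: "real ^ 'n \<Rightarrow> complex"
    by (simp add: less_imp_le)
  define K where "K = C * (2 ^ N * A) + C * L"
  have K1: "C * (2 ^ N * A) \<le> K" and K2: "C * L \<le> K" using A L C by (auto simp: K_def)
  show ?thesis
  proof (intro exI[of _ K] exI[of _ N] conjI allI impI)
    show "0 \<le> K" using A L C by (auto simp: K_def)
    show "cmod (g x) \<le> K * japanese x ^ N" for x
    proof -
      have "cmod (g x) \<le> C * (2 ^ N * A * japanese x ^ N)"
        unfolding g_def
        by (rule C(2)[OF GS], unfold iter_partial_shift[OF sG]) (rule weighted_shift_bound[OF A(2)])
      also have "\<dots> \<le> K * japanese x ^ N"
        using mult_right_mono[OF K1, of "japanese x ^ N"] by (simp add: mult_ac less_imp_le)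
      finally show ?thesis .
    qed
    show "cmod (g x - g x') \<le> K * norm (x - x') * japanese x ^ N" if "norm (x - x') \<le> 1" for x x'
    proof -
      have "g x - g x' = u (\<lambda>y. G (y - x) - 1 * G (y - x'))"
        unfolding g_def by (subst tempered_diff[OF u GS GS]) simp
      also have "cmod \<dots> \<le> C * (L * norm (x - x') * japanese x ^ N)"
      proof (rule C(2)[OF schwartz_diff[OF GS GS]])
        fix js :: "'n list" and y assume "length js \<le> N"
        from L(2)[OF this that, of y]
        show "japanese y ^ N * cmod (iter_partial js (\<lambda>y. G (y - x) - 1 * G (y - x')) y) \<le>
            L * norm (x - x') * japanese x ^ N"
          unfolding iter_partial_diff[OF smooth_shift[OF sG] smooth_shift[OF sG]] iter_partial_shift[OF sG]
          by simp
      qed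
      also have "\<dots> \<le> K * norm (x - x') * japanese x ^ N"
        using mult_right_mono[OF K2, of "norm (x - x') * japanese x ^ N"] by (simp add: mult_ac less_imp_le)
      finally show ?thesis .
    qed
    show "cmod (u (conv \<phi> G)) \<le> K * (\<integral>x. cmod (\<phi> x) * japanese x ^ N \<partial>lborel)" if \<phi>: "moments \<phi>" for \<phi>
    proof -
      have "cmod (u (conv \<phi> G)) \<le> C * (2 ^ N * A * (\<integral>x. cmod (\<phi> x) * japanese x ^ N \<partial>lborel))"
      proof (rule C(2)[OF schwartz_conv[OF \<phi> G]])
        fix js :: "'n list" and y assume "length js \<le> N"
        then show "japanese y ^ N * cmod (iter_partial js (conv \<phi> G) y) \<le>
            2 ^ N * A * (\<integral>x. cmod (\<phi> x) * japanese x ^ N \<partial>lborel)"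
          unfolding iter_partial_conv[OF \<phi> G] conv_def
          by (intro weighted_integral_bound[OF \<phi>] weighted_shift_bound[OF A(2)]) (auto simp: less_imp_le)
      qed
      also have "\<dots> \<le> K * (\<integral>x. cmod (\<phi> x) * japanese x ^ N \<partial>lborel)"
        using mult_right_mono[OF K1 J] by (simp add: mult_ac)
      finally show ?thesis .
    qed
    fix \<phi> :: "real ^ 'n \<Rightarrow> complex" and x\<^sub>0 \<delta>
    assume \<phi>: "moments \<phi>" and \<delta>: "\<delta> \<le> 1" and supp: "\<forall>x. \<phi> x \<noteq> 0 \<longrightarrow> norm (x - x\<^sub>0) \<le> \<delta>"
    show "cmod (u (conv \<phi> G) - (\<integral>x. \<phi> x \<partial>lborel) * g x\<^sub>0) \<le>
        K * \<delta> * (\<integral>x. cmod (\<phi> x) * japanese x ^ N \<partial>lborel)"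
    \<comment> \<open>The sign of \<delta> is left open: a nonzero \<open>\<phi>\<close> forces
      \<delta> \<ge> 0, and for zero \<open>\<phi>\<close> both sides vanish.\<close>
    proof (cases "\<phi> = (\<lambda>_. 0)")
      case True
      then have "conv \<phi> G = (\<lambda>_. 0)" by (simp add: conv_def[abs_def])
      moreover have "u (\<lambda>_. 0) = 0" using tempered_cmult[OF u G, of 0] by simp
      ultimately show ?thesis using True by simp
    next
      case False
      then have \<delta>0: "0 \<le> \<delta>" using supp by (meson ext norm_ge_zero order_trans)
      define I where "I = (\<integral>x. \<phi> x \<partial>lborel)"
      have "u (conv \<phi> G) - I * g x\<^sub>0 = u (\<lambda>y. conv \<phi> G y - I * G (y - x\<^sub>0))"
        unfolding g_def by (rule tempered_diff[OF u schwartz_conv[OF \<phi> G] GS, symmetric])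
      also have "cmod \<dots> \<le> C * (L * \<delta> * (\<integral>x. cmod (\<phi> x) * japanese x ^ N \<partial>lborel))"
      proof (rule C(2)[OF schwartz_diff[OF schwartz_conv[OF \<phi> G] GS]])
        fix js :: "'n list" and y assume js: "length js \<le> N"
        let ?H = "iter_partial js G"
        have "iter_partial js (\<lambda>y. conv \<phi> G y - I * G (y - x\<^sub>0)) y = conv \<phi> ?H y - I * ?H (y - x\<^sub>0)"
          by (simp add: iter_partial_diff[OF schwartz_smooth[OF schwartz_conv[OF \<phi> G]] schwartz_smooth[OF GS]]
              iter_partial_conv[OF \<phi> G] iter_partial_shift[OF sG])
        also have "\<dots> = (\<integral>x. \<phi> x * ?H (y - x) \<partial>lborel) - (\<integral>x. \<phi> x * ?H (y - x\<^sub>0) \<partial>lborel)"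
          unfolding I_def conv_def by simp
        also have "\<dots> = (\<integral>x. \<phi> x * ?H (y - x) - \<phi> x * ?H (y - x\<^sub>0) \<partial>lborel)"
          using integrable_conv[OF \<phi> schwartz_iter_partial[OF G]] moments_integrable[OF \<phi>]
          by (intro Bochner_Integration.integral_diff[symmetric]) auto
        also have "\<dots> = (\<integral>x. \<phi> x * (?H (y - x) - ?H (y - x\<^sub>0)) \<partial>lborel)"
          by (simp add: right_diff_distrib)
        finally have e: "iter_partial js (\<lambda>y. conv \<phi> G y - I * G (y - x\<^sub>0)) y =
            (\<integral>x. \<phi> x * (?H (y - x) - ?H (y - x\<^sub>0)) \<partial>lborel)" .
        show "japanese y ^ N * cmod (iter_partial js (\<lambda>y. conv \<phi> G y - I * G (y - x\<^sub>0)) y) \<le>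
            L * \<delta> * (\<integral>x. cmod (\<phi> x) * japanese x ^ N \<partial>lborel)"
          unfolding e
        proof (rule weighted_integral_bound[OF \<phi>])
          fix x assume "\<phi> x \<noteq> 0"
          with supp have d: "norm (x - x\<^sub>0) \<le> \<delta>" by blast
          then have "japanese y ^ N * cmod (?H (y - x) - ?H (y - x\<^sub>0)) \<le> L * norm (x - x\<^sub>0) * japanese x ^ N"
            using \<delta> by (intro L(2) js) auto
          also have "\<dots> \<le> L * \<delta> * japanese x ^ N"
            using d L(1) by (intro mult_right_mono mult_left_mono) (auto simp: less_imp_le)
          finally show "japanese y ^ N * cmod (?H (y - x) - ?H (y - x\<^sub>0)) \<le> L * \<delta> * japanese x ^ N" .
        qed (simp add: less_imp_le)
      qed
      also have "\<dots> \<le> K * \<delta> * (\<integral>x. cmod (\<phi> x) * japanese x ^ N \<partial>lborel)"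
        using mult_right_mono[OF K2 mult_nonneg_nonneg[OF \<delta>0 J]] by (simp add: mult_ac)
      finally show ?thesis by (simp add: I_def)
    qed
  qed
qed

lemma continuous_tempered_translates:
  fixes u :: "'n::finite distribution" and G :: "real ^ 'n \<Rightarrow> complex"
  assumes u: "tempered u" and G: "schwartz G"
  shows "continuous_on S (\<lambda>x. u (\<lambda>y. G (y - x)))"
proof (rule continuous_at_imp_continuous_on, rule ballI)
  fix x
  let ?g = "\<lambda>x. u (\<lambda>y. G (y - x))"
  define g where "g = ?g"
  obtain K N where K: "0 \<le> K \<and>
    (\<forall>x. cmod (?g x) \<le> K * japanese x ^ N) \<and>
    (\<forall>x x'. norm (x - x') \<le> 1 \<longrightarrow> cmod (?g x - ?g x') \<le> K * norm (x - x') * japanese x ^ N) \<and>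
    (\<forall>\<phi>. moments \<phi> \<longrightarrow> cmod (u (conv \<phi> G)) \<le> K * (\<integral>x. cmod (\<phi> x) * japanese x ^ N \<partial>lborel)) \<and>
    (\<forall>\<phi> x\<^sub>0 \<delta>. moments \<phi> \<longrightarrow> \<delta> \<le> 1 \<longrightarrow> (\<forall>x. \<phi> x \<noteq> 0 \<longrightarrow> norm (x - x\<^sub>0) \<le> \<delta>) \<longrightarrow>
      cmod (u (conv \<phi> G) - (\<integral>x. \<phi> x \<partial>lborel) * ?g x\<^sub>0) \<le>
        K * \<delta> * (\<integral>x. cmod (\<phi> x) * japanese x ^ N \<partial>lborel))"
    using tempered_translates[OF u G] by (elim exE) (rule that)
  have g: "?g x = g x" for x by (simp add: g_def)
  have K: "0 \<le> K" "\<And>x x'. norm (x - x') \<le> 1 \<Longrightarrow> cmod (g x - g x') \<le> K * norm (x - x') * japanese x ^ N"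
    using K unfolding g by blast+
  have "((\<lambda>x'. g x - g x') \<longlongrightarrow> 0) (at x)"
  proof (rule Lim_null_comparison)
    show "\<forall>\<^sub>F x' in at x. norm (g x - g x') \<le> K * norm (x - x') * japanese x ^ N"
      unfolding eventually_at
    proof (intro exI[of _ 1] conjI ballI impI)
      fix x' assume "x' \<noteq> x \<and> dist x' x < 1"
      then have "norm (x - x') \<le> 1" by (simp add: dist_norm norm_minus_commute)
      then show "norm (g x - g x') \<le> K * norm (x - x') * japanese x ^ N" by (rule K(2))
    qed simp
    have "((\<lambda>x'. K * norm (x - x') * japanese x ^ N) \<longlongrightarrow> K * norm (x - x) * japanese x ^ N) (at x)"
      by (intro tendsto_intros)
    then show "((\<lambda>x'. K * norm (x - x') * japanese x ^ N) \<longlongrightarrow> 0) (at x)" by simp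
  qed
  from tendsto_diff[OF tendsto_const[of "g x"] this] have "(g \<longlongrightarrow> g x) (at x)" by simp
  then show "isCont (\<lambda>x. u (\<lambda>y. G (y - x))) x" by (simp add: isCont_def g_def)
qed

text \<open>The error of the exchange is additive in \<open>\<phi>\<close>, and of order \<open>\<delta>\<close> relative to a weighted
  \<open>L\<^sup>1\<close> norm if \<open>\<phi>\<close> lives on a ball of radius \<open>\<delta>\<close>; so it vanishes.\<close>

theorem tempered_conv:
  fixes u :: "'n::finite distribution" and G :: "real ^ 'n \<Rightarrow> complex"
  assumes u: "tempered u" and G: "schwartz G" and \<phi>: "moments \<phi>"
  shows "u (conv \<phi> G) = (\<integral>x. \<phi> x * u (\<lambda>y. G (y - x)) \<partial>lborel)"
proof -
  let ?g = "\<lambda>x. u (\<lambda>y. G (y - x))"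
  define g where "g = ?g"
  have g: "?g x = g x" for x by (simp add: g_def)
  obtain K N where K: "0 \<le> K \<and>
    (\<forall>x. cmod (?g x) \<le> K * japanese x ^ N) \<and>
    (\<forall>x x'. norm (x - x') \<le> 1 \<longrightarrow> cmod (?g x - ?g x') \<le> K * norm (x - x') * japanese x ^ N) \<and>
    (\<forall>\<phi>. moments \<phi> \<longrightarrow> cmod (u (conv \<phi> G)) \<le> K * (\<integral>x. cmod (\<phi> x) * japanese x ^ N \<partial>lborel)) \<and>
    (\<forall>\<phi> x\<^sub>0 \<delta>. moments \<phi> \<longrightarrow> \<delta> \<le> 1 \<longrightarrow> (\<forall>x. \<phi> x \<noteq> 0 \<longrightarrow> norm (x - x\<^sub>0) \<le> \<delta>) \<longrightarrow>
      cmod (u (conv \<phi> G) - (\<integral>x. \<phi> x \<partial>lborel) * ?g x\<^sub>0) \<le>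
        K * \<delta> * (\<integral>x. cmod (\<phi> x) * japanese x ^ N \<partial>lborel))"
    using tempered_translates[OF u G] by (elim exE) (rule that)
  have K: "0 \<le> K" "\<And>x. cmod (g x) \<le> K * japanese x ^ N"
    "\<And>x x'. norm (x - x') \<le> 1 \<Longrightarrow> cmod (g x - g x') \<le> K * norm (x - x') * japanese x ^ N"
    "\<And>\<phi>. moments \<phi> \<Longrightarrow> cmod (u (conv \<phi> G)) \<le> K * (\<integral>x. cmod (\<phi> x) * japanese x ^ N \<partial>lborel)"
    "\<And>\<phi> x\<^sub>0 \<delta>. moments \<phi> \<Longrightarrow> \<delta> \<le> 1 \<Longrightarrow> \<forall>x. \<phi> x \<noteq> 0 \<longrightarrow> norm (x - x\<^sub>0) \<le> \<delta> \<Longrightarrow>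
      cmod (u (conv \<phi> G) - (\<integral>x. \<phi> x \<partial>lborel) * g x\<^sub>0) \<le>
        K * \<delta> * (\<integral>x. cmod (\<phi> x) * japanese x ^ N \<partial>lborel)"
    using K unfolding g by simp_all
  have gm [measurable]: "g \<in> borel_measurable borel"
    unfolding g_def by (intro borel_measurable_continuous_onI continuous_tempered_translates u G)
  define J where "J \<phi> = (\<integral>x. cmod (\<phi> x) * japanese x ^ N \<partial>lborel)" for \<phi> :: "real ^ 'n \<Rightarrow> complex"
  define D where "D \<phi> = u (conv \<phi> G) - (\<integral>x. \<phi> x * g x \<partial>lborel)" for \<phi>
  have gi: "integrable lborel (\<lambda>x. \<phi> x * g x)" if "moments \<phi>" for \<phi>
    by (rule moments_integrable_mult[OF that gm K(2)])
  have D_add: "D (\<lambda>x. \<phi> x + \<psi> x) = D \<phi> + D \<psi>" if "moments \<phi>" "moments \<psi>" for \<phi> \<psi>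
    unfolding D_def conv_add[OF that G]
    using gi[OF that(1)] gi[OF that(2)]
    by (simp add: tempered_add[OF u schwartz_conv[OF that(1) G] schwartz_conv[OF that(2) G]] distrib_right)
  have D_bound: "cmod (D \<phi>) \<le> 2 * K * J \<phi>" if "moments \<phi>" for \<phi>
  proof -
    have "1 * cmod (\<integral>x. \<phi> x * g x \<partial>lborel) \<le> K * J \<phi>"
      unfolding J_def by (rule weighted_integral_bound[OF that]) (auto simp: K(2))
    then show ?thesis
      using K(4)[OF that] norm_triangle_ineq4[of "u (conv \<phi> G)" "\<integral>x. \<phi> x * g x \<partial>lborel"]
      by (simp add: D_def J_def)
  qed
  have D_local: "cmod (D \<phi>) \<le> 2 * K * \<delta> * J \<phi>"
    if \<phi>: "moments \<phi>" and \<delta>: "0 \<le> \<delta>" "\<delta> \<le> 1" and s: "\<And>x. \<phi> x \<noteq> 0 \<Longrightarrow> norm (x - x\<^sub>0) \<le> \<delta>" for \<phi> x\<^sub>0 \<delta>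
  proof -
    have "(\<integral>x. \<phi> x * g x \<partial>lborel) - (\<integral>x. \<phi> x \<partial>lborel) * g x\<^sub>0 = (\<integral>x. \<phi> x * (g x - g x\<^sub>0) \<partial>lborel)"
      using gi[OF \<phi>] moments_integrable[OF \<phi>] by (simp add: right_diff_distrib)
    moreover have "1 * cmod (\<integral>x. \<phi> x * (g x - g x\<^sub>0) \<partial>lborel) \<le> K * \<delta> * J \<phi>"
      unfolding J_def
    proof (rule weighted_integral_bound[OF \<phi>])
      fix x assume "\<phi> x \<noteq> 0"
      from s[OF this] have d: "norm (x - x\<^sub>0) \<le> \<delta>" .
      then have "cmod (g x - g x\<^sub>0) \<le> K * norm (x - x\<^sub>0) * japanese x ^ N" using \<delta> by (intro K(3)) auto
      also have "\<dots> \<le> K * \<delta> * japanese x ^ N"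
        using d K(1) by (intro mult_right_mono mult_left_mono) (auto simp: less_imp_le)
      finally show "1 * cmod (g x - g x\<^sub>0) \<le> K * \<delta> * japanese x ^ N" by simp
    qed simp
    ultimately have "cmod ((\<integral>x. \<phi> x * g x \<partial>lborel) - (\<integral>x. \<phi> x \<partial>lborel) * g x\<^sub>0) \<le> K * \<delta> * J \<phi>" by simp
    moreover have "cmod (u (conv \<phi> G) - (\<integral>x. \<phi> x \<partial>lborel) * g x\<^sub>0) \<le> K * \<delta> * J \<phi>"
      unfolding J_def by (rule K(5)[OF \<phi> \<delta>(2)]) (use s in blast)
    ultimately show ?thesis
      using norm_triangle_ineq4[of "u (conv \<phi> G) - (\<integral>x. \<phi> x \<partial>lborel) * g x\<^sub>0"
          "(\<integral>x. \<phi> x * g x \<partial>lborel) - (\<integral>x. \<phi> x \<partial>lborel) * g x\<^sub>0"]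
      by (simp add: D_def)
  qed
  obtain A :: "(real ^ 'n) set" where A: "countable A" "\<And>S. open S \<Longrightarrow> S \<noteq> {} \<Longrightarrow> \<exists>d\<in>A. d \<in> S"
    using countable_dense_setE by metis
  then have "A \<noteq> {}" using A(2)[of UNIV] by auto
  define e where "e = from_nat_into A"
  have e: "range e = A" unfolding e_def using A \<open>A \<noteq> {}\<close> by (simp add: range_from_nat_into)
  have main: "cmod (D \<phi>) \<le> 2 * K * \<delta> * J \<phi>" if \<delta>: "0 < \<delta>" "\<delta> \<le> 1" for \<delta>
  proof -
    \<comment> \<open>Balls around a dense sequence exhaust the space. Adding at each step only the
      part of a ball outside the preceding ones keeps the pieces disjoint, so their local errors sum
      to at most \<open>2 * K * \<delta> * J \<phi>\<close> whatever the number of pieces.\<close>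
    define U where "U n = (\<Union>i<n. ball (e i) \<delta>)" for n :: nat
    have [measurable]: "U n \<in> sets borel" for n unfolding U_def by (intro borel_open open_UN) auto
    have covers: "\<exists>n. x \<in> U n" for x
    proof -
      have "\<exists>d\<in>A. d \<in> ball x \<delta>" by (rule A(2)) (use \<delta> in auto)
      then obtain i where "e i \<in> ball x \<delta>" using e by blast
      then have "x \<in> U (Suc i)" by (auto simp: U_def dist_commute)
      then show ?thesis by blast
    qed
    have U_mono: "U m \<subseteq> U n" if "m \<le> n" for m n
      unfolding U_def using that by (intro UN_mono) auto
    have J_add: "J (\<lambda>x. \<phi> x * of_bool (x \<in> S)) + J (\<lambda>x. \<phi> x * of_bool (x \<in> T)) = J (\<lambda>x. \<phi> x * of_bool (x \<in> S \<union> T))"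
      if "S \<in> sets borel" "T \<in> sets borel" and "S \<inter> T = {}" for S T
    proof -
      let ?f = "\<lambda>S x. cmod (\<phi> x * of_bool (x \<in> S)) * japanese x ^ N"
      have "J (\<lambda>x. \<phi> x * of_bool (x \<in> S)) + J (\<lambda>x. \<phi> x * of_bool (x \<in> T)) = (\<integral>x. ?f S x + ?f T x \<partial>lborel)"
        unfolding J_def
        by (intro Bochner_Integration.integral_add[symmetric] moments_integrable_norm moments_restrict \<phi> that)
      also have "(\<lambda>x. ?f S x + ?f T x) = ?f (S \<union> T)"
        using that(3) by (auto simp: fun_eq_iff)
      finally show ?thesis by (simp add: J_def)
    qed
    have D_split: "D (\<lambda>x. \<phi> x * of_bool (x \<in> S \<union> T)) = D (\<lambda>x. \<phi> x * of_bool (x \<in> S)) + D (\<lambda>x. \<phi> x * of_bool (x \<in> T))"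
      if "S \<in> sets borel" "T \<in> sets borel" and "S \<inter> T = {}" for S T
    proof -
      have "(\<lambda>x. \<phi> x * of_bool (x \<in> S \<union> T)) = (\<lambda>x. \<phi> x * of_bool (x \<in> S) + \<phi> x * of_bool (x \<in> T))"
        using that by (auto simp: fun_eq_iff)
      then show ?thesis using D_add[OF moments_restrict[OF \<phi> that(1)] moments_restrict[OF \<phi> that(2)]] by simp
    qed
    have inner: "cmod (D (\<lambda>x. \<phi> x * of_bool (x \<in> U n))) \<le> 2 * K * \<delta> * J (\<lambda>x. \<phi> x * of_bool (x \<in> U n))" for n
    proof (induction n)
      case 0
      have "D (\<lambda>x. 0) = 0" using D_bound[OF moments_restrict[OF \<phi>, of "{}"]] by (simp add: J_def)
      then show ?case by (simp add: U_def J_def)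
    next
      case (Suc n)
      let ?B = "ball (e n) \<delta> - U n"
      have U: "U (Suc n) = U n \<union> ?B" by (auto simp: U_def lessThan_Suc)
      have B[measurable]: "?B \<in> sets borel" by measurable
      have "cmod (D (\<lambda>x. \<phi> x * of_bool (x \<in> ?B))) \<le> 2 * K * \<delta> * J (\<lambda>x. \<phi> x * of_bool (x \<in> ?B))"
        by (rule D_local[OF moments_restrict[OF \<phi> B], where x\<^sub>0="e n"])
          (use \<delta> in \<open>auto simp: dist_norm norm_minus_commute less_imp_le split: if_splits\<close>)
      moreover have "D (\<lambda>x. \<phi> x * of_bool (x \<in> U (Suc n))) =
          D (\<lambda>x. \<phi> x * of_bool (x \<in> U n)) + D (\<lambda>x. \<phi> x * of_bool (x \<in> ?B))"
        unfolding U by (rule D_split) auto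
      moreover have "J (\<lambda>x. \<phi> x * of_bool (x \<in> U (Suc n))) =
          J (\<lambda>x. \<phi> x * of_bool (x \<in> U n)) + J (\<lambda>x. \<phi> x * of_bool (x \<in> ?B))"
        unfolding U by (rule J_add[symmetric]) auto
      ultimately show ?case
        using Suc norm_triangle_ineq[of "D (\<lambda>x. \<phi> x * of_bool (x \<in> U n))" "D (\<lambda>x. \<phi> x * of_bool (x \<in> ?B))"]
        by (simp add: distrib_left)
    qed
    \<comment> \<open>Only finitely many pieces are added up, so the part of \<open>\<phi>\<close>
      outside \<open>U n\<close> is left over; the crude bound \<open>D_bound\<close> applies to it,
      and its weighted norm tends to zero.\<close>
    have lim: "(\<lambda>n. J (\<lambda>x. \<phi> x * of_bool (x \<in> - U n))) \<longlonglongrightarrow> (\<integral>(x::real ^ 'n). 0 \<partial>lborel)"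
      unfolding J_def
    proof (rule integral_dominated_convergence)
      have [measurable]: "\<phi> \<in> borel_measurable borel" using \<phi> by (rule moments_measurable)
      show "integrable lborel (\<lambda>x. cmod (\<phi> x) * japanese x ^ N)" by (rule moments_integrable_norm[OF \<phi>])
      show "(\<lambda>x. cmod (\<phi> x * of_bool (x \<in> - U n)) * japanese x ^ N) \<in> borel_measurable lborel" for n
        by measurable
      show "AE x in lborel. (\<lambda>n. cmod (\<phi> x * of_bool (x \<in> - U n)) * japanese x ^ N) \<longlonglongrightarrow> 0"
      proof (rule AE_I2)
        fix x
        obtain m where "x \<in> U m" using covers by blast
        then have "x \<in> U n" if "m \<le> n" for n using U_mono[OF that] by blast
        then have "\<forall>\<^sub>F n in sequentially. cmod (\<phi> x * of_bool (x \<in> - U n)) * japanese x ^ N = 0"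
          by (intro eventually_sequentiallyI[of m]) auto
        then show "(\<lambda>n. cmod (\<phi> x * of_bool (x \<in> - U n)) * japanese x ^ N) \<longlonglongrightarrow> 0"
          by (rule tendsto_eventually)
      qed
      show "AE x in lborel. norm (cmod (\<phi> x * of_bool (x \<in> - U n)) * japanese x ^ N) \<le> cmod (\<phi> x) * japanese x ^ N" for n
        by (intro AE_I2) (simp add: norm_mult less_imp_le)
    qed simp
    have bound: "cmod (D \<phi>) \<le> 2 * K * \<delta> * J \<phi> + 2 * K * J (\<lambda>x. \<phi> x * of_bool (x \<in> - U n))" for n
    proof -
      have "D \<phi> = D (\<lambda>x. \<phi> x * of_bool (x \<in> U n)) + D (\<lambda>x. \<phi> x * of_bool (x \<in> - U n))"
        using D_split[of "U n" "- U n"] by simp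
      moreover have "J (\<lambda>x. \<phi> x * of_bool (x \<in> U n)) \<le> J \<phi>"
        unfolding J_def
        by (intro integral_mono moments_integrable_norm \<phi> moments_restrict)
          (auto simp: norm_mult less_imp_le)
      then have "2 * K * \<delta> * J (\<lambda>x. \<phi> x * of_bool (x \<in> U n)) \<le> 2 * K * \<delta> * J \<phi>"
        using K(1) \<delta> by (intro mult_left_mono) auto
      moreover have "cmod (D (\<lambda>x. \<phi> x * of_bool (x \<in> - U n))) \<le> 2 * K * J (\<lambda>x. \<phi> x * of_bool (x \<in> - U n))"
        by (intro D_bound moments_restrict \<phi>) auto
      ultimately show ?thesis
        using inner[of n] norm_triangle_ineq[of "D (\<lambda>x. \<phi> x * of_bool (x \<in> U n))" "D (\<lambda>x. \<phi> x * of_bool (x \<in> - U n))"]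
        by simp
    qed
    have "(\<lambda>n. 2 * K * \<delta> * J \<phi> + 2 * K * J (\<lambda>x. \<phi> x * of_bool (x \<in> - U n))) \<longlonglongrightarrow> 2 * K * \<delta> * J \<phi> + 2 * K * 0"
      using lim by (intro tendsto_intros) simp
    from LIMSEQ_le_const[OF this] bound show ?thesis by simp
  qed
  have "(\<lambda>n. 2 * K * (1 / real (Suc n)) * J \<phi>) \<longlonglongrightarrow> 2 * K * 0 * J \<phi>"
    using LIMSEQ_inverse_real_of_nat by (intro tendsto_intros) (simp add: inverse_eq_divide)
  moreover have "cmod (D \<phi>) \<le> 2 * K * (1 / real (Suc n)) * J \<phi>" for n by (rule main) auto
  ultimately have "cmod (D \<phi>) \<le> 2 * K * 0 * J \<phi>" by (intro LIMSEQ_le_const) auto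
  then show ?thesis by (simp add: D_def g_def)
qed

section \<open>The frequency-uniform decomposition\<close>

lemma open_AE_empty:
  fixes S :: "'a::euclidean_space set"
  assumes "open S" "AE x in lborel. x \<notin> S" shows "S = {}"
proof -
  have "S \<in> null_sets lborel"
    using assms by (subst AE_iff_null_sets) auto
  then have "negligible S"
    by (simp add: negligible_iff_null_sets null_sets_completionI)
  then show ?thesis using open_not_negligible assms(1) by blast
qed

text \<open>The fundamental lemma of the calculus of variations. The cut-off function is made from
  the given \<eta>: its squared modulus, dilated and moved to \<open>x\<^sub>0\<close>, is a
  nonnegative test function positive at that point.\<close>

lemma represents_unique:
  fixes u :: "'n::finite distribution" and \<eta> :: "real ^ 'n \<Rightarrow> complex"
  assumes g: "represents g u" and g': "represents g' u"
    and \<eta>: "test_fun \<eta>" "\<eta> 0 \<noteq> 0"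
  shows "g = g'"
proof
  fix x\<^sub>0 :: "real ^ 'n"
  define h where "h x = g x - g' x" for x
  define c where "c = h x\<^sub>0"
  have hc: "continuous_on UNIV h"
    using g g' unfolding h_def represents_def by (intro continuous_intros) auto
  have h0: "integrable lborel (\<lambda>x. h x * \<phi> x)" "(\<integral>x. h x * \<phi> x \<partial>lborel) = 0" if "schwartz \<phi>" for \<phi>
    using g g' that unfolding represents_def h_def by (auto simp: left_diff_distrib)
  show "g x\<^sub>0 = g' x\<^sub>0"
  proof (rule ccontr)
    assume "g x\<^sub>0 \<noteq> g' x\<^sub>0"
    then have c: "c \<noteq> 0" by (simp add: c_def h_def)
    \<comment> \<open>Rotating by the conjugate of the value \<open>h x\<^sub>0\<close> yields a
      real function that is positive near \<open>x\<^sub>0\<close>.\<close>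
    define f where "f x = Re (cnj c * h x)" for x
    have fc: "continuous_on UNIV f" unfolding f_def by (intro continuous_intros hc)
    have f0: "0 < f x\<^sub>0" using c by (simp add: f_def c_def mult.commute[of "cnj _"] complex_norm_square[symmetric] del: of_real_power)
    have "open {x. 0 < f x}" using fc by (intro open_Collect_less continuous_intros)
    then obtain r where r: "0 < r" "\<And>x. dist x x\<^sub>0 < r \<Longrightarrow> 0 < f x"
      using f0 unfolding open_dist by blast
    obtain R where R: "\<And>x. R < norm x \<Longrightarrow> \<eta> x = 0" using \<eta>(1) by (auto simp: test_fun_def)
    \<comment> \<open>This dilation squeezes the support into the ball of radius \<open>r\<close>,
      where \<open>f\<close> is positive; the 1 yields the strict inequality that the choice of
      \<open>R\<close> asks for.\<close>
    define a where "a = (\<bar>R\<bar> + 1) / r"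
    have a: "0 < a" using r by (simp add: a_def)
    define \<psi> where "\<psi> x = \<eta> (a *\<^sub>R x + - (a *\<^sub>R x\<^sub>0))" for x
    define b where "b x = (cmod (\<psi> x))\<^sup>2" for x
    have t\<psi>: "test_fun \<psi>" unfolding \<psi>_def using a by (intro test_fun_affine \<eta>) auto
    have tb: "test_fun (\<lambda>x. complex_of_real (b x))"
      unfolding b_def complex_norm_square using test_fun_mult[OF smooth_cnj[OF test_fun_smooth[OF t\<psi>]] t\<psi>]
      by (simp add: mult.commute)
    have b_supp: "b x = 0" if "r \<le> dist x x\<^sub>0" for x
    proof -
      have "a * r \<le> a * dist x x\<^sub>0" using that a by simp
      moreover have "a * r = \<bar>R\<bar> + 1" using r by (simp add: a_def)
      moreover have "norm (a *\<^sub>R x + - (a *\<^sub>R x\<^sub>0)) = a * dist x x\<^sub>0"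
        using a by (simp add: dist_norm scaleR_diff_right[symmetric])
      ultimately have "\<psi> x = 0" unfolding \<psi>_def by (intro R) linarith
      then show ?thesis by (simp add: b_def)
    qed
    have b0: "0 < b x\<^sub>0" using \<eta>(2) by (simp add: b_def \<psi>_def)
    have i: "integrable lborel (\<lambda>x. cnj c * (h x * of_real (b x)))"
      by (intro integrable_mult_right h0 schwartz_test_fun tb)
    have e: "f x * b x = Re (cnj c * (h x * of_real (b x)))" for x
      by (simp add: f_def algebra_simps)
    have "(\<integral>x. f x * b x \<partial>lborel) = Re (\<integral>x. cnj c * (h x * of_real (b x)) \<partial>lborel)"
      unfolding e by (rule integral_Re[OF i])
    also have "\<dots> = 0" using h0(2)[OF schwartz_test_fun[OF tb]] by simp
    finally have "(\<integral>x. f x * b x \<partial>lborel) = 0" .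
    moreover have "integrable lborel (\<lambda>x. f x * b x)" unfolding e by (rule integrable_Re[OF i])
    moreover have nn: "0 \<le> f x * b x" for x
      using r(2)[of x] b_supp[of x] by (cases "dist x x\<^sub>0 < r") (auto simp: b_def less_imp_le)
    ultimately have "AE x in lborel. f x * b x = 0"
      using integral_nonneg_eq_0_iff_AE[of lborel "\<lambda>x. f x * b x"] by auto
    then have "AE x in lborel. x \<notin> {x. 0 < f x * b x}" by (rule AE_mp) auto
    moreover have "open {x. 0 < f x * b x}"
      unfolding b_def using fc smooth_continuous_on[OF test_fun_smooth[OF t\<psi>]]
      by (intro open_Collect_less continuous_intros) auto
    ultimately have "{x. 0 < f x * b x} = {}" by (intro open_AE_empty)
    then show False using mult_pos_pos[OF f0 b0] by blast
  qed
qed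

section \<open>The window and its partition of unity\<close>

lemma finite_lattice_box:
  fixes A :: "'n::finite \<Rightarrow> int set"
  assumes "\<And>i. finite (A i)"
  shows "finite {k :: int ^ 'n. \<forall>i. k $ i \<in> A i}"
proof (rule finite_subset)
  show "{k :: int ^ 'n. \<forall>i. k $ i \<in> A i} \<subseteq> (\<lambda>f. \<chi> i. f i) ` (PiE UNIV A)"
  proof
    fix k :: "int ^ 'n" assume "k \<in> {k. \<forall>i. k $ i \<in> A i}"
    then have "(\<lambda>i. k $ i) \<in> PiE UNIV A" by auto
    moreover have "k = (\<chi> i. k $ i)" by (simp add: vec_eq_iff)
    ultimately show "k \<in> (\<lambda>f. \<chi> i. f i) ` (PiE UNIV A)" by blast
  qed
  show "finite ((\<lambda>f. \<chi> i. f i :: int ^ 'n) ` (PiE UNIV A))"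
    by (intro finite_imageI finite_PiE assms) simp
qed

lemma lattice_pt_nth [simp]: "lattice_pt k $ i = real_of_int (k $ i)"
  by (simp add: lattice_pt_def)

context
  fixes \<sigma> :: "real ^ 'n::finite \<Rightarrow> complex"
  assumes \<sigma>: "decomposition_window \<sigma>"
begin

lemma window_support: "3 / 4 < \<bar>\<xi> $ i\<bar> \<Longrightarrow> \<sigma> \<xi> = 0"
proof -
  assume a: "3 / 4 < \<bar>\<xi> $ i\<bar>"
  have "\<xi> \<notin> cbox (\<chi> i. - 3 / 4) (\<chi> i. 3 / 4)"
  proof
    assume "\<xi> \<in> cbox (\<chi> i. - 3 / 4) (\<chi> i. 3 / 4)"
    then have "- 3 / 4 \<le> \<xi> $ i \<and> \<xi> $ i \<le> 3 / 4" by (simp add: mem_box_cart)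
    with a show False by linarith
  qed
  then show ?thesis using \<sigma> by (simp add: decomposition_window_def)
qed

lemma test_fun_window: "test_fun \<sigma>"
  unfolding test_fun_def
proof (intro conjI exI allI impI)
  show "smooth \<sigma>" using \<sigma> by (simp add: decomposition_window_def)
  fix \<xi> :: "real ^ 'n" assume a: "real CARD('n) < norm \<xi>"
  have "\<exists>i. 1 < \<bar>\<xi> $ i\<bar>"
  proof (rule ccontr)
    assume "\<not> (\<exists>i. 1 < \<bar>\<xi> $ i\<bar>)"
    then have "(\<Sum>i\<in>UNIV. \<bar>\<xi> $ i\<bar>) \<le> (\<Sum>i\<in>(UNIV :: 'n set). 1)"
      by (intro sum_mono) (auto simp: not_less)
    then show False using a norm_le_l1_cart[of \<xi>] by simp
  qed
  then obtain i where "1 < \<bar>\<xi> $ i\<bar>" by blast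
  then show "\<sigma> \<xi> = 0" by (intro window_support[of \<xi> i]) simp
qed

lemma window_sum:
  assumes "finite M" "\<And>k. k \<notin> M \<Longrightarrow> \<sigma> (\<xi> - lattice_pt k) = 0"
  shows "(\<Sum>k\<in>M. \<sigma> (\<xi> - lattice_pt k)) = 1"
proof -
  have "((\<lambda>k. \<sigma> (\<xi> - lattice_pt k)) has_sum 1) UNIV"
    using \<sigma> by (simp add: decomposition_window_def)
  moreover have "((\<lambda>k. \<sigma> (\<xi> - lattice_pt k)) has_sum (\<Sum>k\<in>M. \<sigma> (\<xi> - lattice_pt k))) UNIV"
    using has_sum_finite[OF assms(1), of "\<lambda>k. \<sigma> (\<xi> - lattice_pt k)"]
    by (subst has_sum_cong_neutral[where T=M and g="\<lambda>k. \<sigma> (\<xi> - lattice_pt k)"])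
      (auto simp: assms(2))
  ultimately show ?thesis by (rule has_sum_unique[symmetric])
qed

text \<open>If k \<noteq> 0, some coordinate of \<xi> - k exceeds 1 - 1/4 = 3/4 in modulus, so the
  translate vanishes. The partition of unity then has a single nonzero term, which must be
  1.\<close>

lemma window_near_zero:
  assumes "\<And>i. \<bar>\<xi> $ i\<bar> < 1 / 4"
  shows "\<sigma> (\<xi> - lattice_pt k) = (if k = 0 then 1 else 0)"
proof -
  have z: "\<sigma> (\<xi> - lattice_pt k) = 0" if k: "k \<noteq> 0" for k
  proof -
    obtain i where "k $ i \<noteq> 0" using k by (auto simp: vec_eq_iff)
    then have "1 \<le> \<bar>k $ i\<bar>" by linarith
    then have "1 \<le> \<bar>real_of_int (k $ i)\<bar>" by linarith
    then have "3 / 4 < \<bar>\<xi> $ i - real_of_int (k $ i)\<bar>" using assms[of i] by linarith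
    then show ?thesis by (intro window_support[of _ i]) simp
  qed
  then show ?thesis using window_sum[of "{0}" \<xi>] z[of k] by auto
qed

lemma window_zero: "\<sigma> 0 = 1"
proof -
  have "lattice_pt 0 = (0 :: real ^ 'n)" by (simp add: vec_eq_iff)
  then show ?thesis using window_near_zero[of 0 0] by simp
qed

definition fat_window :: "real ^ 'n \<Rightarrow> complex" where
  "fat_window \<xi> = (\<Sum>m\<in>{m. \<forall>i. m $ i \<in> {-1..1}}. \<sigma> (\<xi> - lattice_pt m))"

lemma test_fun_fat_window: "test_fun fat_window"
  unfolding fat_window_def[abs_def] by (intro test_fun_sum test_fun_shift test_fun_window)

text \<open>On the support of \<sigma> all coordinates are at most 3/4 in modulus, so translates by
  k with some |k_i| \<ge> 2 vanish there and the 3^d remaining ones sum to 1.\<close>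

lemma window_mult_fat_window: "\<sigma> \<xi> * fat_window \<xi> = \<sigma> \<xi>"
proof (cases "\<exists>i. 3 / 4 < \<bar>\<xi> $ i\<bar>")
  case True
  then show ?thesis using window_support by auto
next
  case False
  have "fat_window \<xi> = 1"
    unfolding fat_window_def
  proof (rule window_sum)
    show "finite {m :: int ^ 'n. \<forall>i. m $ i \<in> {-1..1}}" by (rule finite_lattice_box) simp
    fix k :: "int ^ 'n" assume "k \<notin> {m. \<forall>i. m $ i \<in> {-1..1}}"
    then obtain i where "k $ i < -1 \<or> 1 < k $ i" by (auto simp: not_le)
    then have "2 \<le> \<bar>k $ i\<bar>" by linarith
    then have "2 \<le> \<bar>real_of_int (k $ i)\<bar>" by linarith
    then show "\<sigma> (\<xi> - lattice_pt k) = 0"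
    proof (intro window_support[of _ i])
      have "\<bar>\<xi> $ i\<bar> \<le> 3 / 4" using False by (simp add: not_less)
      then have "3 / 4 < \<bar>\<xi> $ i - real_of_int (k $ i)\<bar>"
        using \<open>2 \<le> \<bar>real_of_int (k $ i)\<bar>\<close> by linarith
      then show "3 / 4 < \<bar>(\<xi> - lattice_pt k) $ i\<bar>" by simp
    qed
  qed
  then show ?thesis by simp
qed

end

section \<open>Blocks of tempered distributions as functions\<close>

lemma fourier_shift:
  fixes h :: "real ^ 'n::finite \<Rightarrow> complex"
  assumes h[measurable]: "h \<in> borel_measurable borel"
  shows "fourier (\<lambda>\<xi>. h (\<xi> - a)) y = cis (- (2 * pi * (a \<bullet> y))) * fourier h y"
proof -
  have "fourier (\<lambda>\<xi>. h (\<xi> - a)) y = (\<integral>\<xi>. cis (- (2 * pi * ((a + \<xi>) \<bullet> y))) * h (a + \<xi> - a) \<partial>lborel)"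
    unfolding fourier_def by (rule lborel_integral_shift[symmetric]) measurable
  also have "\<dots> = (\<integral>\<xi>. cis (- (2 * pi * (a \<bullet> y))) * (cis (- (2 * pi * (\<xi> \<bullet> y))) * h \<xi>) \<partial>lborel)"
    by (simp add: mult.assoc[symmetric] cis_mult inner_add_left distrib_left add.commute)
  finally show ?thesis by (simp add: fourier_def)
qed

text \<open>The convolution theorem in the order of operations prescribed by
  \<open>box_dist\<close>: a block tested with \<open>\<phi>\<close> becomes the distribution
  applied to a convolution.\<close>

lemma fourier_mult_inv_fourier:
  fixes h \<phi> :: "real ^ 'n::finite \<Rightarrow> complex"
  assumes h: "test_fun h" and \<phi>: "integrable lborel \<phi>"
  shows "fourier (\<lambda>\<xi>. h \<xi> * inv_fourier \<phi> \<xi>) = conv \<phi> (fourier h)"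
proof
  fix y :: "real ^ 'n"
  let ?a = "\<lambda>\<xi>. cis (- (2 * pi * (\<xi> \<bullet> y))) * h \<xi>"
  have "fourier (\<lambda>\<xi>. h \<xi> * inv_fourier \<phi> \<xi>) y = (\<integral>\<xi>. ?a \<xi> * (\<integral>x. cis (2 * pi * (\<xi> \<bullet> x)) * \<phi> x \<partial>lborel) \<partial>lborel)"
    by (simp add: fourier_def inv_fourier_def mult.assoc)
  also have "\<dots> = (\<integral>x. \<phi> x * (\<integral>\<xi>. cis (2 * pi * (\<xi> \<bullet> x)) * ?a \<xi> \<partial>lborel) \<partial>lborel)"
  proof (rule fubini_tensor[where B=1])
    show "integrable lborel ?a" by (intro integrable_cis_mult test_fun_integrable h) simp
  qed (use \<phi> in auto)
  also have "\<dots> = conv \<phi> (fourier h) y"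
    by (simp add: conv_def fourier_def mult.assoc[symmetric] cis_mult inner_diff_right right_diff_distrib)
  finally show "fourier (\<lambda>\<xi>. h \<xi> * inv_fourier \<phi> \<xi>) y = conv \<phi> (fourier h) y" .
qed

lemma conv_shift:
  fixes x :: "real ^ 'n::finite"
  shows "conv T (\<lambda>y. G (y - x)) = (\<lambda>y. conv T G (y - x))"
  by (simp add: conv_def fun_eq_iff diff_diff_eq add.commute)

context
  fixes \<sigma> :: "real ^ 'n::finite \<Rightarrow> complex" and u :: "'n distribution"
  assumes \<sigma>: "decomposition_window \<sigma>" and u: "tempered u"
begin

lemma test_fun_window_shift: "test_fun (\<lambda>\<xi>. \<sigma> (\<xi> - lattice_pt k))"
  by (intro test_fun_shift test_fun_window \<sigma>)

text \<open>By the convolution theorem and the exchange of \<open>u\<close> with the convolution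
  integral, \<open>?g\<close> represents the block. The definite description then selects it by
  uniqueness, for which \<sigma> itself, equal to 1 at the origin, serves as the cut-off
  function.\<close>

lemma box_fun_eq:
  "box_fun \<sigma> k u = (\<lambda>x. u (\<lambda>y. fourier (\<lambda>\<xi>. \<sigma> (\<xi> - lattice_pt k)) (y - x)))" (is "_ = ?g")
proof -
  let ?G = "fourier (\<lambda>\<xi>. \<sigma> (\<xi> - lattice_pt k))"
  have G: "schwartz ?G" by (intro schwartz_fourier test_fun_window_shift)
  have c: "continuous_on UNIV ?g" by (rule continuous_tempered_translates[OF u G])
  obtain K N where K: "\<forall>x. cmod (?g x) \<le> K * japanese x ^ N"
    using tempered_translates[OF u G] by blast
  have rep: "represents ?g (box_dist \<sigma> k u)"
    unfolding represents_def
  proof (intro conjI allI impI c)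
    fix \<phi> :: "real ^ 'n \<Rightarrow> complex" assume \<phi>: "schwartz \<phi>"
    have m: "moments \<phi>" by (rule schwartz_moments[OF \<phi>])
    have "integrable lborel (\<lambda>x. \<phi> x * ?g x)"
      by (rule moments_integrable_mult[OF m borel_measurable_continuous_onI[OF c] K[rule_format]])
    then show "integrable lborel (\<lambda>x. ?g x * \<phi> x)" by (simp add: mult.commute)
    have "box_dist \<sigma> k u \<phi> = u (conv \<phi> ?G)"
      by (simp add: box_dist_def dist_inv_fourier_def dist_mult_def dist_fourier_def
          fourier_mult_inv_fourier test_fun_window_shift moments_integrable m)
    also have "\<dots> = (\<integral>x. ?g x * \<phi> x \<partial>lborel)"
      by (simp add: tempered_conv[OF u G m] mult.commute)
    finally show "box_dist \<sigma> k u \<phi> = (\<integral>x. ?g x * \<phi> x \<partial>lborel)" .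
  qed
  show ?thesis
    unfolding box_fun_def
  proof (rule the_equality[where P="\<lambda>g. represents g (box_dist \<sigma> k u)", OF rep])
    fix g assume "represents g (box_dist \<sigma> k u)"
    then show "g = ?g"
      by (rule represents_unique[OF _ rep test_fun_window[OF \<sigma>]]) (simp add: window_zero[OF \<sigma>])
  qed
qed

lemma continuous_box_fun: "continuous_on UNIV (box_fun \<sigma> k u)"
  unfolding box_fun_eq
  by (intro continuous_tempered_translates u schwartz_fourier test_fun_window_shift)

lemma box_fun_growth: "\<exists>K N. \<forall>x. cmod (box_fun \<sigma> k u x) \<le> K * japanese x ^ N"
  unfolding box_fun_eq
  using tempered_translates[OF u schwartz_fourier[OF test_fun_window_shift]] by blast

text \<open>Fourier inversion turns multiplication by the wide window into convolution with its
  Fourier transform, and \<open>u\<close> is exchanged with this convolution. As the kernel is a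
  transform rather than an inverse transform, the argument is x + z instead of x - z.\<close>

lemma box_fun_reproducing:
  "box_fun \<sigma> k u x = (\<integral>z. fourier (\<lambda>\<xi>. fat_window \<sigma> (\<xi> - lattice_pt k)) z * box_fun \<sigma> k u (x + z) \<partial>lborel)"
proof -
  let ?\<tau> = "\<lambda>\<xi>. fat_window \<sigma> (\<xi> - lattice_pt k)" and ?\<sigma> = "\<lambda>\<xi>. \<sigma> (\<xi> - lattice_pt k)"
  have \<tau>: "test_fun ?\<tau>" by (intro test_fun_shift test_fun_fat_window \<sigma>)
  have T: "moments (fourier ?\<tau>)" by (intro schwartz_moments schwartz_fourier \<tau>)
  have G: "schwartz (fourier ?\<sigma>)" by (intro schwartz_fourier test_fun_window_shift)
  have "fourier ?\<sigma> = fourier (\<lambda>\<xi>. ?\<sigma> \<xi> * inv_fourier (fourier ?\<tau>) \<xi>)"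
    by (simp add: fourier_inversion[OF \<tau>] window_mult_fat_window[OF \<sigma>])
  also have "\<dots> = conv (fourier ?\<tau>) (fourier ?\<sigma>)"
    by (intro fourier_mult_inv_fourier test_fun_window_shift moments_integrable T)
  finally have r: "conv (fourier ?\<tau>) (fourier ?\<sigma>) = fourier ?\<sigma>" ..
  have "u (\<lambda>y. fourier ?\<sigma> (y - x)) = u (conv (fourier ?\<tau>) (\<lambda>y. fourier ?\<sigma> (y - x)))"
    by (simp only: conv_shift r)
  also have "\<dots> = (\<integral>z. fourier ?\<tau> z * u (\<lambda>y. fourier ?\<sigma> (y - z - x)) \<partial>lborel)"
    by (rule tempered_conv[OF u schwartz_shift[OF G] T])
  also have "(\<lambda>z. u (\<lambda>y. fourier ?\<sigma> (y - z - x))) = (\<lambda>z. u (\<lambda>y. fourier ?\<sigma> (y - (x + z))))"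
    by (simp add: diff_diff_eq add.commute)
  finally show ?thesis unfolding box_fun_eq by metis
qed

end

lemma cmod_fourier_shift:
  fixes h :: "real ^ 'n::finite \<Rightarrow> complex"
  assumes "h \<in> borel_measurable borel"
  shows "cmod (fourier (\<lambda>\<xi>. h (\<xi> - a)) y) = cmod (fourier h y)"
  by (simp add: fourier_shift[OF assms] norm_mult)

section \<open>Test distributions with prescribed frequency blocks\<close>

lemma schwartz_norm_upper:
  fixes \<phi> :: "real ^ 'n::finite \<Rightarrow> complex"
  assumes \<phi>: "schwartz \<phi>" shows "cmod (\<phi> x) \<le> schwartz_norm 0 \<phi>"
proof -
  let ?S = "{js :: 'n list. length js \<le> 0} \<times> (UNIV :: (real ^ 'n) set)"
  let ?f = "\<lambda>(js, x). japanese x ^ 0 * cmod (iter_partial js \<phi> x)"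
  obtain C where "\<And>x. cmod (\<phi> x) \<le> C" using schwartz_bounded[OF \<phi>] by blast
  then have "bdd_above (?f ` ?S)" by (intro bdd_aboveI[of _ C]) auto
  moreover have "([], x) \<in> ?S" by simp
  ultimately have "?f ([], x) \<le> schwartz_norm 0 \<phi>"
    unfolding schwartz_norm_def by (rule cSUP_upper[rotated])
  then show ?thesis by simp
qed

lemma inv_fourier_measurable:
  fixes h :: "real ^ 'n::finite \<Rightarrow> complex"
  assumes "test_fun h"
  shows "inv_fourier h \<in> borel_measurable borel" "integrable lborel (inv_fourier h)"
proof -
  have s: "schwartz (fourier h)" by (rule schwartz_fourier[OF assms])
  have "integrable lborel (\<lambda>x. fourier h (0 + (- 1) *\<^sub>R x))"
    by (intro lborel_integrable_affine moments_integrable schwartz_moments s) simp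
  then show "integrable lborel (inv_fourier h)" by (simp add: inv_fourier_eq[abs_def])
  then show "inv_fourier h \<in> borel_measurable borel" by auto
qed

lemma tempered_integral:
  fixes F :: "real ^ 'n::finite \<Rightarrow> complex"
  assumes F: "integrable lborel F"
  shows "tempered (\<lambda>\<phi>. \<integral>x. F x * \<phi> x \<partial>lborel)"
proof -
  have i: "integrable lborel (\<lambda>x. F x * \<phi> x)" if \<phi>: "schwartz \<phi>" for \<phi>
  proof -
    have [measurable]: "F \<in> borel_measurable borel" "\<phi> \<in> borel_measurable borel"
      using F \<phi> by (auto simp: schwartz_measurable)
    have "integrable lborel (\<lambda>x. of_real (schwartz_norm 0 \<phi>) * F x)" using F by simp
    then show ?thesis
    proof (rule Bochner_Integration.integrable_bound)
      have "cmod (F x * \<phi> x) \<le> cmod (of_real (schwartz_norm 0 \<phi>) * F x)" for x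
        using mult_left_mono[OF schwartz_norm_upper[OF \<phi>, of x] norm_ge_zero[of "F x"]]
        by (simp add: norm_mult mult.commute abs_of_nonneg order_trans[OF norm_ge_zero schwartz_norm_upper[OF \<phi>]])
      then show "AE x in lborel. cmod (F x * \<phi> x) \<le> cmod (of_real (schwartz_norm 0 \<phi>) * F x)" by simp
    qed measurable
  qed
  have "cmod (\<integral>x. F x * \<phi> x \<partial>lborel) \<le> (\<integral>x. cmod (F x) \<partial>lborel) * schwartz_norm 0 \<phi>" if \<phi>: "schwartz \<phi>" for \<phi>
  proof -
    have "cmod (\<integral>x. F x * \<phi> x \<partial>lborel) \<le> (\<integral>x. cmod (F x) * schwartz_norm 0 \<phi> \<partial>lborel)"
      using F by (intro norm_integral_le) (auto simp: norm_mult intro!: mult_left_mono schwartz_norm_upper \<phi>)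
    then show ?thesis by simp
  qed
  moreover have "(\<integral>x. F x * (c * \<phi> x) \<partial>lborel) = c * (\<integral>x. F x * \<phi> x \<partial>lborel)" for c \<phi>
    by (subst integral_mult_right_zero[symmetric]) (simp add: mult_ac)
  ultimately show ?thesis
    unfolding tempered_def using i by (auto simp: distrib_left)
qed

text \<open>For the function \<open>inv_fourier h\<close> the block is the classical Fourier
  multiplier. After Fubini's theorem the inner integral is evaluated by Fourier inversion for the
  translated window.\<close>

lemma box_fun_inv_fourier:
  fixes \<sigma> h :: "real ^ 'n::finite \<Rightarrow> complex"
  assumes \<sigma>: "decomposition_window \<sigma>" and h: "test_fun h"
  shows "box_fun \<sigma> k (\<lambda>\<phi>. \<integral>x. inv_fourier h x * \<phi> x \<partial>lborel) =
    inv_fourier (\<lambda>\<xi>. \<sigma> (\<xi> - lattice_pt k) * h \<xi>)"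
proof
  fix x :: "real ^ 'n"
  let ?\<sigma> = "\<lambda>\<xi>. \<sigma> (\<xi> - lattice_pt k)"
  let ?G = "fourier ?\<sigma>"
  have \<sigma>t: "test_fun ?\<sigma>" by (intro test_fun_shift test_fun_window \<sigma>)
  have G: "schwartz ?G" by (intro schwartz_fourier \<sigma>t)
  have [measurable]: "?G \<in> borel_measurable borel" by (rule schwartz_measurable[OF G])
  have "box_fun \<sigma> k (\<lambda>\<phi>. \<integral>x. inv_fourier h x * \<phi> x \<partial>lborel) x =
      (\<integral>y. inv_fourier h y * ?G (y - x) \<partial>lborel)"
    by (simp add: box_fun_eq[OF \<sigma> tempered_integral[OF inv_fourier_measurable(2)[OF h]]])
  also have "\<dots> = (\<integral>y. ?G (y - x) * (\<integral>\<xi>. cis (2 * pi * (y \<bullet> \<xi>)) * h \<xi> \<partial>lborel) \<partial>lborel)"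
    by (simp add: inv_fourier_def mult.commute)
  also have "\<dots> = (\<integral>\<xi>. h \<xi> * (\<integral>y. cis (2 * pi * (y \<bullet> \<xi>)) * ?G (y - x) \<partial>lborel) \<partial>lborel)"
    by (rule fubini_tensor[where B=1])
      (use moments_integrable[OF schwartz_moments[OF schwartz_shift[OF G]]] test_fun_integrable[OF h] in auto)
  also have "\<dots> = (\<integral>\<xi>. cis (2 * pi * (x \<bullet> \<xi>)) * (?\<sigma> \<xi> * h \<xi>) \<partial>lborel)"
  proof (rule Bochner_Integration.integral_cong[OF refl])
    fix \<xi> :: "real ^ 'n"
    have "(\<integral>y. cis (2 * pi * (y \<bullet> \<xi>)) * ?G (y - x) \<partial>lborel) =
        (\<integral>y. cis (2 * pi * ((x + y) \<bullet> \<xi>)) * ?G (x + y - x) \<partial>lborel)"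
      by (rule lborel_integral_shift[symmetric]) measurable
    also have "\<dots> = (\<integral>y. cis (2 * pi * (x \<bullet> \<xi>)) * (cis (2 * pi * (y \<bullet> \<xi>)) * ?G y) \<partial>lborel)"
      by (simp add: mult.assoc[symmetric] cis_mult inner_add_left distrib_left)
    also have "\<dots> = cis (2 * pi * (x \<bullet> \<xi>)) * inv_fourier ?G \<xi>"
      by (simp add: inv_fourier_def inner_commute)
    finally show "h \<xi> * (\<integral>y. cis (2 * pi * (y \<bullet> \<xi>)) * ?G (y - x) \<partial>lborel) =
        cis (2 * pi * (x \<bullet> \<xi>)) * (?\<sigma> \<xi> * h \<xi>)"
      by (simp add: fourier_inversion[OF \<sigma>t] mult_ac)
  qed
  finally show "box_fun \<sigma> k (\<lambda>\<phi>. \<integral>x. inv_fourier h x * \<phi> x \<partial>lborel) x =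
      inv_fourier (\<lambda>\<xi>. ?\<sigma> \<xi> * h \<xi>) x" by (simp add: inv_fourier_def)
qed

text \<open>The summand \<open>\<eta> j\<close> is moved to frequency j, into the cube where the
  j-th window is 1 and all other windows vanish; hence the blocks decouple. Only moduli are
  recorded, since the move multiplies the block by a unimodular character.\<close>

lemma exists_block_distribution:
  fixes \<sigma> :: "real ^ 'n::finite \<Rightarrow> complex" and \<eta> :: "int ^ 'n \<Rightarrow> real ^ 'n \<Rightarrow> complex"
  assumes \<sigma>: "decomposition_window \<sigma>" and A: "finite A"
    and \<eta>: "\<And>k. k \<in> A \<Longrightarrow> test_fun (\<eta> k)"
    and supp: "\<And>k \<xi> i. k \<in> A \<Longrightarrow> \<eta> k \<xi> \<noteq> 0 \<Longrightarrow> \<bar>\<xi> $ i\<bar> < 1 / 4"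
  shows "\<exists>u. tempered u \<and>
    (\<forall>k x. cmod (box_fun \<sigma> k u x) = (if k \<in> A then cmod (inv_fourier (\<eta> k) x) else 0))"
proof -
  define h where "h \<xi> = (\<Sum>j\<in>A. \<eta> j (\<xi> - lattice_pt j))" for \<xi>
  have h: "test_fun h" unfolding h_def by (intro test_fun_sum test_fun_shift \<eta>)
  have block: "\<sigma> (\<xi> - lattice_pt k) * \<eta> j (\<xi> - lattice_pt j) = (if j = k then \<eta> k (\<xi> - lattice_pt k) else 0)"
    if "j \<in> A" for j k \<xi>
  proof (cases "\<eta> j (\<xi> - lattice_pt j) = 0")
    case False
    have "lattice_pt (k - j) = (lattice_pt k - lattice_pt j :: real ^ 'n)" by (simp add: vec_eq_iff)
    then have "\<sigma> (\<xi> - lattice_pt k) = \<sigma> ((\<xi> - lattice_pt j) - lattice_pt (k - j))" by simp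
    also have "\<dots> = (if k - j = 0 then 1 else 0)"
      by (rule window_near_zero[OF \<sigma>]) (rule supp[OF that False])
    finally show ?thesis by auto
  qed auto
  have "\<sigma> (\<xi> - lattice_pt k) * h \<xi> = (if k \<in> A then \<eta> k (\<xi> - lattice_pt k) else 0)" for k \<xi>
    using A by (simp add: h_def sum_distrib_left block)
  then have b: "box_fun \<sigma> k (\<lambda>\<phi>. \<integral>x. inv_fourier h x * \<phi> x \<partial>lborel) x =
      fourier (\<lambda>\<xi>. if k \<in> A then \<eta> k (\<xi> - lattice_pt k) else 0) (- x)" for k x
    by (simp only: box_fun_inv_fourier[OF \<sigma> h]) (simp only: inv_fourier_eq)
  have "cmod (fourier (\<lambda>\<xi>. if k \<in> A then \<eta> k (\<xi> - lattice_pt k) else 0) (- x)) =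
      (if k \<in> A then cmod (inv_fourier (\<eta> k) x) else 0)" for k x
  proof (cases "k \<in> A")
    case True
    then show ?thesis
      using cmod_fourier_shift[OF test_fun_measurable[OF \<eta>[OF True]], of "lattice_pt k" "- x"]
      by (simp add: inv_fourier_eq)
  qed (simp add: fourier_def)
  with b show ?thesis
    by (intro exI[of _ "\<lambda>\<phi>. \<integral>x. inv_fourier h x * \<phi> x \<partial>lborel"] conjI
        tempered_integral inv_fourier_measurable(2)[OF h]) auto
qed

section \<open>Powers and norms with values in the extended half-line\<close>

lemma ennreal_powr_ennreal: "0 \<le> x \<Longrightarrow> ennreal_powr (ennreal x) a = ennreal (x powr a)"
  by (simp add: ennreal_powr_def)

lemma ennreal_powr_top [simp]: "ennreal_powr \<top> a = \<top>"
  by (simp add: ennreal_powr_def)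

lemma ennreal_powr_0 [simp]: "ennreal_powr 0 a = 0"
  by (simp add: ennreal_powr_def)

lemma ennreal_powr_1 [simp]: "ennreal_powr x 1 = x"
  by (cases x) (auto simp: ennreal_powr_ennreal)

lemma ennreal_powr_mono: "x \<le> y \<Longrightarrow> 0 \<le> a \<Longrightarrow> ennreal_powr x a \<le> ennreal_powr y a"
  by (cases x; cases y) (auto simp: ennreal_powr_ennreal top_unique intro!: ennreal_leI powr_mono2)

lemma ennreal_powr_eq_0_iff [simp]: "ennreal_powr x a = 0 \<longleftrightarrow> x = 0"
  by (cases x) (auto simp: ennreal_powr_ennreal)

lemma ennreal_powr_eq_top_iff [simp]: "ennreal_powr x a = \<top> \<longleftrightarrow> x = \<top>"
  by (cases x) (auto simp: ennreal_powr_ennreal)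

text \<open>Every power fixes 0 and \<top>, whatever the exponent, so this and the following power
  laws hold for exponents of any sign.\<close>

lemma ennreal_powr_mult: "ennreal_powr (x * y) a = ennreal_powr x a * ennreal_powr y a"
proof (cases "x = \<top> \<or> y = \<top>")
  case True
  then show ?thesis by (cases "x = 0 \<or> y = 0") (auto simp: ennreal_mult_top ennreal_top_mult)
next
  case False
  then obtain u v where "x = ennreal u" "0 \<le> u" "y = ennreal v" "0 \<le> v"
    by (metis ennreal_cases)
  then show ?thesis by (simp add: ennreal_mult[symmetric] ennreal_powr_ennreal powr_mult)
qed

lemma ennreal_powr_powr: "ennreal_powr (ennreal_powr x a) b = ennreal_powr x (a * b)"
  by (cases x) (auto simp: ennreal_powr_ennreal powr_powr)

lemma ennreal_powr_add: "ennreal_powr x a * ennreal_powr x b = ennreal_powr x (a + b)"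
  by (cases x) (auto simp: ennreal_powr_ennreal powr_add ennreal_mult[symmetric])

lemma measurable_ennreal_powr [measurable]:
  assumes [measurable]: "f \<in> borel_measurable M"
  shows "(\<lambda>x. ennreal_powr (f x) a) \<in> borel_measurable M"
  unfolding ennreal_powr_def by measurable

section \<open>Function and sequence norms\<close>

lemma Lp_norm_ereal: "Lp_norm M (ereal P) f = ennreal_powr (\<integral>\<^sup>+x. ennreal_powr (f x) P \<partial>M) (1 / P)"
  by (simp add: Lp_norm_def)

lemma Lp_norm_infty: "Lp_norm M \<infinity> f = esssup M f"
  by (simp add: Lp_norm_def)

lemma Lp_norm_powr: "P \<noteq> 0 \<Longrightarrow> ennreal_powr (Lp_norm M (ereal P) f) P = (\<integral>\<^sup>+x. ennreal_powr (f x) P \<partial>M)"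
  by (simp add: Lp_norm_ereal ennreal_powr_powr)

lemma ereal_pos_cases:
  assumes "0 < (p::ereal)"
  obtains (fin) P where "p = ereal P" "0 < P" | (inf) "p = \<infinity>"
  using assms by (cases p) auto

lemma Lp_norm_le_iff:
  assumes "0 < P"
  shows "Lp_norm M (ereal P) f \<le> B \<longleftrightarrow> (\<integral>\<^sup>+x. ennreal_powr (f x) P \<partial>M) \<le> ennreal_powr B P"
proof
  assume "Lp_norm M (ereal P) f \<le> B"
  from ennreal_powr_mono[OF this, of P] show "(\<integral>\<^sup>+x. ennreal_powr (f x) P \<partial>M) \<le> ennreal_powr B P"
    using assms by (simp add: Lp_norm_powr)
next
  assume "(\<integral>\<^sup>+x. ennreal_powr (f x) P \<partial>M) \<le> ennreal_powr B P"
  from ennreal_powr_mono[OF this, of "1 / P"] show "Lp_norm M (ereal P) f \<le> B"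
    using assms by (simp add: Lp_norm_ereal ennreal_powr_powr)
qed

lemma Lp_norm_mono:
  assumes "0 < p" "f \<in> borel_measurable M" "\<And>x. f x \<le> g x"
  shows "Lp_norm M p f \<le> Lp_norm M p g"
  using assms(1)
proof (cases rule: ereal_pos_cases)
  case (fin P)
  then show ?thesis unfolding fin(1) Lp_norm_ereal
    by (intro ennreal_powr_mono nn_integral_mono assms) auto
qed (use assms in \<open>simp add: Lp_norm_infty esssup_mono\<close>)

lemma Lp_norm_cmult:
  assumes "0 < P" "f \<in> borel_measurable M"
  shows "Lp_norm M (ereal P) (\<lambda>x. c * f x) = c * Lp_norm M (ereal P) f"
  using assms by (simp add: Lp_norm_ereal ennreal_powr_mult nn_integral_cmult ennreal_powr_powr)

lemma esssup_count_space: "esssup (count_space UNIV) f = (SUP k. f k)" for f :: "'k \<Rightarrow> ennreal"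
proof (rule antisym)
  show "esssup (count_space UNIV) f \<le> (SUP k. f k)"
    by (rule esssup_I) (auto intro: SUP_upper)
  show "(SUP k. f k) \<le> esssup (count_space UNIV) f"
    using esssup_AE[where M="count_space UNIV" and f=f]
    by (intro SUP_least) (simp add: AE_count_space)
qed

lemma Lp_norm_count_infty: "Lp_norm (count_space UNIV) \<infinity> f = (SUP k. f k)"
  by (simp add: Lp_norm_infty esssup_count_space)

lemma nn_integral_count_space_ge: "f k \<le> (\<integral>\<^sup>+k. f k \<partial>count_space UNIV)"
proof -
  have "f k = (\<integral>\<^sup>+j. f j * indicator {k} j \<partial>count_space UNIV)"
    by (subst nn_integral_count_space'[of "{k}"]) auto
  also have "\<dots> \<le> (\<integral>\<^sup>+k. f k \<partial>count_space UNIV)"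
    by (intro nn_integral_mono) (auto split: split_indicator)
  finally show ?thesis .
qed

lemma Lp_norm_count_ge: "0 < p \<Longrightarrow> f k \<le> Lp_norm (count_space UNIV) p f"
proof (induction rule: ereal_pos_cases)
  case (fin P)
  then have "ennreal_powr (ennreal_powr (f k) P) (1 / P) \<le> Lp_norm (count_space UNIV) p f"
    unfolding fin(1) Lp_norm_ereal
    by (intro ennreal_powr_mono nn_integral_count_space_ge) auto
  then show ?case using fin by (simp add: ennreal_powr_powr)
qed (auto simp: Lp_norm_count_infty intro: SUP_upper)

text \<open>Monotone convergence along the finite initial segments of an enumeration of the index
  type. It reduces later estimates of infinite sums to finite ones.\<close>

lemma nn_integral_count_space_le:
  fixes f :: "'k::countable \<Rightarrow> ennreal"
  assumes "\<And>F. finite F \<Longrightarrow> sum f F \<le> B"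
  shows "(\<integral>\<^sup>+k. f k \<partial>count_space UNIV) \<le> B"
proof -
  define U where "U n = {k :: 'k. to_nat k < n}" for n
  have fin: "finite (U n)" for n
    unfolding U_def by (rule finite_imageD[of to_nat]) (auto intro: finite_subset[of _ "{..<n}"])
  have "f k = (SUP n. f k * indicator (U n) k)" for k
  proof (rule antisym)
    show "f k \<le> (SUP n. f k * indicator (U n) k)"
      by (rule SUP_upper2[of "Suc (to_nat k)"]) (auto simp: U_def)
    show "(SUP n. f k * indicator (U n) k) \<le> f k"
      by (intro SUP_least) (auto split: split_indicator)
  qed
  then have "(\<integral>\<^sup>+k. f k \<partial>count_space UNIV) = (\<integral>\<^sup>+k. (SUP n. f k * indicator (U n) k) \<partial>count_space UNIV)"
    by simp
  also have "\<dots> = (SUP n. \<integral>\<^sup>+k. f k * indicator (U n) k \<partial>count_space UNIV)"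
    by (intro nn_integral_monotone_convergence_SUP)
      (auto simp: incseq_def le_fun_def U_def split: split_indicator)
  also have "\<dots> \<le> B"
  proof (rule SUP_least)
    fix n
    have "(\<integral>\<^sup>+k. f k * indicator (U n) k \<partial>count_space UNIV) = sum f (U n)"
      by (subst nn_integral_count_space'[OF fin[of n]]) auto
    then show "(\<integral>\<^sup>+k. f k * indicator (U n) k \<partial>count_space UNIV) \<le> B"
      using assms[OF fin[of n]] by simp
  qed
  finally show ?thesis .
qed

text \<open>The inequality \<open>\<parallel>f\<parallel>\<^sub>q\<^sup>q \<le> (sup f)\<^sup>q\<^sup>-\<^sup>p \<parallel>f\<parallel>\<^sub>p\<^sup>p\<close> serves both for sequences and, after Bernstein's
  inequality, for band-limited functions.\<close>

lemma Lp_norm_interpolate: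
  assumes p: "0 < p" "p \<le> q" and f [measurable]: "f \<in> borel_measurable M"
    and sup: "\<And>x. f x \<le> C * Lp_norm M p f" and C: "1 \<le> C"
  shows "Lp_norm M q f \<le> C * Lp_norm M p f"
proof (cases "q = \<infinity>")
  case True
  then show ?thesis using sup by (auto simp: Lp_norm_infty intro!: esssup_I)
next
  case False
  let ?N = "Lp_norm M p f"
  obtain P Q where P: "p = ereal P" "0 < P" and Q: "q = ereal Q" "P \<le> Q"
    using p False by (cases p; cases q) auto
  show ?thesis
  proof (cases "P = Q")
    case True
    then show ?thesis using mult_right_mono[OF C, of ?N] P Q by simp
  next
    case neq: False
    have "(\<integral>\<^sup>+x. ennreal_powr (f x) Q \<partial>M) \<le> (\<integral>\<^sup>+x. ennreal_powr (C * ?N) (Q - P) * ennreal_powr (f x) P \<partial>M)"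
    proof (intro nn_integral_mono)
      fix x
      have "ennreal_powr (f x) Q = ennreal_powr (f x) (Q - P) * ennreal_powr (f x) P"
        by (simp add: ennreal_powr_add)
      also have "\<dots> \<le> ennreal_powr (C * ?N) (Q - P) * ennreal_powr (f x) P"
        using Q by (intro mult_right_mono ennreal_powr_mono sup) auto
      finally show "ennreal_powr (f x) Q \<le> ennreal_powr (C * ?N) (Q - P) * ennreal_powr (f x) P" .
    qed
    also have "\<dots> = ennreal_powr (C * ?N) (Q - P) * ennreal_powr ?N P"
      using P by (simp add: nn_integral_cmult Lp_norm_powr)
    \<comment> \<open>C \<ge> 1 enlarges the second factor, so that the two powers have the same
      base and combine to the exponent Q.\<close>
    also have "\<dots> \<le> ennreal_powr (C * ?N) (Q - P) * ennreal_powr (C * ?N) P"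
      using P mult_right_mono[OF C, of ?N] by (intro mult_left_mono ennreal_powr_mono) auto
    also have "\<dots> = ennreal_powr (C * ?N) Q" by (simp add: ennreal_powr_add)
    finally show ?thesis using P Q by (simp add: Lp_norm_le_iff)
  qed
qed

lemma Lp_norm_count_antimono:
  assumes "0 < p" "p \<le> q"
  shows "Lp_norm (count_space UNIV) q f \<le> Lp_norm (count_space UNIV) p f"
  using Lp_norm_interpolate[OF assms, of f "count_space UNIV" 1] Lp_norm_count_ge[OF assms(1), of f] by simp

text \<open>Hoelder's inequality with 1/Q = 1/R + 1/\<beta>, up to the constant. The exponent
  \<beta> = QR/(R - Q) tends to Q as R tends to infinity, which explains its value for infinite
  \<open>r\<close>.\<close>

lemma Lp_norm_count_weighted:
  fixes w :: "'k \<Rightarrow> real" and b :: "'k \<Rightarrow> ennreal"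
  assumes Q: "0 < Q" and r: "ereal Q < r" and w: "\<And>k. 0 < w k"
    and S: "(\<integral>\<^sup>+k. ennreal (w k powr (case r of ereal R \<Rightarrow> Q * R / (R - Q) | _ \<Rightarrow> Q)) \<partial>count_space UNIV) = ennreal S"
    and S0: "0 \<le> S"
  shows "Lp_norm (count_space UNIV) (ereal Q) (\<lambda>k. ennreal (w k) * b k) \<le>
    ennreal ((S + 1) powr (1 / Q)) * Lp_norm (count_space UNIV) r b"
proof -
  let ?N = "Lp_norm (count_space UNIV) r b"
  have r0: "0 < r" using Q r by (meson ereal_less(2) less_trans)
  have b: "b k \<le> ?N" for k by (rule Lp_norm_count_ge[OF r0])
  consider "?N = \<top>" | "?N = 0" | N where "?N = ennreal N" "0 < N"
    by (cases ?N) (auto simp: le_less)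
  then show ?thesis
  proof cases
    case 1
    have "ennreal ((S + 1) powr (1 / Q)) \<noteq> 0" using S0 by simp
    then have "ennreal ((S + 1) powr (1 / Q)) * ?N = \<top>"
      unfolding 1 by (simp add: ennreal_mult_top)
    then show ?thesis by simp
  next
    case 2
    then have "b k = 0" for k using b[of k] by simp
    then show ?thesis using Q by (simp add: Lp_norm_ereal)
  next
    case (3 N)
    define b' where "b' k = enn2real (b k)" for k
    have b': "b k = ennreal (b' k)" "0 \<le> b' k" "b' k \<le> N" for k
    proof -
      have "b k \<noteq> \<top>" using b[of k] 3 by (auto simp: top_unique)
      then show "b k = ennreal (b' k)" "0 \<le> b' k" by (auto simp: b'_def less_top)
      then show "b' k \<le> N" using b[of k] 3 by simp
    qed
    define \<beta> where "\<beta> = (case r of ereal R \<Rightarrow> Q * R / (R - Q) | _ \<Rightarrow> Q)"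
    have "(\<integral>\<^sup>+k. ennreal_powr (ennreal (w k) * b k) Q \<partial>count_space UNIV) \<le> ennreal (N powr Q * (S + 1))"
    proof (cases r)
      case (real R)
      have R: "Q < R" using r real by simp
      have pt: "ennreal_powr (ennreal (w k) * b k) Q \<le>
          ennreal (N powr Q) * (ennreal (w k powr \<beta>) + ennreal (N powr - R) * ennreal_powr (b k) R)" for k
      proof -
        define t where "t = b' k / N"
        have t: "0 \<le> t" "b' k = N * t" using 3 b'(2)[of k] by (auto simp: t_def)
        \<comment> \<open>A Young-type inequality without optimisation: if w^Q \<le> t^(R - Q), the
          product is at most t^R; otherwise t is small against w and the product is at most
          w^\<beta>. Summed over k, the two terms contribute 1 and S.\<close>
        have "(w k * t) powr Q \<le> w k powr \<beta> + t powr R"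
        proof (cases "t = 0")
          case False
          then have t0: "0 < t" using t by simp
          show ?thesis
          proof (cases "w k powr Q \<le> t powr (R - Q)")
            case True
            then have "w k powr Q * t powr Q \<le> t powr (R - Q) * t powr Q"
              by (intro mult_right_mono) auto
            also have "\<dots> = t powr R" by (simp add: powr_add[symmetric])
            finally show ?thesis using w[of k] t by (simp add: powr_mult less_imp_le add_increasing)
          next
            case False
            then have "(t powr (R - Q)) powr (Q / (R - Q)) \<le> (w k powr Q) powr (Q / (R - Q))"
              using R Q by (intro powr_mono2) auto
            then have "t powr Q \<le> w k powr (Q * (Q / (R - Q)))" using R by (simp add: powr_powr)
            then have "w k powr Q * t powr Q \<le> w k powr Q * w k powr (Q * (Q / (R - Q)))"
              by (intro mult_left_mono) auto
            also have "\<dots> = w k powr (Q + Q * (Q / (R - Q)))" by (simp add: powr_add)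
            also have "Q + Q * (Q / (R - Q)) = \<beta>"
              using R unfolding \<beta>_def real by (simp add: field_simps)
            finally show ?thesis using w[of k] t by (simp add: powr_mult less_imp_le add_increasing2)
          qed
        qed (use Q in simp)
        then have "N powr Q * (w k * t) powr Q \<le> N powr Q * (w k powr \<beta> + t powr R)"
          by (intro mult_left_mono) auto
        moreover have "N powr Q * (w k * t) powr Q = (w k * b' k) powr Q"
          using 3 t w[of k] by (simp add: powr_mult less_imp_le)
        moreover have "t powr R = N powr - R * b' k powr R"
          using 3 b'(2)[of k] by (simp add: t_def powr_divide powr_minus field_simps)
        ultimately have "(w k * b' k) powr Q \<le> N powr Q * (w k powr \<beta> + N powr - R * b' k powr R)" by simp
        then have "ennreal ((w k * b' k) powr Q) \<le> ennreal (N powr Q * (w k powr \<beta> + N powr - R * b' k powr R))"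
          by (rule ennreal_leI)
        then show ?thesis
          using w[of k] b'(2)[of k]
          by (simp add: b'(1) ennreal_mult[symmetric] ennreal_powr_ennreal less_imp_le ennreal_plus[symmetric] del: ennreal_plus)
      qed
      have "(\<integral>\<^sup>+k. ennreal_powr (ennreal (w k) * b k) Q \<partial>count_space UNIV) \<le>
          (\<integral>\<^sup>+k. ennreal (N powr Q) * (ennreal (w k powr \<beta>) + ennreal (N powr - R) * ennreal_powr (b k) R) \<partial>count_space UNIV)"
        by (intro nn_integral_mono pt)
      also have "\<dots> = ennreal (N powr Q) * (ennreal S + ennreal (N powr - R) * ennreal_powr ?N R)"
        using S Q R by (simp add: nn_integral_cmult nn_integral_add \<beta>_def real Lp_norm_powr)
      also have "\<dots> = ennreal (N powr Q * (S + 1))"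
      proof -
        have "ennreal (N powr - R) * ennreal_powr ?N R = 1"
          using 3 by (simp add: ennreal_powr_ennreal ennreal_mult[symmetric] powr_add[symmetric])
        then show ?thesis using S0 by (simp add: ennreal_mult)
      qed
      finally show ?thesis .
    next
      case PInf
      have "(\<integral>\<^sup>+k. ennreal_powr (ennreal (w k) * b k) Q \<partial>count_space UNIV) \<le>
          (\<integral>\<^sup>+k. ennreal (N powr Q) * ennreal (w k powr \<beta>) \<partial>count_space UNIV)"
      proof (intro nn_integral_mono)
        fix k
        have "(w k * b' k) powr Q \<le> (w k * N) powr Q"
          using w[of k] b'(2,3)[of k] Q by (intro powr_mono2 mult_left_mono) (auto simp: less_imp_le)
        also have "\<dots> = N powr Q * w k powr \<beta>"
          using w[of k] 3 by (simp add: \<beta>_def PInf powr_mult less_imp_le)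
        finally show "ennreal_powr (ennreal (w k) * b k) Q \<le> ennreal (N powr Q) * ennreal (w k powr \<beta>)"
          using w[of k] b'(2)[of k]
          by (simp add: b'(1) ennreal_mult[symmetric] ennreal_powr_ennreal less_imp_le ennreal_leI)
      qed
      also have "\<dots> = ennreal (N powr Q * S)"
        using S S0 by (simp add: nn_integral_cmult \<beta>_def ennreal_mult)
      also have "\<dots> \<le> ennreal (N powr Q * (S + 1))" by (intro ennreal_leI mult_left_mono) auto
      finally show ?thesis .
    qed (use r in auto)
    also have "ennreal (N powr Q * (S + 1)) = ennreal_powr (ennreal ((S + 1) powr (1 / Q)) * ?N) Q"
      using 3 S0 Q by (simp add: ennreal_powr_mult ennreal_powr_ennreal powr_powr ennreal_mult[symmetric] powr_mult mult.commute)
    finally show ?thesis using Q by (simp add: Lp_norm_le_iff)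
  qed
qed

section \<open>Minkowski's inequality for mixed norms\<close>

text \<open>Young's inequality for the normalised terms b^c / B and f^c / V. The first factor is
  written as b^(c - 1) because this is the extremal dual sequence in the proof of Minkowski's
  inequality.\<close>

lemma holder_sum:
  fixes b f :: "'k \<Rightarrow> real"
  assumes F: "finite F" and c: "1 < c" and b: "\<And>k. k \<in> F \<Longrightarrow> 0 \<le> b k" and f: "\<And>k. k \<in> F \<Longrightarrow> 0 \<le> f k"
  shows "(\<Sum>k\<in>F. b k powr (c - 1) * f k) \<le> (\<Sum>k\<in>F. b k powr c) powr ((c - 1) / c) * (\<Sum>k\<in>F. f k powr c) powr (1 / c)"
proof -
  define B where "B = (\<Sum>k\<in>F. b k powr c)"
  define V where "V = (\<Sum>k\<in>F. f k powr c)"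
  have B0: "0 \<le> B" and V0: "0 \<le> V" by (auto simp: B_def V_def intro!: sum_nonneg)
  show ?thesis
  proof (cases "B = 0 \<or> V = 0")
    case True
    have "b k = 0 \<or> f k = 0" if "k \<in> F" for k
    proof -
      have "B = 0 \<Longrightarrow> b k powr c = 0" "V = 0 \<Longrightarrow> f k powr c = 0"
        using that F by (auto simp: B_def V_def sum_nonneg_eq_0_iff)
      then show ?thesis using True by auto
    qed
    then have "(\<Sum>k\<in>F. b k powr (c - 1) * f k) = 0" by (intro sum.neutral) auto
    then show ?thesis by simp
  next
    case False
    then have BV: "0 < B" "0 < V" using B0 V0 by auto
    have pt: "b k powr (c - 1) * f k \<le> B powr ((c - 1) / c) * V powr (1 / c) *
        ((c - 1) / c * (b k powr c / B) + 1 / c * (f k powr c / V))" if k: "k \<in> F" for k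
    proof (cases "b k = 0 \<or> f k = 0")
      case True
      then have "b k powr (c - 1) * f k = 0" by auto
      also have "0 \<le> B powr ((c - 1) / c) * V powr (1 / c) *
        ((c - 1) / c * (b k powr c / B) + 1 / c * (f k powr c / V))"
        using BV c by (intro mult_nonneg_nonneg add_nonneg_nonneg) auto
      finally show ?thesis .
    next
      case False
      then have bf: "0 < b k" "0 < f k" using b[OF k] f[OF k] by auto
      have "(b k powr c / B) powr ((c - 1) / c) * (f k powr c / V) powr (1 / c) \<le>
          (c - 1) / c * (b k powr c / B) + 1 / c * (f k powr c / V)"
        using c BV bf by (intro Youngs_inequality_0) (auto simp: field_simps)
      moreover have "(b k powr c / B) powr ((c - 1) / c) = b k powr (c - 1) / B powr ((c - 1) / c)"
        using c BV bf by (simp add: powr_divide powr_powr)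
      moreover have "(f k powr c / V) powr (1 / c) = f k / V powr (1 / c)"
        using c BV bf by (simp add: powr_divide powr_powr)
      ultimately show ?thesis using BV by (simp add: field_simps)
    qed
    have "(\<Sum>k\<in>F. b k powr (c - 1) * f k) \<le> (\<Sum>k\<in>F. B powr ((c - 1) / c) * V powr (1 / c) *
        ((c - 1) / c * (b k powr c / B) + 1 / c * (f k powr c / V)))"
      by (intro sum_mono pt)
    also have "\<dots> = B powr ((c - 1) / c) * V powr (1 / c) * ((c - 1) / c * (B / B) + 1 / c * (V / V))"
      by (simp add: sum_distrib_left[symmetric] sum.distrib sum_divide_distrib[symmetric] B_def V_def)
    also have "(c - 1) / c * (B / B) + 1 / c * (V / V) = 1"
      using BV c by (simp add: field_simps)
    finally show ?thesis by (simp add: B_def V_def)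
  qed
qed

text \<open>With b_k the integral of f_k and B the sum of the b_k^c, the number B is the integral of
  the sum of b_k^(c - 1) f_k. By Hoelder's inequality at each point it is at most B^((c - 1)/c)
  times the integral on the right, and this power of B is divided out.\<close>

lemma minkowski_sum:
  fixes f :: "'k \<Rightarrow> 'a \<Rightarrow> ennreal"
  assumes F: "finite F" and c: "1 < c" and f [measurable]: "\<And>k. k \<in> F \<Longrightarrow> f k \<in> borel_measurable M"
  shows "(\<Sum>k\<in>F. ennreal_powr (\<integral>\<^sup>+x. f k x \<partial>M) c) \<le>
    ennreal_powr (\<integral>\<^sup>+x. ennreal_powr (\<Sum>k\<in>F. ennreal_powr (f k x) c) (1 / c) \<partial>M) c"
proof -
  define V where "V x = ennreal_powr (\<Sum>k\<in>F. ennreal_powr (f k x) c) (1 / c)" for x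
  define I where "I = (\<integral>\<^sup>+x. V x \<partial>M)"
  have fV: "f k x \<le> V x" if "k \<in> F" for k x
  proof -
    have "ennreal_powr (f k x) c \<le> (\<Sum>k\<in>F. ennreal_powr (f k x) c)"
      using F that by (intro member_le_sum) auto
    from ennreal_powr_mono[OF this, of "1 / c"] show ?thesis using c by (simp add: V_def ennreal_powr_powr)
  qed
  show ?thesis
  \<comment> \<open>Once the right side is finite, f_k \<le> V makes all the b_k finite, so that B
    is a real number and division is legitimate.\<close>
  proof (cases "I = \<top>")
    case True
    then show ?thesis by (simp add: I_def V_def)
  next
    case False
    define b where "b k = enn2real (\<integral>\<^sup>+x. f k x \<partial>M)" for k
    have b: "(\<integral>\<^sup>+x. f k x \<partial>M) = ennreal (b k)" "0 \<le> b k" if "k \<in> F" for k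
    proof -
      have "(\<integral>\<^sup>+x. f k x \<partial>M) \<le> I" unfolding I_def by (intro nn_integral_mono fV that)
      then show "(\<integral>\<^sup>+x. f k x \<partial>M) = ennreal (b k)" "0 \<le> b k"
        using False by (auto simp: b_def top_unique less_top)
    qed
    define B where "B = (\<Sum>k\<in>F. b k powr c)"
    have lhs: "(\<Sum>k\<in>F. ennreal_powr (\<integral>\<^sup>+x. f k x \<partial>M) c) = ennreal B"
      unfolding B_def using b by (subst sum_ennreal[symmetric]) (auto simp: ennreal_powr_ennreal)
    have B0: "0 \<le> B" unfolding B_def by (intro sum_nonneg) auto
    show ?thesis
    proof (cases "B = 0")
      case True
      then show ?thesis by (simp add: lhs)
    next
      case False
      then have Bpos: "0 < B" using B0 by simp
      have pt: "(\<Sum>k\<in>F. ennreal (b k powr (c - 1)) * f k x) \<le> ennreal (B powr ((c - 1) / c)) * V x" for x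
      proof (cases "V x = \<top>")
        case True
        have "ennreal (B powr ((c - 1) / c)) * V x = \<top>" using Bpos by (simp add: True ennreal_mult_top)
        then show ?thesis by simp
      next
        case False
        define g where "g k = enn2real (f k x)" for k
        have g: "f k x = ennreal (g k)" "0 \<le> g k" if "k \<in> F" for k
          using fV[OF that, of x] False by (auto simp: g_def top_unique less_top)
        have "V x = ennreal_powr (ennreal (\<Sum>k\<in>F. g k powr c)) (1 / c)"
          unfolding V_def using g by (subst sum_ennreal[symmetric]) (auto simp: ennreal_powr_ennreal)
        then have Vx: "V x = ennreal ((\<Sum>k\<in>F. g k powr c) powr (1 / c))"
          by (simp add: ennreal_powr_ennreal sum_nonneg)
        have "(\<Sum>k\<in>F. ennreal (b k powr (c - 1)) * f k x) = ennreal (\<Sum>k\<in>F. b k powr (c - 1) * g k)"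
          using g by (subst sum_ennreal[symmetric]) (auto simp: ennreal_mult)
        also have "\<dots> \<le> ennreal (B powr ((c - 1) / c) * (\<Sum>k\<in>F. g k powr c) powr (1 / c))"
          unfolding B_def using b g by (intro ennreal_leI holder_sum F c) auto
        also have "\<dots> = ennreal (B powr ((c - 1) / c)) * V x" by (simp add: Vx ennreal_mult)
        finally show ?thesis .
      qed
      have [measurable]: "V \<in> borel_measurable M" unfolding V_def by measurable
      have "ennreal B = (\<Sum>k\<in>F. ennreal (b k powr (c - 1)) * (\<integral>\<^sup>+x. f k x \<partial>M))"
      proof -
        have "b k powr (c - 1) * b k = b k powr c" if "k \<in> F" for k
          using b(2)[OF that] by (cases "b k = 0") (auto simp: powr_mult_base[symmetric] mult.commute powr_diff)
        then show ?thesis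
          unfolding B_def using b by (subst sum_ennreal[symmetric]) (auto simp: ennreal_mult[symmetric])
      qed
      also have "\<dots> = (\<integral>\<^sup>+x. (\<Sum>k\<in>F. ennreal (b k powr (c - 1)) * f k x) \<partial>M)"
        by (subst nn_integral_sum) (auto simp: nn_integral_cmult)
      also have "\<dots> \<le> (\<integral>\<^sup>+x. ennreal (B powr ((c - 1) / c)) * V x \<partial>M)"
        by (intro nn_integral_mono pt)
      also have "\<dots> = ennreal (B powr ((c - 1) / c)) * I" by (simp add: nn_integral_cmult I_def)
      finally have "ennreal (B powr - ((c - 1) / c)) * ennreal B \<le>
          ennreal (B powr - ((c - 1) / c)) * (ennreal (B powr ((c - 1) / c)) * I)"
        by (rule mult_left_mono) simp
      moreover have "ennreal (B powr - ((c - 1) / c)) * ennreal B = ennreal (B powr (1 / c))"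
      proof -
        have "B powr - ((c - 1) / c) * B powr 1 = B powr (1 / c)"
          using c by (simp only: powr_add[symmetric]) (simp add: field_simps)
        then show ?thesis using Bpos by (simp add: ennreal_mult[symmetric])
      qed
      moreover have "ennreal (B powr - ((c - 1) / c)) * (ennreal (B powr ((c - 1) / c)) * I) = I"
      proof -
        have "ennreal (B powr - ((c - 1) / c)) * ennreal (B powr ((c - 1) / c)) = 1"
          using Bpos by (simp add: ennreal_mult[symmetric] powr_add[symmetric])
        then show ?thesis by (simp add: mult.assoc[symmetric])
      qed
      ultimately have "ennreal (B powr (1 / c)) \<le> I" by simp
      from ennreal_powr_mono[OF this, of c] show ?thesis
        using c Bpos by (simp add: lhs ennreal_powr_ennreal powr_powr I_def V_def)
    qed
  qed
qed

text \<open>If q \<le> p, Tonelli's theorem reduces the claim to the embedding of l^q into l^p at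
  each point. If p < q, Minkowski's inequality with exponent c = q/p > 1 is applied to the p-th
  powers, which covers exponents below 1. If one exponent is infinite, each single index is
  estimated by monotonicity.\<close>

theorem mixed_norm_swap:
  fixes H :: "'k::countable \<Rightarrow> 'a \<Rightarrow> ennreal"
  assumes p: "0 < p" and q: "0 < q" and H [measurable]: "\<And>k. H k \<in> borel_measurable M"
  shows "Lp_norm (count_space UNIV) (max p q) (\<lambda>k. Lp_norm M p (H k)) \<le>
    Lp_norm M p (\<lambda>x. Lp_norm (count_space UNIV) q (\<lambda>k. H k x))"
proof (cases "max p q = \<infinity>")
  case True
  have "Lp_norm M p (H k) \<le> Lp_norm M p (\<lambda>x. Lp_norm (count_space UNIV) q (\<lambda>k. H k x))" for k
    by (intro Lp_norm_mono p H Lp_norm_count_ge[OF q, of "\<lambda>k. H k x" for x])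
  then show ?thesis unfolding True Lp_norm_count_infty by (rule SUP_least)
next
  case False
  then have "p \<noteq> \<infinity>" "q \<noteq> \<infinity>" by (auto simp: max_def split: if_splits)
  then obtain P Q where P: "p = ereal P" "0 < P" and Q: "q = ereal Q" "0 < Q"
    using p q by (metis ereal_pos_cases)
  show ?thesis
  proof (cases "Q \<le> P")
    case True
    have "(\<integral>\<^sup>+k. ennreal_powr (Lp_norm M p (H k)) P \<partial>count_space UNIV) =
        (\<integral>\<^sup>+k. \<integral>\<^sup>+x. ennreal_powr (H k x) P \<partial>M \<partial>count_space UNIV)"
      using P by (simp add: Lp_norm_powr)
    also have "\<dots> = (\<integral>\<^sup>+x. \<integral>\<^sup>+k. ennreal_powr (H k x) P \<partial>count_space UNIV \<partial>M)"
      by (rule nn_integral_count_space_nn_integral[symmetric]) auto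
    also have "\<dots> \<le> (\<integral>\<^sup>+x. ennreal_powr (Lp_norm (count_space UNIV) q (\<lambda>k. H k x)) P \<partial>M)"
    proof (intro nn_integral_mono)
      fix x
      have "(\<integral>\<^sup>+k. ennreal_powr (H k x) P \<partial>count_space UNIV) =
          ennreal_powr (Lp_norm (count_space UNIV) p (\<lambda>k. H k x)) P"
        using P by (simp add: Lp_norm_powr)
      also have "\<dots> \<le> ennreal_powr (Lp_norm (count_space UNIV) q (\<lambda>k. H k x)) P"
        using P Q True by (intro ennreal_powr_mono Lp_norm_count_antimono) auto
      finally show "(\<integral>\<^sup>+k. ennreal_powr (H k x) P \<partial>count_space UNIV) \<le>
          ennreal_powr (Lp_norm (count_space UNIV) q (\<lambda>k. H k x)) P" .
    qed
    finally have "Lp_norm (count_space UNIV) p (\<lambda>k. Lp_norm M p (H k)) \<le>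
        Lp_norm M p (\<lambda>x. Lp_norm (count_space UNIV) q (\<lambda>k. H k x))"
      using P by (simp add: Lp_norm_le_iff Lp_norm_powr)
    moreover have "max p q = p" using P Q True by simp
    ultimately show ?thesis by (simp only:)
  next
    case PQ: False
    define c where "c = Q / P"
    have c: "1 < c" "P * c = Q" using PQ P by (auto simp: c_def)
    define R where "R = Lp_norm M p (\<lambda>x. Lp_norm (count_space UNIV) q (\<lambda>k. H k x))"
    have RP: "ennreal_powr R P = (\<integral>\<^sup>+x. ennreal_powr (\<integral>\<^sup>+k. ennreal_powr (H k x) Q \<partial>count_space UNIV) (1 / c) \<partial>M)"
      unfolding R_def using P Q by (simp add: Lp_norm_powr) (simp add: Lp_norm_ereal ennreal_powr_powr c_def)
    have "(\<integral>\<^sup>+k. ennreal_powr (Lp_norm M p (H k)) Q \<partial>count_space UNIV) \<le> ennreal_powr R Q"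
    proof (rule nn_integral_count_space_le)
      fix F :: "'k set" assume F: "finite F"
      have "(\<Sum>k\<in>F. ennreal_powr (Lp_norm M p (H k)) Q) =
          (\<Sum>k\<in>F. ennreal_powr (\<integral>\<^sup>+x. ennreal_powr (H k x) P \<partial>M) c)"
        using P by (simp add: Lp_norm_ereal ennreal_powr_powr c_def)
      also have "\<dots> \<le> ennreal_powr (\<integral>\<^sup>+x. ennreal_powr (\<Sum>k\<in>F. ennreal_powr (ennreal_powr (H k x) P) c) (1 / c) \<partial>M) c"
        by (intro minkowski_sum F c) measurable
      also have "\<dots> \<le> ennreal_powr (ennreal_powr R P) c"
        unfolding RP
      proof (intro ennreal_powr_mono nn_integral_mono)
        fix x
        have "(\<Sum>k\<in>F. ennreal_powr (ennreal_powr (H k x) P) c) = (\<integral>\<^sup>+k. ennreal_powr (H k x) Q * indicator F k \<partial>count_space UNIV)"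
          using F by (subst nn_integral_count_space'[of F]) (auto simp: ennreal_powr_powr c)
        also have "\<dots> \<le> (\<integral>\<^sup>+k. ennreal_powr (H k x) Q \<partial>count_space UNIV)"
          by (intro nn_integral_mono) (auto split: split_indicator)
        finally show "(\<Sum>k\<in>F. ennreal_powr (ennreal_powr (H k x) P) c) \<le>
            (\<integral>\<^sup>+k. ennreal_powr (H k x) Q \<partial>count_space UNIV)" .
      qed (use c in auto)
      also have "\<dots> = ennreal_powr R Q" by (simp add: ennreal_powr_powr c)
      finally show "(\<Sum>k\<in>F. ennreal_powr (Lp_norm M p (H k)) Q) \<le> ennreal_powr R Q" .
    qed
    then show ?thesis
      using P Q PQ by (simp add: R_def max_def Lp_norm_le_iff)
  qed
qed

section \<open>Bernstein's inequality\<close>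

text \<open>Splitting at the level A gives t \<le> A + A^(1 - P) t^P for every A > 0. Inserted into
  the reproducing inequality, the first term meets the L^1 norm of \<open>T\<close> and the second
  its supremum; the choice A = r^(1/P) balances both.\<close>

lemma bernstein_ge_1:
  fixes T g :: "real ^ 'n::finite \<Rightarrow> complex"
  assumes P: "1 \<le> P" and T: "integrable lborel T" and D: "\<And>z. cmod (T z) \<le> D"
    and g [measurable]: "g \<in> borel_measurable borel"
    and rep: "\<And>x. ennreal (cmod (g x)) \<le> (\<integral>\<^sup>+z. ennreal (cmod (T z) * cmod (g (x + z))) \<partial>lborel)"
    and r: "(\<integral>\<^sup>+z. ennreal (cmod (g z) powr P) \<partial>lborel) = ennreal r" "0 \<le> r"
  shows "cmod (g x) powr P \<le> ((\<integral>z. cmod (T z) \<partial>lborel) + D) powr P * r"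
proof -
  have [measurable]: "T \<in> borel_measurable borel" using T by auto
  define L where "L = (\<integral>z. cmod (T z) \<partial>lborel)"
  have L: "0 \<le> L" "(\<integral>\<^sup>+z. ennreal (cmod (T z)) \<partial>lborel) = ennreal L"
    unfolding L_def using T by (auto simp: nn_integral_eq_integral)
  have D0: "0 \<le> D" using D norm_ge_zero order_trans by blast
  have main: "cmod (g x) \<le> A * L + A powr (1 - P) * D * r" if A: "0 < A" for A
  proof -
    have "ennreal (cmod (g x)) \<le> (\<integral>\<^sup>+z. ennreal (cmod (T z) * cmod (g (x + z))) \<partial>lborel)" by (rule rep)
    also have "\<dots> \<le> (\<integral>\<^sup>+z. ennreal A * ennreal (cmod (T z)) + ennreal (A powr (1 - P) * D) * ennreal (cmod (g (x + z)) powr P) \<partial>lborel)"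
    proof (intro nn_integral_mono)
      fix z
      let ?t = "cmod (g (x + z))"
      have "?t \<le> A + A powr (1 - P) * ?t powr P"
      proof (cases "?t \<le> A")
        case False
        then have t: "0 < ?t" "A \<le> ?t" using A by auto
        have "?t = ?t powr (1 - P) * ?t powr P" using t by (simp add: powr_add[symmetric])
        also have "\<dots> \<le> A powr (1 - P) * ?t powr P"
          using t A P by (intro mult_right_mono powr_mono2') auto
        finally show ?thesis using A by simp
      qed (simp add: add_increasing2)
      then have "cmod (T z) * ?t \<le> cmod (T z) * (A + A powr (1 - P) * ?t powr P)"
        by (intro mult_left_mono) auto
      also have "\<dots> = A * cmod (T z) + cmod (T z) * (A powr (1 - P) * ?t powr P)" by (simp add: algebra_simps)
      also have "\<dots> \<le> A * cmod (T z) + D * (A powr (1 - P) * ?t powr P)"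
        using D by (intro add_left_mono mult_right_mono) auto
      finally have "cmod (T z) * ?t \<le> A * cmod (T z) + A powr (1 - P) * D * ?t powr P" by (simp add: mult_ac)
      then have "ennreal (cmod (T z) * ?t) \<le> ennreal (A * cmod (T z) + A powr (1 - P) * D * ?t powr P)"
        by (rule ennreal_leI)
      also have "\<dots> = ennreal A * ennreal (cmod (T z)) + ennreal (A powr (1 - P) * D) * ennreal (?t powr P)"
        using A D0 by (simp add: ennreal_mult)
      finally show "ennreal (cmod (T z) * ?t) \<le>
          ennreal A * ennreal (cmod (T z)) + ennreal (A powr (1 - P) * D) * ennreal (?t powr P)" .
    qed
    also have "\<dots> = ennreal A * ennreal L + ennreal (A powr (1 - P) * D) * (\<integral>\<^sup>+z. ennreal (cmod (g (x + z)) powr P) \<partial>lborel)"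
      by (simp add: nn_integral_add nn_integral_cmult L)
    also have "(\<integral>\<^sup>+z. ennreal (cmod (g (x + z)) powr P) \<partial>lborel) = ennreal r"
      by (subst r(1)[symmetric], rule lborel_nn_integral_shift) measurable
    also have "ennreal A * ennreal L + ennreal (A powr (1 - P) * D) * ennreal r = ennreal (A * L + A powr (1 - P) * D * r)"
      using A L D0 r by (simp add: ennreal_mult)
    finally show ?thesis using A L D0 r by (subst (asm) ennreal_le_iff) auto
  qed
  show ?thesis
  proof (cases "r = 0")
    case True
    have "cmod (g x) \<le> 0"
    \<comment> \<open>The balancing choice would be A = 0; instead A is taken arbitrarily small,
      with L + 1 in the denominator as \<open>L\<close> may be 0.\<close>
    proof (rule field_le_epsilon)
      fix e :: real assume e: "0 < e"
      have "cmod (g x) \<le> e / (L + 1) * L" using main[of "e / (L + 1)"] e L True by simp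
      also have "\<dots> \<le> 0 + e" using e L by (simp add: divide_le_eq)
      finally show "cmod (g x) \<le> 0 + e" .
    qed
    then show ?thesis using True by simp
  next
    case False
    then have r0: "0 < r" using r by simp
    let ?A = "r powr (1 / P)"
    have "?A powr (1 - P) * r = ?A"
    proof -
      have "?A powr (1 - P) * r powr 1 = r powr ((1 - P) / P + 1)" by (simp add: powr_powr powr_add)
      also have "(1 - P) / P + 1 = 1 / P" using P by (simp add: field_simps)
      finally show ?thesis using r0 by simp
    qed
    then have "?A powr (1 - P) * D * r = ?A * D" by (simp add: mult_ac)
    moreover have "cmod (g x) \<le> ?A * L + ?A powr (1 - P) * D * r"
      by (rule main) (use r0 in simp)
    ultimately have "cmod (g x) \<le> ?A * (L + D)" by (simp only: distrib_left)
    then have "cmod (g x) powr P \<le> (?A * (L + D)) powr P" using P by (intro powr_mono2) auto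
    also have "\<dots> = (L + D) powr P * r"
      using r0 P L D0 by (simp add: powr_mult powr_powr mult.commute)
    finally show ?thesis by (simp add: L_def)
  qed
qed

text \<open>For \<open>P < 1\<close> the supremum of \<open>g\<close> has to be known to be finite beforehand; the weight
  \<open>N\<close> only serves to establish this, and afterwards the case \<open>N = 0\<close> gives a uniform constant.\<close>

lemma bernstein_less_1:
  fixes T g :: "real ^ 'n::finite \<Rightarrow> complex"
  assumes P: "0 < P" "P < 1" and D: "\<And>z. japanese z ^ N * cmod (T z) \<le> D"
    and g [measurable]: "g \<in> borel_measurable borel" and K: "\<And>x. cmod (g x) \<le> K * japanese x ^ N"
    and rep: "\<And>x. ennreal (cmod (g x)) \<le> (\<integral>\<^sup>+z. ennreal (cmod (T z) * cmod (g (x + z))) \<partial>lborel)"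
    and r: "(\<integral>\<^sup>+z. ennreal (cmod (g z) powr P) \<partial>lborel) = ennreal r" "0 \<le> r"
  shows "cmod (g x\<^sub>0) powr P \<le> 2 ^ N * D * r"
proof -
  have jp: "0 < japanese x ^ N" for x :: "real ^ 'n" by simp
  have D0: "0 \<le> D" using D[of 0] by (meson jp less_imp_le mult_nonneg_nonneg norm_ge_zero order_trans)
  have K0: "0 \<le> K"
    using order_trans[OF norm_ge_zero K[of 0]] jp[of 0] by (simp add: zero_le_mult_iff)
  \<comment> \<open>The weight is centred at the point of interest, where it equals 1, and makes the
    supremum \<open>W\<close> finite by the polynomial growth of \<open>g\<close>.\<close>
  define h where "h x = cmod (g x) / japanese (x - x\<^sub>0) ^ N" for x
  define W where "W = (SUP x. h x)"
  have bdd: "bdd_above (range h)"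
  proof (rule bdd_aboveI2)
    fix x
    have "cmod (g x) \<le> K * (2 ^ N * japanese (x - x\<^sub>0) ^ N * japanese x\<^sub>0 ^ N)"
      using K[of x] mult_left_mono[OF japanese_add_power[of "x - x\<^sub>0" x\<^sub>0 N] K0] by simp
    then show "h x \<le> K * 2 ^ N * japanese x\<^sub>0 ^ N"
      unfolding h_def using jp[of "x - x\<^sub>0"] by (simp add: pos_divide_le_eq mult_ac)
  qed
  have hW: "h x \<le> W" for x unfolding W_def by (rule cSUP_upper[OF _ bdd]) simp
  have h0: "0 \<le> h x" for x by (simp add: h_def less_imp_le)
  have W0: "0 \<le> W" using hW[of x\<^sub>0] h0[of x\<^sub>0] by linarith
  have gW: "cmod (g x) \<le> W * japanese (x - x\<^sub>0) ^ N" for x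
    using hW[of x] jp[of "x - x\<^sub>0"] by (simp add: h_def pos_divide_le_eq)
  have "h x \<le> W powr (1 - P) * (2 ^ N * D) * r" for x
  proof -
    define E where "E = W powr (1 - P) * (2 ^ N * D) * japanese (x - x\<^sub>0) ^ N"
    have E0: "0 \<le> E"
      unfolding E_def using D0 jp[of "x - x\<^sub>0"] by (intro mult_nonneg_nonneg) (auto intro: less_imp_le)
    have "ennreal (cmod (g x)) \<le> (\<integral>\<^sup>+z. ennreal (cmod (T z) * cmod (g (x + z))) \<partial>lborel)" by (rule rep)
    also have "\<dots> \<le> (\<integral>\<^sup>+z. ennreal E * ennreal (cmod (g (x + z)) powr P) \<partial>lborel)"
    proof (intro nn_integral_mono)
      fix z
      let ?t = "cmod (g (x + z))" and ?J = "japanese (x + z - x\<^sub>0) ^ N"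
      have J1: "1 \<le> ?J" by (rule japanese_power_ge_1)
      \<comment> \<open>The factor |g|^(1 - P) is estimated by the supremum, which leaves |g|^P for
        the integral.\<close>
      have "?t = ?t powr (1 - P) * ?t powr P" by (simp add: powr_add[symmetric])
      also have "\<dots> \<le> (W * ?J) powr (1 - P) * ?t powr P"
        using P gW by (intro mult_right_mono powr_mono2) auto
      also have "\<dots> = W powr (1 - P) * ?J powr (1 - P) * ?t powr P"
        using W0 jp by (simp add: powr_mult less_imp_le)
      also have "\<dots> \<le> W powr (1 - P) * ?J * ?t powr P"
      proof -
        have "?J powr (1 - P) \<le> ?J powr 1" using P J1 by (intro powr_mono) auto
        then have "?J powr (1 - P) \<le> ?J" using J1 by simp
        then show ?thesis by (intro mult_right_mono mult_left_mono) auto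
      qed
      also have "\<dots> \<le> W powr (1 - P) * (2 ^ N * japanese (x - x\<^sub>0) ^ N * japanese z ^ N) * ?t powr P"
      proof -
        have "x + z - x\<^sub>0 = (x - x\<^sub>0) + z" by simp
        then have "?J \<le> 2 ^ N * japanese (x - x\<^sub>0) ^ N * japanese z ^ N"
          using japanese_add_power[of "x - x\<^sub>0" z N] by (simp only:)
        then show ?thesis by (intro mult_right_mono mult_left_mono) auto
      qed
      finally have "cmod (T z) * ?t \<le> cmod (T z) * (W powr (1 - P) * (2 ^ N * japanese (x - x\<^sub>0) ^ N * japanese z ^ N) * ?t powr P)"
        by (intro mult_left_mono) auto
      also have "\<dots> = (japanese z ^ N * cmod (T z)) * (W powr (1 - P) * (2 ^ N * japanese (x - x\<^sub>0) ^ N) * ?t powr P)"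
        by (simp add: mult_ac)
      also have "\<dots> \<le> D * (W powr (1 - P) * (2 ^ N * japanese (x - x\<^sub>0) ^ N) * ?t powr P)"
        using D jp[of "x - x\<^sub>0"] by (intro mult_right_mono) auto
      also have "\<dots> = E * ?t powr P" by (simp add: E_def mult_ac)
      finally show "ennreal (cmod (T z) * ?t) \<le> ennreal E * ennreal (?t powr P)"
        using E0 by (simp add: ennreal_mult[symmetric] ennreal_leI)
    qed
    also have "\<dots> = ennreal E * (\<integral>\<^sup>+z. ennreal (cmod (g (x + z)) powr P) \<partial>lborel)"
      by (simp add: nn_integral_cmult)
    also have "(\<integral>\<^sup>+z. ennreal (cmod (g (x + z)) powr P) \<partial>lborel) = ennreal r"
      by (subst r(1)[symmetric], rule lborel_nn_integral_shift) measurable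
    also have "ennreal E * ennreal r = ennreal (E * r)" using E0 r by (simp add: ennreal_mult)
    finally have "cmod (g x) \<le> E * r" using E0 r by (subst (asm) ennreal_le_iff) auto
    then show ?thesis
      unfolding h_def E_def using jp[of "x - x\<^sub>0"] by (simp add: pos_divide_le_eq mult_ac)
  qed
  \<comment> \<open>\<open>W\<close> now appears on both sides; since it is finite, W^(1 - P) can be
    divided out if \<open>W\<close> is nonzero.\<close>
  then have W: "W \<le> W powr (1 - P) * (2 ^ N * D) * r" unfolding W_def by (intro cSUP_least) auto
  have "W powr P \<le> 2 ^ N * D * r"
  proof (cases "W = 0")
    case True
    then show ?thesis using D0 r by simp
  next
    case False
    then have Wpos: "0 < W" using W0 by simp
    have "W = W powr (1 - P) * W powr P" using Wpos by (simp add: powr_add[symmetric])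
    then have "W powr (1 - P) * W powr P \<le> W powr (1 - P) * (2 ^ N * D * r)" using W by (simp add: mult_ac)
    then show ?thesis using Wpos by simp
  qed
  moreover have "cmod (g x\<^sub>0) powr P \<le> W powr P"
    using gW[of x\<^sub>0] P by (intro powr_mono2) (auto simp: japanese_def)
  ultimately show ?thesis by linarith
qed

theorem bernstein:
  fixes T :: "real ^ 'n::finite \<Rightarrow> complex"
  assumes T: "schwartz T" and P: "0 < P"
  shows "\<exists>C\<ge>1. \<forall>g. g \<in> borel_measurable borel \<longrightarrow> (\<exists>K N. \<forall>x. cmod (g x) \<le> K * japanese x ^ N) \<longrightarrow>
    (\<forall>x. ennreal (cmod (g x)) \<le> (\<integral>\<^sup>+z. ennreal (cmod (T z) * cmod (g (x + z))) \<partial>lborel)) \<longrightarrow>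
    (\<forall>x. ennreal (cmod (g x)) \<le> ennreal C * Lp_norm lborel (ereal P) (\<lambda>x. ennreal (cmod (g x))))"
proof -
  have dec: "\<exists>D. \<forall>z. japanese z ^ N * cmod (T z) \<le> D" for N
    using schwartz_decay[OF T, of N "[]"] by (metis iter_partial_Nil)
  obtain D where D: "\<And>z. cmod (T z) \<le> D" using dec[of 0] by auto
  define C where "C = (if P < 1 then max 1 D else max 1 (((\<integral>z. cmod (T z) \<partial>lborel) + D) powr P))"
  have C1: "1 \<le> C" by (simp add: C_def)
  have main: "cmod (g x) powr P \<le> C * r"
    if g: "g \<in> borel_measurable borel" and growth: "\<exists>K N. \<forall>x. cmod (g x) \<le> K * japanese x ^ N"
      and rep: "\<And>x. ennreal (cmod (g x)) \<le> (\<integral>\<^sup>+z. ennreal (cmod (T z) * cmod (g (x + z))) \<partial>lborel)"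
      and r: "(\<integral>\<^sup>+z. ennreal (cmod (g z) powr P) \<partial>lborel) = ennreal r" "0 \<le> r" for g x r
  proof (cases "P < 1")
    case True
    obtain K N where K: "\<And>x. cmod (g x) \<le> K * japanese x ^ N" using growth by blast
    obtain D' where D': "\<And>z. japanese z ^ N * cmod (T z) \<le> D'" using dec[of N] by blast
    have "cmod (g x) powr P \<le> 2 ^ N * D' * r" for x
      by (rule bernstein_less_1[OF P True D' g K rep r])
    then have "(cmod (g x) powr P) powr (1 / P) \<le> (2 ^ N * D' * r) powr (1 / P)" for x
      using P by (intro powr_mono2) auto
    then have b: "cmod (g x) \<le> (2 ^ N * D' * r) powr (1 / P) * japanese x ^ 0" for x
      using P by (simp add: powr_powr)
    have "cmod (g x) powr P \<le> 2 ^ 0 * D * r"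
      by (rule bernstein_less_1[OF P True _ g b rep r]) (simp add: D)
    also have "\<dots> \<le> C * r" using True r by (simp add: C_def mult_right_mono)
    finally show ?thesis .
  next
    case False
    have "cmod (g x) powr P \<le> ((\<integral>z. cmod (T z) \<partial>lborel) + D) powr P * r"
      by (rule bernstein_ge_1[OF _ moments_integrable[OF schwartz_moments[OF T]] D g rep r]) (use False in simp)
    also have "\<dots> \<le> C * r" using False r by (intro mult_right_mono) (auto simp: C_def)
    finally show ?thesis .
  qed
  show ?thesis
  proof (intro exI[of _ "C powr (1 / P)"] conjI allI impI)
    show "1 \<le> C powr (1 / P)" using C1 P by (simp add: ge_one_powr_ge_zero)
    fix g :: "real ^ 'n \<Rightarrow> complex" and x
    assume g: "g \<in> borel_measurable borel" "\<exists>K N. \<forall>x. cmod (g x) \<le> K * japanese x ^ N"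
      "\<forall>x. ennreal (cmod (g x)) \<le> (\<integral>\<^sup>+z. ennreal (cmod (T z) * cmod (g (x + z))) \<partial>lborel)"
    let ?I = "\<integral>\<^sup>+z. ennreal (cmod (g z) powr P) \<partial>lborel"
    have I: "Lp_norm lborel (ereal P) (\<lambda>x. ennreal (cmod (g x))) = ennreal_powr ?I (1 / P)"
      by (simp add: Lp_norm_ereal ennreal_powr_ennreal)
    have "ennreal (cmod (g x) powr P) \<le> ennreal C * ?I"
    proof (cases ?I)
      case (real r)
      then have "cmod (g x) powr P \<le> C * r" using main[OF g(1,2) g(3)[rule_format], of r x] by simp
      then show ?thesis using real C1 by (simp add: ennreal_mult[symmetric] ennreal_leI)
    next
      case top
      then show ?thesis using C1 by (simp add: ennreal_mult_top)
    qed
    from ennreal_powr_mono[OF this, of "1 / P"]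
    show "ennreal (cmod (g x)) \<le> ennreal (C powr (1 / P)) * Lp_norm lborel (ereal P) (\<lambda>x. ennreal (cmod (g x)))"
      using P C1 by (simp add: I ennreal_powr_mult ennreal_powr_ennreal powr_powr)
  qed
qed

text \<open>The L^p norm of a block bounds its supremum, so \<open>Lp_norm_interpolate\<close>
  reaches every larger exponent; for infinite \<open>p\<close> the two exponents coincide.\<close>

lemma box_fun_Lp_embedding:
  fixes \<sigma> :: "real ^ 'n::finite \<Rightarrow> complex"
  assumes \<sigma>: "decomposition_window \<sigma>" and p: "0 < p" "p \<le> p\<^sub>1"
  shows "\<exists>C\<ge>1. \<forall>u k. tempered u \<longrightarrow>
    Lp_norm lborel p\<^sub>1 (\<lambda>x. ennreal (cmod (box_fun \<sigma> k u x))) \<le>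
      ennreal C * Lp_norm lborel p (\<lambda>x. ennreal (cmod (box_fun \<sigma> k u x)))"
  using p(1)
proof (cases rule: ereal_pos_cases)
  case inf
  then show ?thesis using p by (intro exI[of _ 1]) auto
next
  case (fin P)
  let ?T = "fourier (fat_window \<sigma>)"
  have T: "schwartz ?T" by (intro schwartz_fourier test_fun_fat_window \<sigma>)
  obtain C where C: "1 \<le> C" and bern: "\<And>g. g \<in> borel_measurable borel \<Longrightarrow>
    (\<exists>K N. \<forall>x. cmod (g x) \<le> K * japanese x ^ N) \<Longrightarrow>
    (\<forall>x. ennreal (cmod (g x)) \<le> (\<integral>\<^sup>+z. ennreal (cmod (?T z) * cmod (g (x + z))) \<partial>lborel)) \<Longrightarrow>
    (\<forall>x. ennreal (cmod (g x)) \<le> ennreal C * Lp_norm lborel p (\<lambda>x. ennreal (cmod (g x))))"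
    using bernstein[OF T fin(2)] unfolding fin(1) by blast
  show ?thesis
  proof (intro exI[of _ C] conjI allI impI C)
    fix u :: "'n distribution" and k assume u: "tempered u"
    let ?g = "box_fun \<sigma> k u"
    have gm [measurable]: "?g \<in> borel_measurable borel"
      by (intro borel_measurable_continuous_onI continuous_box_fun \<sigma> u)
    have rep: "ennreal (cmod (?g x)) \<le> (\<integral>\<^sup>+z. ennreal (cmod (?T z) * cmod (?g (x + z))) \<partial>lborel)" for x
    proof -
      let ?f = "\<lambda>z. fourier (\<lambda>\<xi>. fat_window \<sigma> (\<xi> - lattice_pt k)) z * ?g (x + z)"
      have "ennreal (cmod (?g x)) = ennreal (cmod (\<integral>z. ?f z \<partial>lborel))"
        by (subst box_fun_reproducing[OF \<sigma> u]) simp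
      \<comment> \<open>If the integrand were not integrable, the Bochner integral would be 0 by
        convention and the bound trivial.\<close>
      also have "\<dots> \<le> (\<integral>\<^sup>+z. ennreal (cmod (?f z)) \<partial>lborel)"
        by (cases "integrable lborel ?f")
          (auto intro: integral_norm_bound_ennreal simp: not_integrable_integral_eq)
      finally show ?thesis
        by (simp add: norm_mult cmod_fourier_shift[OF test_fun_measurable[OF test_fun_fat_window[OF \<sigma>]]])
    qed
    have "ennreal (cmod (?g x)) \<le> ennreal C * Lp_norm lborel p (\<lambda>x. ennreal (cmod (?g x)))" for x
      using bern[OF gm box_fun_growth[OF \<sigma> u]] rep by blast
    then show "Lp_norm lborel p\<^sub>1 (\<lambda>x. ennreal (cmod (?g x))) \<le>
        ennreal C * Lp_norm lborel p (\<lambda>x. ennreal (cmod (?g x)))"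
      using C by (intro Lp_norm_interpolate p) auto
  qed
qed

section \<open>Lattice sums\<close>

lemma sum_vec_prod:
  fixes \<phi> :: "int \<Rightarrow> real"
  assumes "finite A"
  shows "(\<Sum>k\<in>{k :: int ^ 'n::finite. \<forall>i. k $ i \<in> A}. \<Prod>i\<in>UNIV. \<phi> (k $ i)) = (\<Sum>j\<in>A. \<phi> j) ^ CARD('n)"
proof -
  have "(\<Sum>k\<in>{k :: int ^ 'n. \<forall>i. k $ i \<in> A}. \<Prod>i\<in>UNIV. \<phi> (k $ i)) =
      (\<Sum>f\<in>PiE (UNIV :: 'n set) (\<lambda>_. A). \<Prod>i\<in>UNIV. \<phi> (f i))"
    by (rule sum.reindex_bij_witness[where j="\<lambda>k i. k $ i" and i="\<lambda>f. \<chi> i. f i"]) auto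
  also have "\<dots> = (\<Prod>i\<in>(UNIV :: 'n set). \<Sum>j\<in>A. \<phi> j)"
    by (rule prod_sum_PiE[symmetric]) (use assms in auto)
  finally show ?thesis by simp
qed

text \<open>Comparison with the convergent series of n^(-c). The symmetric range is covered by two
  one-sided ones, counting 0 twice.\<close>

lemma bounded_integer_powr_sums:
  fixes c :: real
  assumes c: "1 < c"
  obtains B where "0 \<le> B" "\<And>m. (\<Sum>j\<in>{- int m..int m}. sqrt (1 + (real_of_int j)\<^sup>2) powr - c) \<le> B"
proof -
  define \<phi> where "\<phi> j = sqrt (1 + (real_of_int j)\<^sup>2) powr - c" for j
  define f where "f n = \<phi> (int n)" for n
  have f0: "0 \<le> f n" for n by (simp add: f_def \<phi>_def)
  have "summable f"
  proof (rule summable_comparison_test)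
    show "summable (\<lambda>n. real n powr - c)" using c by (simp add: summable_real_powr_iff)
    have "norm (f n) \<le> real n powr - c" if "1 \<le> n" for n
    proof -
      have "real n = sqrt ((real n)\<^sup>2)" by simp
      also have "\<dots> \<le> sqrt (1 + (real n)\<^sup>2)" by (intro real_sqrt_le_mono) simp
      finally have "real n \<le> sqrt (1 + (real n)\<^sup>2)" .
      then have "sqrt (1 + (real n)\<^sup>2) powr - c \<le> real n powr - c"
        using that c by (intro powr_mono2') auto
      then show ?thesis by (simp add: f_def \<phi>_def)
    qed
    then show "\<exists>N. \<forall>n\<ge>N. norm (f n) \<le> real n powr - c" by blast
  qed
  then have s: "(\<Sum>n\<le>m. f n) \<le> suminf f" for m
    using f0 by (intro sum_le_suminf) auto
  have "(\<Sum>j\<in>{- int m..int m}. \<phi> j) \<le> suminf f + suminf f" for m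
  proof -
    let ?X = "int ` {..m}" and ?Y = "(\<lambda>n. - int n) ` {..m}"
    have sub: "{- int m..int m} \<subseteq> ?X \<union> ?Y"
    proof
      fix j assume j: "j \<in> {- int m..int m}"
      show "j \<in> ?X \<union> ?Y"
      proof (cases "0 \<le> j")
        case True
        then have "j = int (nat j)" "nat j \<le> m" using j by auto
        then show ?thesis by blast
      next
        case False
        then have "j = - int (nat (- j))" "nat (- j) \<le> m" using j by auto
        then show ?thesis by blast
      qed
    qed
    have "(\<Sum>j\<in>{- int m..int m}. \<phi> j) \<le> (\<Sum>j\<in>?X \<union> ?Y. \<phi> j)"
      by (intro sum_mono2 sub) (auto simp: \<phi>_def)
    also have "\<dots> \<le> (\<Sum>j\<in>?X. \<phi> j) + (\<Sum>j\<in>?Y. \<phi> j)"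
      by (subst sum_Un) (auto simp: \<phi>_def intro!: sum_nonneg)
    also have "(\<Sum>j\<in>?X. \<phi> j) = (\<Sum>n\<le>m. f n)"
      by (subst sum.reindex) (auto simp: f_def)
    also have "(\<Sum>j\<in>?Y. \<phi> j) = (\<Sum>n\<le>m. f n)"
      by (subst sum.reindex) (auto simp: f_def \<phi>_def inj_on_def)
    finally show ?thesis using s[of m] by linarith
  qed
  moreover have "0 \<le> suminf f + suminf f" using s[of 0] f0[of 0] by simp
  ultimately show ?thesis using that[of "suminf f + suminf f"] by (simp add: \<phi>_def)
qed

text \<open>The weight \<open>\<langle>k\<rangle>\<^sup>d\<close> dominates the product of the one-dimensional weights of the coordinates.\<close>

lemma lattice_sum_finite:
  assumes a: "real CARD('n) < a"
  obtains S where "0 \<le> S"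
    "(\<integral>\<^sup>+k. ennreal (japanese (lattice_pt k :: real ^ 'n::finite) powr - a) \<partial>count_space UNIV) = ennreal S"
proof -
  let ?d = "real CARD('n)"
  \<comment> \<open>The exponent is shared equally among the d coordinates; c > 1 is what each
    one-dimensional sum requires.\<close>
  define c where "c = a / ?d"
  have c: "1 < c" "c * ?d = a" using a by (auto simp: c_def)
  obtain B where B: "0 \<le> B" "\<And>m. (\<Sum>j\<in>{- int m..int m}. sqrt (1 + (real_of_int j)\<^sup>2) powr - c) \<le> B"
    using bounded_integer_powr_sums[OF c(1)] by metis
  have pt: "japanese (lattice_pt k :: real ^ 'n) powr - a \<le> (\<Prod>i\<in>UNIV. sqrt (1 + (real_of_int (k $ i))\<^sup>2) powr - c)" for k :: "int ^ 'n"
  proof -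
    let ?J = "japanese (lattice_pt k :: real ^ 'n)"
    have "?J powr - a = (?J powr - c) powr real CARD('n)"
      by (simp add: powr_powr c(2)[symmetric])
    also have "\<dots> = (?J powr - c) ^ CARD('n)" by (rule powr_realpow) simp
    also have "\<dots> = (\<Prod>i\<in>(UNIV :: 'n set). ?J powr - c)" by simp
    also have "\<dots> \<le> (\<Prod>i\<in>UNIV. sqrt (1 + (real_of_int (k $ i))\<^sup>2) powr - c)"
    proof (intro prod_mono conjI powr_mono2')
      fix i
      have "\<bar>(lattice_pt k :: real ^ 'n) $ i\<bar>\<^sup>2 \<le> (norm (lattice_pt k :: real ^ 'n))\<^sup>2"
        by (intro power_mono component_le_norm_cart) auto
      then show "sqrt (1 + (real_of_int (k $ i))\<^sup>2) \<le> ?J"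
        unfolding japanese_def by (intro real_sqrt_le_mono) simp
      show "0 < sqrt (1 + (real_of_int (k $ i))\<^sup>2)" by (simp add: add_pos_nonneg)
    qed (use c in auto)
    finally show ?thesis .
  qed
  have "(\<integral>\<^sup>+k. ennreal (japanese (lattice_pt k :: real ^ 'n) powr - a) \<partial>count_space UNIV) \<le> ennreal (B ^ CARD('n))"
  proof (rule nn_integral_count_space_le)
    fix F :: "(int ^ 'n) set" assume F: "finite F"
    \<comment> \<open>Any common bound of the coordinates will do; a sum, unlike a maximum, also
      makes sense for empty \<open>F\<close>.\<close>
    define m where "m = (\<Sum>k\<in>F. \<Sum>i\<in>UNIV. nat \<bar>k $ i\<bar>)"
    have sub: "F \<subseteq> {k. \<forall>i. k $ i \<in> {- int m..int m}}"
    proof (intro subsetI CollectI allI)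
      fix k i assume k: "k \<in> F"
      have "nat \<bar>k $ i\<bar> \<le> (\<Sum>i\<in>UNIV. nat \<bar>k $ i\<bar>)" by (intro member_le_sum) auto
      also have "\<dots> \<le> m" unfolding m_def using F k by (intro member_le_sum) auto
      finally show "k $ i \<in> {- int m..int m}" by auto
    qed
    have "(\<Sum>k\<in>F. japanese (lattice_pt k :: real ^ 'n) powr - a) \<le>
        (\<Sum>k\<in>{k. \<forall>i. k $ i \<in> {- int m..int m}}. japanese (lattice_pt k :: real ^ 'n) powr - a)"
      by (intro sum_mono2 sub finite_lattice_box) auto
    also have "\<dots> \<le> (\<Sum>k\<in>{k :: int ^ 'n. \<forall>i. k $ i \<in> {- int m..int m}}.
        \<Prod>i\<in>UNIV. sqrt (1 + (real_of_int (k $ i))\<^sup>2) powr - c)"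
      by (intro sum_mono pt)
    also have "\<dots> = (\<Sum>j\<in>{- int m..int m}. sqrt (1 + (real_of_int j)\<^sup>2) powr - c) ^ CARD('n)"
      by (rule sum_vec_prod) simp
    also have "\<dots> \<le> B ^ CARD('n)" by (intro power_mono B sum_nonneg) auto
    finally show "(\<Sum>k\<in>F. ennreal (japanese (lattice_pt k :: real ^ 'n) powr - a)) \<le> ennreal (B ^ CARD('n))"
      by (subst sum_ennreal) (auto intro: ennreal_leI)
  qed
  then have "(\<integral>\<^sup>+k. ennreal (japanese (lattice_pt k :: real ^ 'n) powr - a) \<partial>count_space UNIV) \<noteq> \<top>"
    by (auto simp: top_unique)
  then show ?thesis using that by (metis ennreal_cases)
qed

section \<open>Sufficiency of the conditions\<close>

text \<open>The criterion for l^r to embed into l^q with weight \<langle>k\<rangle>^s on a lattice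
  of dimension d. In the theorem \<open>r\<close> is the maximum of p and q, and \<open>q\<close>
  stands for q_1.\<close>

definition sequence_condition :: "real \<Rightarrow> ereal \<Rightarrow> ereal \<Rightarrow> real \<Rightarrow> bool" where
  "sequence_condition d r q s \<longleftrightarrow>
    (r \<le> q \<and> s \<le> 0) \<or> (q < r \<and> ereal s + ereal d / q < ereal d / r)"

lemma weighted_sequence_embedding:
  assumes r: "0 < r" and q: "0 < q" and cond: "sequence_condition (real CARD('n)) r q s"
  shows "\<exists>C\<ge>1. \<forall>b. Lp_norm (count_space UNIV) q
      (\<lambda>k. ennreal (japanese (lattice_pt k :: real ^ 'n::finite) powr s) * b k) \<le>
    ennreal C * Lp_norm (count_space UNIV) r b"
proof (cases "r \<le> q")
  case True
  then have s: "s \<le> 0" using cond by (auto simp: sequence_condition_def)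
  have "Lp_norm (count_space UNIV) q (\<lambda>k. ennreal (japanese (lattice_pt k :: real ^ 'n) powr s) * b k) \<le>
      1 * Lp_norm (count_space UNIV) r b" for b
  proof -
    have "japanese (lattice_pt k :: real ^ 'n) powr s \<le> 1" for k
      using powr_mono[OF s japanese_ge_1[of "lattice_pt k"]] by (simp add: less_imp_neq[symmetric])
    then have "ennreal (japanese (lattice_pt k :: real ^ 'n) powr s) * b k \<le> 1 * b k" for k
      by (intro mult_right_mono) auto
    then have "Lp_norm (count_space UNIV) q (\<lambda>k. ennreal (japanese (lattice_pt k :: real ^ 'n) powr s) * b k) \<le>
        Lp_norm (count_space UNIV) q b"
      by (intro Lp_norm_mono q) auto
    also have "\<dots> \<le> Lp_norm (count_space UNIV) r b" by (intro Lp_norm_count_antimono r True)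
    finally show ?thesis by simp
  qed
  then show ?thesis by (intro exI[of _ 1]) simp
next
  case False
  then have qr: "q < r" and c: "ereal s + ereal (real CARD('n)) / q < ereal (real CARD('n)) / r"
    using cond by (auto simp: sequence_condition_def)
  obtain Q where Q: "q = ereal Q" "0 < Q" using q qr by (cases q) auto
  define \<beta> where "\<beta> = (case r of ereal R \<Rightarrow> Q * R / (R - Q) | _ \<Rightarrow> Q)"
  \<comment> \<open>The strict inequality between the exponents, multiplied by \<beta>, says
    precisely that the lattice sum of \<langle>k\<rangle>^(s \<beta>) converges, which is the weight
    condition in Hoelder's inequality.\<close>
  have "real CARD('n) < - (s * \<beta>)"
  proof (cases r)
    case (real R)
    then have R: "Q < R" "0 < R" using qr r Q by auto
    have "s + real CARD('n) / Q < real CARD('n) / R" using c Q R real by simp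
    then have "s < real CARD('n) / R - real CARD('n) / Q" by simp
    also have "\<dots> = - (real CARD('n) * ((R - Q) / (Q * R)))" using R Q by (simp add: field_simps)
    finally have "s * (Q * R / (R - Q)) < - (real CARD('n) * ((R - Q) / (Q * R))) * (Q * R / (R - Q))"
      using R Q by (intro mult_strict_right_mono) auto
    also have "\<dots> = - real CARD('n)" using R Q by simp
    finally show ?thesis by (simp add: \<beta>_def real)
  next
    case PInf
    then have "s + real CARD('n) / Q < 0" using c Q by simp
    then have "(s + real CARD('n) / Q) * Q < 0" using Q by (simp add: mult_neg_pos)
    then show ?thesis using Q by (simp add: \<beta>_def PInf distrib_right)
  qed (use r in auto)
  then obtain S where S: "0 \<le> S"
    "(\<integral>\<^sup>+k. ennreal (japanese (lattice_pt k :: real ^ 'n) powr - (- (s * \<beta>))) \<partial>count_space UNIV) = ennreal S"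
    by (rule lattice_sum_finite)
  have "Lp_norm (count_space UNIV) q (\<lambda>k. ennreal (japanese (lattice_pt k :: real ^ 'n) powr s) * b k) \<le>
      ennreal ((S + 1) powr (1 / Q)) * Lp_norm (count_space UNIV) r b" for b
    unfolding Q(1)
    by (rule Lp_norm_count_weighted[OF Q(2)]) (use qr Q S in \<open>auto simp: powr_powr \<beta>_def less_imp_neq[symmetric]\<close>)
  moreover have "1 \<le> (S + 1) powr (1 / Q)" using S Q by (simp add: ge_one_powr_ge_zero)
  ultimately show ?thesis by blast
qed

lemma amalgam_norm_0:
  "amalgam_norm \<sigma> p q 0 f = Lp_norm lborel p (\<lambda>x. Lp_norm (count_space UNIV) q
    (\<lambda>k. ennreal (cmod (box_fun \<sigma> k f x))))"
  by (simp add: amalgam_norm_def less_imp_neq[symmetric])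

theorem amalgam_embedding:
  fixes \<sigma> :: "real ^ 'n::finite \<Rightarrow> complex"
  assumes \<sigma>: "decomposition_window \<sigma>" and p: "0 < p" "p \<le> p\<^sub>1" and q: "0 < q" "0 < q\<^sub>1"
    and cond: "sequence_condition (real CARD('n)) (max p q) q\<^sub>1 s"
  shows "continuously_embedded (amalgam_space \<sigma> p q 0) (amalgam_norm \<sigma> p q 0)
    (modulation_space \<sigma> p\<^sub>1 q\<^sub>1 s) (modulation_norm \<sigma> p\<^sub>1 q\<^sub>1 s)"
proof -
  have r: "0 < max p q" using p by (simp add: less_max_iff_disj)
  obtain C where C: "1 \<le> C" "\<And>u k. tempered u \<Longrightarrow>
    Lp_norm lborel p\<^sub>1 (\<lambda>x. ennreal (cmod (box_fun \<sigma> k u x))) \<le>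
      ennreal C * Lp_norm lborel p (\<lambda>x. ennreal (cmod (box_fun \<sigma> k u x)))"
    using box_fun_Lp_embedding[OF \<sigma> p] by blast
  obtain C' where C': "1 \<le> C'" "\<And>b. Lp_norm (count_space UNIV) q\<^sub>1
      (\<lambda>k. ennreal (japanese (lattice_pt k :: real ^ 'n) powr s) * b k) \<le>
    ennreal C' * Lp_norm (count_space UNIV) (max p q) b"
    using weighted_sequence_embedding[OF r q(2) cond] by blast
  have Cmult: "Lp_norm (count_space UNIV) (max p q) (\<lambda>k. ennreal C * b k) \<le>
      ennreal C * Lp_norm (count_space UNIV) (max p q) b" for b :: "int ^ 'n \<Rightarrow> ennreal"
    using r
  proof (cases rule: ereal_pos_cases)
    case (fin P)
    then show ?thesis by (simp add: Lp_norm_cmult)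
  next
    case inf
    then show ?thesis by (auto simp: Lp_norm_count_infty intro!: SUP_least mult_left_mono SUP_upper)
  qed
  \<comment> \<open>The inequality holds for every tempered \<open>f\<close>, with values in the
    extended half-line; the inclusion of the spaces is then a matter of finiteness.\<close>
  have main: "modulation_norm \<sigma> p\<^sub>1 q\<^sub>1 s f \<le> ennreal (C' * C) * amalgam_norm \<sigma> p q 0 f" if f: "tempered f" for f
  proof -
    let ?H = "\<lambda>k x. ennreal (cmod (box_fun \<sigma> k f x))"
    have [measurable]: "box_fun \<sigma> k f \<in> borel_measurable borel" for k
      by (intro borel_measurable_continuous_onI continuous_box_fun \<sigma> f)
    have "modulation_norm \<sigma> p\<^sub>1 q\<^sub>1 s f \<le> ennreal C' *
        Lp_norm (count_space UNIV) (max p q) (\<lambda>k. Lp_norm lborel p\<^sub>1 (?H k))"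
      unfolding modulation_norm_def by (rule C'(2))
    also have "\<dots> \<le> ennreal C' * Lp_norm (count_space UNIV) (max p q) (\<lambda>k. ennreal C * Lp_norm lborel p (?H k))"
      by (intro mult_left_mono Lp_norm_mono r C(2) f) auto
    also have "\<dots> \<le> ennreal C' * (ennreal C * Lp_norm (count_space UNIV) (max p q) (\<lambda>k. Lp_norm lborel p (?H k)))"
      by (intro mult_left_mono Cmult) auto
    also have "\<dots> \<le> ennreal C' * (ennreal C * amalgam_norm \<sigma> p q 0 f)"
      unfolding amalgam_norm_0 by (intro mult_left_mono mixed_norm_swap p q) auto
    finally show ?thesis using C C' by (simp add: ennreal_mult mult.assoc)
  qed
  have "f \<in> modulation_space \<sigma> p\<^sub>1 q\<^sub>1 s" if "f \<in> amalgam_space \<sigma> p q 0" for f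
  proof -
    have f: "tempered f" "amalgam_norm \<sigma> p q 0 f < \<infinity>" using that by (auto simp: amalgam_space_def)
    have "ennreal (C' * C) * amalgam_norm \<sigma> p q 0 f < \<infinity>" using f(2) by (simp add: ennreal_mult_less_top)
    then show ?thesis using main[OF f(1)] f(1) by (auto simp: modulation_space_def)
  qed
  then show ?thesis
    unfolding continuously_embedded_def using main by (auto simp: amalgam_space_def)
qed

section \<open>Necessity of the conditions\<close>

lemma Lp_norm_cmult_le:
  assumes p: "0 < p" and f [measurable]: "f \<in> borel_measurable M"
  shows "Lp_norm M p (\<lambda>x. c * f x) \<le> c * Lp_norm M p f"
  using p
proof (cases rule: ereal_pos_cases)
  case inf
  have "AE x in M. c * f x \<le> c * esssup M f"
    using esssup_AE[where M=M and f=f] by eventually_elim (rule mult_left_mono, auto)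
  then show ?thesis by (auto simp: inf Lp_norm_infty intro!: esssup_I)
qed (simp add: Lp_norm_cmult)

lemma Lp_norm_cmult_ge:
  assumes p: "0 < p" and f [measurable]: "f \<in> borel_measurable M" and c: "0 \<le> c"
  shows "ennreal c * Lp_norm M p f \<le> Lp_norm M p (\<lambda>x. ennreal c * f x)"
proof (cases "c = 0")
  case False
  then have c0: "0 < c" using c by simp
  have i: "ennreal (1 / c) * ennreal c = 1" "ennreal c * ennreal (1 / c) = 1"
    using c0 by (simp_all add: ennreal_mult[symmetric])
  have "Lp_norm M p (\<lambda>x. ennreal (1 / c) * (ennreal c * f x)) \<le> ennreal (1 / c) * Lp_norm M p (\<lambda>x. ennreal c * f x)"
    by (rule Lp_norm_cmult_le[OF p]) measurable
  then have "Lp_norm M p f \<le> ennreal (1 / c) * Lp_norm M p (\<lambda>x. ennreal c * f x)"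
    by (simp add: mult.assoc[symmetric] i)
  then have "ennreal c * Lp_norm M p f \<le> ennreal c * (ennreal (1 / c) * Lp_norm M p (\<lambda>x. ennreal c * f x))"
    by (rule mult_left_mono) simp
  then show ?thesis by (simp add: mult.assoc[symmetric] i)
qed simp

lemma Lp_norm_shift_ge:
  fixes f :: "'a::euclidean_space \<Rightarrow> ennreal"
  assumes p: "0 < p" and f [measurable]: "f \<in> borel_measurable borel"
  shows "Lp_norm lborel p f \<le> Lp_norm lborel p (\<lambda>x. f (t + x))"
  using p
proof (cases rule: ereal_pos_cases)
  case (fin P)
  have "(\<integral>\<^sup>+x. ennreal_powr (f (t + x)) P \<partial>lborel) = (\<integral>\<^sup>+x. ennreal_powr (f x) P \<partial>lborel)"
    by (rule lborel_nn_integral_shift) measurable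
  then show ?thesis by (simp add: fin Lp_norm_ereal)
next
  case inf
  let ?E = "esssup lborel (\<lambda>x. f (t + x))"
  have "AE x in lborel. f (t + x) \<le> ?E" by (rule esssup_AE)
  then have "AE x in distr lborel borel ((+) t). f x \<le> ?E" by (subst AE_distr_iff) auto
  then have "AE x in lborel. f x \<le> ?E" unfolding lborel_distr_plus .
  then show ?thesis by (auto simp: inf Lp_norm_infty intro!: esssup_I)
qed

lemma schwartz_Lp_norm_finite:
  fixes \<phi> :: "real ^ 'n::finite \<Rightarrow> complex"
  assumes \<phi>: "schwartz \<phi>" and p: "0 < p"
  shows "Lp_norm lborel p (\<lambda>x. ennreal (cmod (\<phi> x))) < \<top>"
  using p
proof (cases rule: ereal_pos_cases)
  case (fin P)
  have [measurable]: "\<phi> \<in> borel_measurable borel" by (rule schwartz_measurable[OF \<phi>])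
  let ?d = "2 * CARD('n)"
  \<comment> \<open>N P \<ge> 2d, so that the P-th power of the decay is integrable; small
    \<open>P\<close> requires large \<open>N\<close>.\<close>
  define N where "N = nat \<lceil>real ?d / P\<rceil>"
  have N: "real ?d \<le> real N * P" using fin(2) by (simp add: N_def pos_divide_le_eq[symmetric])
  obtain C where C: "0 \<le> C" "\<And>x. japanese x ^ N * cmod (\<phi> x) \<le> C"
    using schwartz_decay[OF \<phi>, of N "[]"] by (metis iter_partial_Nil)
  have pt: "cmod (\<phi> x) powr P \<le> C powr P * (1 / japanese x ^ ?d)" for x
  proof -
    have "(japanese x ^ N * cmod (\<phi> x)) powr P \<le> C powr P" using C fin(2) by (intro powr_mono2) auto
    then have "japanese x powr (real N * P) * cmod (\<phi> x) powr P \<le> C powr P"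
      by (simp add: powr_mult powr_realpow[symmetric] powr_powr)
    moreover have "japanese x ^ ?d * cmod (\<phi> x) powr P \<le> japanese x powr (real N * P) * cmod (\<phi> x) powr P"
    proof (rule mult_right_mono)
      have "japanese x ^ ?d = japanese x powr real ?d" by (rule powr_realpow[symmetric]) simp
      also have "\<dots> \<le> japanese x powr (real N * P)" by (rule powr_mono[OF N japanese_ge_1])
      finally show "japanese x ^ ?d \<le> japanese x powr (real N * P)" .
    qed simp
    ultimately have "japanese x ^ ?d * cmod (\<phi> x) powr P \<le> C powr P" by linarith
    then show ?thesis by (simp add: pos_le_divide_eq mult.commute)
  qed
  have "integrable lborel (\<lambda>x::real ^ 'n. C powr P * (1 / japanese x ^ ?d))"
    by (intro integrable_mult_right integrable_inverse_japanese)
  then have "(\<integral>\<^sup>+(x::real ^ 'n). ennreal (C powr P * (1 / japanese x ^ ?d)) \<partial>lborel) < \<top>"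
    by (subst (asm) integrable_iff_bounded) (simp add: abs_mult)
  moreover have "(\<integral>\<^sup>+x. ennreal (cmod (\<phi> x) powr P) \<partial>lborel) \<le>
      (\<integral>\<^sup>+(x::real ^ 'n). ennreal (C powr P * (1 / japanese x ^ ?d)) \<partial>lborel)"
    by (intro nn_integral_mono ennreal_leI pt)
  ultimately have "(\<integral>\<^sup>+x. ennreal (cmod (\<phi> x) powr P) \<partial>lborel) < \<top>" by (rule le_less_trans[rotated])
  then show ?thesis by (simp add: fin Lp_norm_ereal ennreal_powr_ennreal less_top[symmetric])
next
  case inf
  have [measurable]: "\<phi> \<in> borel_measurable borel" by (rule schwartz_measurable[OF \<phi>])
  obtain C where "\<And>x. cmod (\<phi> x) \<le> C" using schwartz_bounded[OF \<phi>] by blast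
  then have "esssup lborel (\<lambda>x. ennreal (cmod (\<phi> x))) \<le> ennreal C"
    by (intro esssup_I) (auto intro: ennreal_leI)
  then show ?thesis by (simp add: inf Lp_norm_infty le_less_trans)
qed

lemma continuous_Lp_norm_pos:
  fixes \<phi> :: "real ^ 'n::finite \<Rightarrow> complex"
  assumes \<phi>: "continuous_on UNIV \<phi>" and x: "\<phi> x \<noteq> 0" and p: "0 < p"
  shows "0 < Lp_norm lborel p (\<lambda>x. ennreal (cmod (\<phi> x)))"
proof (rule ccontr)
  have [measurable]: "\<phi> \<in> borel_measurable borel" by (rule borel_measurable_continuous_onI[OF \<phi>])
  assume "\<not> ?thesis"
  then have z: "Lp_norm lborel p (\<lambda>x. ennreal (cmod (\<phi> x))) = 0" by simp
  have "AE x in lborel. \<phi> x = 0"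
    using p
  proof (cases rule: ereal_pos_cases)
    case (fin P)
    then have "(\<integral>\<^sup>+x. ennreal (cmod (\<phi> x) powr P) \<partial>lborel) = 0"
      using z by (simp add: Lp_norm_ereal ennreal_powr_ennreal)
    then have "AE x in lborel. ennreal (cmod (\<phi> x) powr P) = 0" by (subst (asm) nn_integral_0_iff_AE) auto
    then show ?thesis by eventually_elim auto
  next
    case inf
    have "AE x in lborel. ennreal (cmod (\<phi> x)) \<le> 0"
      using esssup_AE[where M=lborel and f="\<lambda>x. ennreal (cmod (\<phi> x))"] z by (simp add: inf Lp_norm_infty)
    then show ?thesis by eventually_elim auto
  qed
  then have "AE x in lborel. x \<notin> {x. \<phi> x \<noteq> 0}" by simp
  moreover have "open {x. \<phi> x \<noteq> 0}"
    using \<phi> by (intro open_Collect_neq continuous_intros) auto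
  ultimately have "{x. \<phi> x \<noteq> 0} = {}" by (intro open_AE_empty)
  then show False using x by blast
qed

section \<open>Divergence of the critical lattice sum\<close>

lemma harmonic_partial_sums_unbounded: "\<exists>m. B < (\<Sum>j\<in>{1..m}. 1 / real j)"
proof (rule ccontr)
  assume "\<not> ?thesis"
  then have le: "(\<Sum>j\<in>{1..m}. 1 / real j) \<le> B" for m by (simp add: not_less)
  have "summable (\<lambda>n. 1 / real (Suc n))"
  proof (rule bounded_imp_summable)
    fix n
    have "(\<Sum>k\<le>n. 1 / real (Suc k)) = (\<Sum>j\<in>{1..Suc n}. 1 / real j)"
      by (rule sum.reindex_bij_witness[where i="\<lambda>j. j - 1" and j=Suc]) auto
    then show "(\<Sum>k\<le>n. 1 / real (Suc k)) \<le> B" using le[of "Suc n"] by (simp only:)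
  qed simp
  then have "summable (\<lambda>n. inverse (real n))"
    by (subst summable_Suc_iff[symmetric]) (simp add: inverse_eq_divide)
  then show False using not_summable_harmonic by blast
qed

lemma card_lattice_box:
  fixes A :: "'n::finite \<Rightarrow> int set"
  assumes "\<And>i. finite (A i)"
  shows "card {k :: int ^ 'n. \<forall>i. k $ i \<in> A i} = (\<Prod>i\<in>UNIV. card (A i))"
proof -
  have "bij_betw (\<lambda>k i. k $ i) {k :: int ^ 'n. \<forall>i. k $ i \<in> A i} (PiE UNIV A)"
    by (rule bij_betwI[where g="\<lambda>f. \<chi> i. f i"]) auto
  then have "card {k :: int ^ 'n. \<forall>i. k $ i \<in> A i} = card (PiE UNIV A)" by (rule bij_betw_same_card)
  then show ?thesis by (simp add: card_PiE)
qed

text \<open>The points with a fixed coordinate \<open>j\<close> and the other coordinates in \<open>{0..<j}\<close> contribute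
  at least a multiple of \<open>j\<^sup>d\<^sup>-\<^sup>1 / j\<^sup>d\<close>.\<close>

lemma lattice_sum_unbounded:
  "\<exists>A :: (int ^ 'n::finite) set. finite A \<and>
    B < (\<Sum>k\<in>A. japanese (lattice_pt k :: real ^ 'n) powr - real CARD('n))"
proof -
  let ?d = "CARD('n)"
  let ?J = "\<lambda>k. japanese (lattice_pt k :: real ^ 'n)"
  \<comment> \<open>Picks a coordinate, which exists because types are nonempty.\<close>
  obtain i0 :: 'n where True by simp
  define E where "E j = {k :: int ^ 'n. \<forall>i. k $ i \<in> (if i = i0 then {int j} else {0..<int j})}" for j :: nat
  have finE: "finite (E j)" for j unfolding E_def by (rule finite_lattice_box) auto
  have cardE: "card (E j) = j ^ (?d - 1)" for j
  proof -
    have "card (E j) = (\<Prod>i\<in>UNIV. card (if i = i0 then {int j} else {0..<int j}))"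
      unfolding E_def by (rule card_lattice_box) auto
    also have "\<dots> = (\<Prod>i\<in>UNIV - {i0}. j)"
      by (subst prod.remove[of UNIV i0]) (auto intro!: prod.cong)
    finally show ?thesis by (simp add: card_Diff_singleton)
  qed
  \<comment> \<open>On the layer \<open>E j\<close> all coordinates are at most j, so
    \<langle>k\<rangle> \<le> (d + 1) j; \<open>c\<close> is the power -d of this constant.\<close>
  define c where "c = (real ?d + 1) powr - real ?d"
  have c: "0 < c" by (simp add: c_def)
  have lower: "c / real j \<le> (\<Sum>k\<in>E j. ?J k powr - real ?d)" if j: "1 \<le> j" for j
  proof -
    have Jle: "?J k \<le> (real ?d + 1) * real j" if k: "k \<in> E j" for k
    proof (rule power2_le_imp_le)
      have kj: "0 \<le> k $ i" "k $ i \<le> int j" for i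
      proof -
        have "k $ i \<in> (if i = i0 then {int j} else {0..<int j})" using k unfolding E_def by blast
        then show "0 \<le> k $ i" "k $ i \<le> int j" by (auto split: if_splits)
      qed
      have "(real_of_int (k $ i))\<^sup>2 \<le> (real j)\<^sup>2" for i
      proof (rule power_mono)
        have "real_of_int (k $ i) \<le> real_of_int (int j)" using kj(2) by (simp only: of_int_le_iff)
        then show "real_of_int (k $ i) \<le> real j" by simp
        show "0 \<le> real_of_int (k $ i)" using kj(1) by simp
      qed
      then have "(\<Sum>i\<in>UNIV. (real_of_int (k $ i))\<^sup>2) \<le> (\<Sum>i\<in>(UNIV :: 'n set). (real j)\<^sup>2)" by (intro sum_mono)
      moreover have "(norm (lattice_pt k :: real ^ 'n))\<^sup>2 = (\<Sum>i\<in>UNIV. (real_of_int (k $ i))\<^sup>2)"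
        unfolding power2_norm_eq_inner inner_vec_def by (simp add: power2_eq_square)
      ultimately have "(norm (lattice_pt k :: real ^ 'n))\<^sup>2 \<le> real ?d * (real j)\<^sup>2" by simp
      then have "(?J k)\<^sup>2 \<le> 1 + real ?d * (real j)\<^sup>2" by (simp add: japanese_squared)
      also have "\<dots> \<le> (real ?d + 1) * (real j)\<^sup>2" using j by (simp add: algebra_simps)
      also have "\<dots> \<le> (real ?d + 1)\<^sup>2 * (real j)\<^sup>2" by (intro mult_right_mono) (auto simp: power2_eq_square)
      finally show "(?J k)\<^sup>2 \<le> ((real ?d + 1) * real j)\<^sup>2" by (simp add: power_mult_distrib)
    qed simp
    have "c / real j = real (card (E j)) * (c * real j powr - real ?d)"
    proof -
      have "real (j ^ (?d - 1)) * real j powr - real ?d = real j powr (real (?d - 1)) * real j powr - real ?d"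
        by (subst powr_realpow) (use j in auto)
      also have "\<dots> = real j powr (real (?d - 1) + - real ?d)" by (simp only: powr_add)
      also have "real (?d - 1) + - real ?d = - 1" by (simp add: of_nat_diff Suc_leI)
      also have "real j powr - 1 = 1 / real j" using j by (simp add: powr_minus inverse_eq_divide)
      finally show ?thesis by (simp add: cardE mult_ac)
    qed
    also have "\<dots> = (\<Sum>k\<in>E j. c * real j powr - real ?d)" by simp
    also have "\<dots> \<le> (\<Sum>k\<in>E j. ?J k powr - real ?d)"
    proof (rule sum_mono)
      fix k assume k: "k \<in> E j"
      have "c * real j powr - real ?d = ((real ?d + 1) * real j) powr - real ?d"
        by (simp add: c_def powr_mult)
      also have "\<dots> \<le> ?J k powr - real ?d" by (rule powr_mono2'[OF _ _ Jle[OF k]]) auto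
      finally show "c * real j powr - real ?d \<le> ?J k powr - real ?d" .
    qed
    finally show ?thesis .
  qed
  obtain m where m: "B / c < (\<Sum>j\<in>{1..m}. 1 / real j)" using harmonic_partial_sums_unbounded by blast
  have "B < c * (\<Sum>j\<in>{1..m}. 1 / real j)" using m c by (simp add: pos_divide_less_eq mult.commute)
  also have "\<dots> = (\<Sum>j\<in>{1..m}. c / real j)" by (simp add: sum_distrib_left)
  also have "\<dots> \<le> (\<Sum>j\<in>{1..m}. \<Sum>k\<in>E j. ?J k powr - real ?d)" by (intro sum_mono lower) auto
  also have "\<dots> = (\<Sum>k\<in>(\<Union>j\<in>{1..m}. E j). ?J k powr - real ?d)"
  proof (rule sum.UNION_disjoint[symmetric])
    have "k $ i0 = int j" if "k \<in> E j" for k j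
    proof -
      have "k $ i0 \<in> (if i0 = i0 then {int j} else {0..<int j})" using that unfolding E_def by blast
      then show ?thesis by simp
    qed
    then show "\<forall>i\<in>{1..m}. \<forall>j\<in>{1..m}. i \<noteq> j \<longrightarrow> E i \<inter> E j = {}"
      by (metis disjoint_iff of_nat_eq_iff)
  qed (auto simp: finE)
  finally show ?thesis using finE by (intro exI[of _ "\<Union>j\<in>{1..m}. E j"]) auto
qed

section \<open>Necessity for weighted sequence spaces\<close>

lemma nn_integral_count_space_supported:
  assumes "finite A"
  shows "(\<integral>\<^sup>+k. ennreal_powr (ennreal (a k * of_bool (k \<in> A))) R \<partial>count_space UNIV) =
    (\<Sum>k\<in>A. ennreal_powr (ennreal (a k)) R)"
  using assms by (subst nn_integral_count_space'[of A]) auto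

text \<open>For r \<le> q unit sequences show that \<langle>k\<rangle>^s is bounded. For q < r the
  coefficients \<langle>k\<rangle>^(-d/r) on a finite set \<open>A\<close> compare both norms with
  powers of one and the same sum S of \<langle>k\<rangle>^(-d): if the strict inequality fails, then
  S^(1/q) \<le> K S^(1/r), which is impossible as S is unbounded.\<close>

lemma sequence_condition_necessary:
  assumes r: "0 < r" and q: "0 < q"
    and emb: "\<And>A a. finite A \<Longrightarrow> (\<And>k. 0 \<le> a k) \<Longrightarrow>
      Lp_norm (count_space UNIV) q (\<lambda>k. ennreal (japanese (lattice_pt k :: real ^ 'n::finite) powr s) *
        ennreal (a k * of_bool (k \<in> A))) \<le>
      ennreal K * Lp_norm (count_space UNIV) r (\<lambda>k. ennreal (a k * of_bool (k \<in> A)))"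
  shows "sequence_condition (real CARD('n)) r q s"
proof -
  let ?J = "\<lambda>k. japanese (lattice_pt k :: real ^ 'n)"
  let ?d = "real CARD('n)"
  show ?thesis
  proof (cases "r \<le> q")
    case True
    have K: "?J k powr s \<le> max K 0" for k
    proof -
      have "ennreal (?J k powr s) * ennreal (1 * of_bool (k \<in> {k})) \<le>
          Lp_norm (count_space UNIV) q (\<lambda>j. ennreal (?J j powr s) * ennreal (1 * of_bool (j \<in> {k})))"
        by (rule Lp_norm_count_ge[OF q, where f="\<lambda>j. ennreal (?J j powr s) * ennreal (1 * of_bool (j \<in> {k}))"])
      also have "\<dots> \<le> ennreal K * Lp_norm (count_space UNIV) r (\<lambda>j. ennreal (1 * of_bool (j \<in> {k})))"
        by (rule emb[of "{k}" "\<lambda>_. 1"]) auto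
      also have "\<dots> \<le> ennreal K * 1"
      proof (rule mult_left_mono)
        show "Lp_norm (count_space UNIV) r (\<lambda>j. ennreal (1 * of_bool (j \<in> {k}))) \<le> 1"
          using r
        proof (cases rule: ereal_pos_cases)
          case (fin R)
          show ?thesis
            unfolding fin(1) Lp_norm_ereal
            by (subst nn_integral_count_space_supported) (auto simp: ennreal_powr_ennreal[of 1, simplified])
        qed (auto simp: Lp_norm_count_infty intro!: SUP_least)
      qed simp
      finally have "ennreal (?J k powr s) \<le> ennreal K" by simp
      then show ?thesis by (cases "0 \<le> K") (auto simp: ennreal_neg)
    qed
    have "s \<le> 0"
    proof (rule ccontr)
      assume "\<not> s \<le> 0"
      then have s: "0 < s" by simp
      obtain n :: nat where n: "(max K 0) powr (1 / s) < real n" using reals_Archimedean2 by blast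
      define k :: "int ^ 'n" where "k = (\<chi> i. int n)"
      obtain i0 :: 'n where True by simp
      have "real n = \<bar>(lattice_pt k :: real ^ 'n) $ i0\<bar>" by (simp add: k_def)
      also have "\<dots> \<le> norm (lattice_pt k :: real ^ 'n)" by (rule component_le_norm_cart)
      also have "\<dots> \<le> ?J k" by (rule norm_le_japanese)
      finally have "real n powr s \<le> ?J k powr s" using s by (intro powr_mono2) auto
      also have "\<dots> \<le> max K 0" by (rule K)
      finally have "(real n powr s) powr (1 / s) \<le> (max K 0) powr (1 / s)" using s by (intro powr_mono2) auto
      then show False using n s by (simp add: powr_powr)
    qed
    then show ?thesis using True by (simp add: sequence_condition_def)
  next
    case False
    then have qr: "q < r" by simp
    obtain Q where Q: "q = ereal Q" "0 < Q" using q qr by (cases q) auto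
    \<comment> \<open>1/r as a real number, with value 0 for infinite \<open>r\<close>; in that case
      the sequence \<open>a\<close> is constantly 1.\<close>
    define \<rho> where "\<rho> = (case r of ereal R \<Rightarrow> 1 / R | _ \<Rightarrow> 0)"
    have \<rho>: "0 \<le> \<rho>" "\<rho> < 1 / Q" and dr: "ereal ?d / r = ereal (?d * \<rho>)"
      using qr r Q by (cases r; auto simp: \<rho>_def frac_less2)+
    have "s + ?d / Q < ?d * \<rho>"
    proof (rule ccontr)
      assume "\<not> ?thesis"
      then have ge: "?d * \<rho> \<le> s + ?d / Q" by simp
      \<comment> \<open>The failure of the strict inequality, equality included, in the form that
        the summands require: it gives (\<langle>k\<rangle>^s a_k)^Q \<ge> \<langle>k\<rangle>^(-d),
        because \<langle>k\<rangle> \<ge> 1.\<close>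
      have exp_ge: "- ?d \<le> (s - ?d * \<rho>) * Q"
      proof -
        have "- (?d / Q) \<le> s - ?d * \<rho>" using ge by simp
        from mult_right_mono[OF this, of Q] show ?thesis using Q by simp
      qed
      define a where "a k = ?J k powr - (?d * \<rho>)" for k
      have bound: "(\<Sum>k\<in>A. ?J k powr - ?d) powr (1 / Q - \<rho>) \<le> max K 0" if A: "finite A" for A
      proof -
        define S where "S = (\<Sum>k\<in>A. ?J k powr - ?d)"
        have S0: "0 \<le> S" unfolding S_def by (intro sum_nonneg) auto
        show ?thesis
        proof (cases "S = 0")
          case True
          then show ?thesis using \<rho> by (simp add: S_def)
        next
          case False
          then have S: "0 < S" using S0 by simp
          have "ennreal (S powr (1 / Q)) \<le> Lp_norm (count_space UNIV) q (\<lambda>k. ennreal (?J k powr s) *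
              ennreal (a k * of_bool (k \<in> A)))"
          proof -
            have "ennreal S \<le> (\<Sum>k\<in>A. ennreal_powr (ennreal (?J k powr s * a k)) Q)"
            proof -
              have "?J k powr - ?d \<le> (?J k powr s * a k) powr Q" for k
              proof -
                have "?J k powr - ?d \<le> ?J k powr ((s - ?d * \<rho>) * Q)"
                  by (rule powr_mono[OF exp_ge japanese_ge_1])
                also have "\<dots> = (?J k powr s * a k) powr Q"
                  by (simp add: a_def powr_add[symmetric] powr_powr)
                finally show ?thesis .
              qed
              then have "S \<le> (\<Sum>k\<in>A. (?J k powr s * a k) powr Q)" unfolding S_def by (intro sum_mono)
              then show ?thesis
                by (simp add: ennreal_powr_ennreal a_def sum_ennreal ennreal_leI)
            qed
            also have "\<dots> = (\<integral>\<^sup>+k. ennreal_powr (ennreal ((?J k powr s * a k) * of_bool (k \<in> A))) Q \<partial>count_space UNIV)"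
              by (rule nn_integral_count_space_supported[OF A, symmetric])
            also have "\<dots> = (\<integral>\<^sup>+k. ennreal_powr (ennreal (?J k powr s) * ennreal (a k * of_bool (k \<in> A))) Q \<partial>count_space UNIV)"
              by (intro nn_integral_cong arg_cong2[where f=ennreal_powr] refl)
                (simp add: ennreal_mult[symmetric] a_def mult.assoc)
            finally have "ennreal_powr (ennreal S) (1 / Q) \<le> Lp_norm (count_space UNIV) q (\<lambda>k. ennreal (?J k powr s) *
              ennreal (a k * of_bool (k \<in> A)))"
              unfolding Q(1) Lp_norm_ereal using Q by (intro ennreal_powr_mono) auto
            then show ?thesis using S by (simp add: ennreal_powr_ennreal)
          qed
          also have "\<dots> \<le> ennreal K * Lp_norm (count_space UNIV) r (\<lambda>k. ennreal (a k * of_bool (k \<in> A)))"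
            by (rule emb[OF A]) (simp add: a_def)
          also have "\<dots> \<le> ennreal K * ennreal (S powr \<rho>)"
          proof (rule mult_left_mono)
            show "Lp_norm (count_space UNIV) r (\<lambda>k. ennreal (a k * of_bool (k \<in> A))) \<le> ennreal (S powr \<rho>)"
            proof (cases r)
              case (real R)
              then have R: "0 < R" using r by simp
              have "(\<Sum>k\<in>A. ennreal_powr (ennreal (a k)) R) = ennreal S"
                using R by (simp add: S_def ennreal_powr_ennreal a_def powr_powr \<rho>_def real sum_ennreal)
              then show ?thesis
                unfolding real Lp_norm_ereal nn_integral_count_space_supported[OF A]
                using S by (simp add: ennreal_powr_ennreal \<rho>_def real)
            next
              case PInf
              have "ennreal (a k * of_bool (k \<in> A)) \<le> 1" for k
                by (auto simp: a_def \<rho>_def PInf)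
              then show ?thesis
                unfolding PInf Lp_norm_count_infty using S by (simp add: \<rho>_def PInf SUP_least)
            qed (use r in auto)
          qed simp
          also have "\<dots> \<le> ennreal (max K 0 * S powr \<rho>)"
            by (simp add: ennreal_mult' mult_right_mono ennreal_leI)
          finally have "S powr (1 / Q) \<le> max K 0 * S powr \<rho>" by (subst (asm) ennreal_le_iff) auto
          moreover have "S powr (1 / Q) = S powr (1 / Q - \<rho>) * S powr \<rho>" by (simp add: powr_add[symmetric])
          ultimately show ?thesis using S by (simp add: S_def[symmetric])
        qed
      qed
      define e where "e = 1 / Q - \<rho>"
      have e: "0 < e" using \<rho> by (simp add: e_def)
      obtain A :: "(int ^ 'n) set" where A: "finite A" "(max K 0) powr (1 / e) < (\<Sum>k\<in>A. ?J k powr - ?d)"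
        using lattice_sum_unbounded by metis
      have "((\<Sum>k\<in>A. ?J k powr - ?d) powr e) powr (1 / e) \<le> (max K 0) powr (1 / e)"
        using bound[OF A(1)] e by (intro powr_mono2) (auto simp: e_def)
      then show False using A(2) e by (simp add: powr_powr sum_nonneg)
    qed
    then have "ereal s + ereal ?d / q < ereal ?d / r" unfolding dr using Q by simp
    then show ?thesis using qr by (simp add: sequence_condition_def)
  qed
qed

section \<open>Dilations, modulations and lattice translates\<close>

lemma inv_fourier_reflect:
  fixes h :: "real ^ 'n::finite \<Rightarrow> complex"
  assumes [measurable]: "h \<in> borel_measurable borel"
  shows "inv_fourier h = fourier (\<lambda>\<xi>. h (- \<xi>))"
proof
  fix x :: "real ^ 'n"
  have "inv_fourier h x = \<bar>- 1 :: real\<bar> ^ DIM(real ^ 'n) *\<^sub>R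
      (\<integral>\<xi>. cis (2 * pi * (x \<bullet> (0 + (- 1) *\<^sub>R \<xi>))) * h (0 + (- 1) *\<^sub>R \<xi>) \<partial>lborel)"
    unfolding inv_fourier_def
    by (rule lborel_integral_affine[where f="\<lambda>\<xi>. cis (2 * pi * (x \<bullet> \<xi>)) * h \<xi>"]) auto
  then show "inv_fourier h x = fourier (\<lambda>\<xi>. h (- \<xi>)) x"
    by (simp add: fourier_def inner_commute)
qed

lemma schwartz_inv_fourier:
  fixes h :: "real ^ 'n::finite \<Rightarrow> complex"
  assumes "test_fun h" shows "schwartz (inv_fourier h)"
  unfolding inv_fourier_reflect[OF test_fun_measurable[OF assms]]
  using schwartz_fourier[OF test_fun_affine[OF assms, of "- 1" 0]] by simp

lemma inv_fourier_dilate: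
  fixes h :: "real ^ 'n::finite \<Rightarrow> complex"
  assumes [measurable]: "h \<in> borel_measurable borel" and c: "0 < c"
  shows "inv_fourier (\<lambda>\<xi>. h (c *\<^sub>R \<xi>)) x = of_real ((1 / c) ^ CARD('n)) * inv_fourier h ((1 / c) *\<^sub>R x)"
proof -
  have "inv_fourier (\<lambda>\<xi>. h (c *\<^sub>R \<xi>)) x = \<bar>1 / c\<bar> ^ DIM(real ^ 'n) *\<^sub>R
      (\<integral>\<xi>. cis (2 * pi * (x \<bullet> (0 + (1 / c) *\<^sub>R \<xi>))) * h (c *\<^sub>R (0 + (1 / c) *\<^sub>R \<xi>)) \<partial>lborel)"
    unfolding inv_fourier_def
    by (rule lborel_integral_affine[where f="\<lambda>\<xi>. cis (2 * pi * (x \<bullet> \<xi>)) * h (c *\<^sub>R \<xi>)"]) (use c in auto)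
  then show ?thesis using c by (simp add: inv_fourier_def scaleR_conv_of_real[where 'a=complex])
qed

text \<open>A character on the frequency side becomes a translation by \<open>t\<close> in space;
  this is how atoms are positioned.\<close>

lemma cmod_inv_fourier_modulate:
  "cmod (inv_fourier (\<lambda>\<xi>. of_real a * (cis (- (2 * pi * (\<xi> \<bullet> t))) * h \<xi>)) x) = \<bar>a\<bar> * cmod (inv_fourier h (x - t))"
proof -
  have "inv_fourier (\<lambda>\<xi>. of_real a * (cis (- (2 * pi * (\<xi> \<bullet> t))) * h \<xi>)) x =
      (\<integral>\<xi>. of_real a * (cis (2 * pi * ((x - t) \<bullet> \<xi>)) * h \<xi>) \<partial>lborel)"
  proof -
    have "cis (2 * pi * (x \<bullet> \<xi>)) * (of_real a * (cis (- (2 * pi * (\<xi> \<bullet> t))) * h \<xi>)) =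
        of_real a * ((cis (2 * pi * (x \<bullet> \<xi>)) * cis (- (2 * pi * (\<xi> \<bullet> t)))) * h \<xi>)" for \<xi>
      by (simp only: mult_ac)
    moreover have "cis (2 * pi * (x \<bullet> \<xi>)) * cis (- (2 * pi * (\<xi> \<bullet> t))) = cis (2 * pi * ((x - t) \<bullet> \<xi>))" for \<xi>
      by (simp add: cis_mult inner_diff_left right_diff_distrib inner_commute[of \<xi> t])
    ultimately have "cis (2 * pi * (x \<bullet> \<xi>)) * (of_real a * (cis (- (2 * pi * (\<xi> \<bullet> t))) * h \<xi>)) =
        of_real a * (cis (2 * pi * ((x - t) \<bullet> \<xi>)) * h \<xi>)" for \<xi>
      by (simp only:)
    then show ?thesis by (simp only: inv_fourier_def)
  qed
  then show ?thesis by (simp add: inv_fourier_def norm_mult)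
qed

text \<open>The bound is uniform in x because, with m the integer part of x, decay in x - k becomes
  decay in k - m, and reindexing by k - m removes x from the sum.\<close>

lemma lattice_translates_bound:
  fixes \<gamma> :: "real ^ 'n::finite \<Rightarrow> complex"
  assumes \<gamma>: "schwartz \<gamma>" and Q: "0 < Q"
  obtains S where "1 \<le> S" "\<And>x A. finite A \<Longrightarrow> (\<Sum>k\<in>A. cmod (\<gamma> (x - lattice_pt k)) powr Q) \<le> S"
proof -
  let ?d = "real CARD('n)"
  \<comment> \<open>The lattice sum of \<langle>k\<rangle>^(-N Q) converges for N Q > d; the 1 makes
    the inequality strict.\<close>
  define N where "N = nat \<lceil>?d / Q\<rceil> + 1"
  have "?d / Q < real N" unfolding N_def by linarith
  then have N: "?d < real N * Q" using Q by (simp add: pos_divide_less_eq)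
  obtain C where C: "0 \<le> C" "\<And>x. japanese x ^ N * cmod (\<gamma> x) \<le> C"
    using schwartz_decay[OF \<gamma>, of N "[]"] by (metis iter_partial_Nil)
  obtain S0 where S0: "0 \<le> S0"
    "(\<integral>\<^sup>+k. ennreal (japanese (lattice_pt k :: real ^ 'n) powr - (real N * Q)) \<partial>count_space UNIV) = ennreal S0"
    using lattice_sum_finite[OF N] by blast
  have fin_sum: "(\<Sum>k\<in>A. japanese (lattice_pt k :: real ^ 'n) powr - (real N * Q)) \<le> S0" if A: "finite A" for A
  proof -
    let ?f = "\<lambda>k. ennreal (japanese (lattice_pt k :: real ^ 'n) powr - (real N * Q))"
    have "ennreal (\<Sum>k\<in>A. japanese (lattice_pt k :: real ^ 'n) powr - (real N * Q)) =
        (\<integral>\<^sup>+k. ?f k * indicator A k \<partial>count_space UNIV)"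
      using A by (subst nn_integral_count_space'[of A]) (auto simp: sum_ennreal)
    also have "\<dots> \<le> (\<integral>\<^sup>+k. ?f k \<partial>count_space UNIV)"
      by (intro nn_integral_mono) (auto split: split_indicator)
    finally show ?thesis unfolding S0(2) using S0(1) by (simp add: ennreal_le_iff)
  qed
  \<comment> \<open>The factor 2 comes from \<open>japanese_add\<close>, and 1 + d bounds
    \<langle>y\<rangle> for the fractional part \<open>y\<close> of x.\<close>
  define c where "c = 2 * (1 + ?d)"
  have c: "0 < c" by (simp add: c_def add_pos_nonneg)
  define S where "S = C powr Q * c powr (real N * Q) * S0"
  have "(\<Sum>k\<in>A. cmod (\<gamma> (x - lattice_pt k)) powr Q) \<le> S" if A: "finite A" for x A
  proof -
    define m :: "int ^ 'n" where "m = (\<chi> i. \<lfloor>x $ i\<rfloor>)"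
    define y where "y = x - lattice_pt m"
    have "(\<Sum>i\<in>UNIV. \<bar>y $ i\<bar>) \<le> (\<Sum>i\<in>(UNIV :: 'n set). 1)"
    proof (rule sum_mono)
      fix i
      have "y $ i = x $ i - of_int \<lfloor>x $ i\<rfloor>" by (simp add: y_def m_def)
      then show "\<bar>y $ i\<bar> \<le> 1" by linarith
    qed
    then have ny: "norm y \<le> ?d" using norm_le_l1_cart[of y] by simp
    have "(japanese y)\<^sup>2 \<le> (1 + norm y)\<^sup>2" by (simp add: japanese_squared power2_sum)
    then have "japanese y \<le> 1 + norm y" by (rule power2_le_imp_le) simp
    then have jy: "japanese y \<le> 1 + ?d" using ny by linarith
    have pt: "cmod (\<gamma> (x - lattice_pt k)) powr Q \<le>
        C powr Q * c powr (real N * Q) * japanese (lattice_pt (k - m) :: real ^ 'n) powr - (real N * Q)" for k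
    proof -
      let ?z = "x - lattice_pt k" and ?w = "lattice_pt (k - m) :: real ^ 'n"
      have "?w = - ?z + y" by (simp add: y_def vec_eq_iff)
      then have "japanese ?w \<le> 2 * japanese (- ?z) * japanese y" by (simp only: japanese_add)
      also have "\<dots> \<le> 2 * japanese ?z * (1 + ?d)" unfolding japanese_minus using jy by (intro mult_left_mono) auto
      finally have "japanese ?w \<le> c * japanese ?z" by (simp add: c_def algebra_simps)
      then have "japanese ?w powr (real N * Q) \<le> (c * japanese ?z) powr (real N * Q)"
        using Q by (intro powr_mono2) auto
      also have "\<dots> = c powr (real N * Q) * japanese ?z powr (real N * Q)" using c by (simp add: powr_mult)
      finally have 1: "japanese ?w powr (real N * Q) \<le> c powr (real N * Q) * japanese ?z powr (real N * Q)" .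
      have "(japanese ?z ^ N * cmod (\<gamma> ?z)) powr Q \<le> C powr Q" using C Q by (intro powr_mono2) auto
      then have 2: "japanese ?z powr (real N * Q) * cmod (\<gamma> ?z) powr Q \<le> C powr Q"
        by (simp add: powr_mult powr_realpow[symmetric] powr_powr)
      have "japanese ?w powr (real N * Q) * cmod (\<gamma> ?z) powr Q \<le>
          c powr (real N * Q) * (japanese ?z powr (real N * Q) * cmod (\<gamma> ?z) powr Q)"
        using mult_right_mono[OF 1, of "cmod (\<gamma> ?z) powr Q"] by (simp add: mult.assoc)
      also have "\<dots> \<le> c powr (real N * Q) * C powr Q" using 2 by (intro mult_left_mono) auto
      finally show ?thesis by (simp add: powr_minus field_simps)
    qed
    have "(\<Sum>k\<in>A. cmod (\<gamma> (x - lattice_pt k)) powr Q) \<le>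
        (\<Sum>k\<in>A. C powr Q * c powr (real N * Q) * japanese (lattice_pt (k - m) :: real ^ 'n) powr - (real N * Q))"
      by (intro sum_mono pt)
    also have "\<dots> = C powr Q * c powr (real N * Q) *
        (\<Sum>k\<in>(\<lambda>k. k - m) ` A. japanese (lattice_pt k :: real ^ 'n) powr - (real N * Q))"
      by (subst sum.reindex) (auto simp: inj_on_def sum_distrib_left)
    also have "\<dots> \<le> S" unfolding S_def using A by (intro mult_left_mono fin_sum) auto
    finally show ?thesis .
  qed
  then show ?thesis using that[of "max 1 S"] by (meson max.cobounded1 max.coboundedI2)
qed

lemma sequence_norm_finite:
  assumes A: "finite A" and a: "\<And>k. 0 \<le> a k" and r: "0 < r"
  shows "Lp_norm (count_space UNIV) r (\<lambda>k. ennreal (a k * of_bool (k \<in> A))) < \<top>"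
  using r
proof (cases rule: ereal_pos_cases)
  case (fin R)
  have "(\<Sum>k\<in>A. ennreal_powr (ennreal (a k)) R) = ennreal (\<Sum>k\<in>A. a k powr R)"
    using a by (simp add: ennreal_powr_ennreal sum_ennreal)
  then show ?thesis
    unfolding fin(1) Lp_norm_ereal nn_integral_count_space_supported[OF A]
    by (simp add: ennreal_powr_ennreal sum_nonneg)
next
  case inf
  have "ennreal (a k * of_bool (k \<in> A)) \<le> ennreal (\<Sum>k\<in>A. a k)" for k
    using A a by (auto intro!: ennreal_leI member_le_sum sum_nonneg)
  then have "(SUP k. ennreal (a k * of_bool (k \<in> A))) \<le> ennreal (\<Sum>k\<in>A. a k)" by (intro SUP_least)
  then show ?thesis unfolding inf Lp_norm_count_infty by (rule le_less_trans) simp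
qed

text \<open>The weights w_k = |\<gamma>(x - k)|^Q have sum at most S for each x and a common
  integral over x. Hoelder's inequality with exponent c = P/Q relative to these weights bounds (sum
  of a_k^Q w_k)^c by S^(c - 1) times the sum of a_k^P w_k, and integration leaves the l^P norm. For
  infinite p the supremum of \<open>a\<close> is pulled out directly.\<close>

lemma translates_amalgam_bound:
  fixes \<gamma> :: "real ^ 'n::finite \<Rightarrow> complex"
  assumes \<gamma>: "schwartz \<gamma>" and Q: "0 < Q" "ereal Q < p"
  shows "\<exists>K>0. \<forall>A a. finite A \<longrightarrow> (\<forall>k. 0 \<le> a k) \<longrightarrow>
    Lp_norm lborel p (\<lambda>x. Lp_norm (count_space UNIV) (ereal Q)
      (\<lambda>k. ennreal (a k * of_bool (k \<in> A) * cmod (\<gamma> (x - lattice_pt k))))) \<le>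
    ennreal K * Lp_norm (count_space UNIV) p (\<lambda>k. ennreal (a k * of_bool (k \<in> A)))"
proof -
  have p: "0 < p" using Q by (meson ereal_less(2) less_trans)
  have [measurable]: "\<gamma> \<in> borel_measurable borel" by (rule schwartz_measurable[OF \<gamma>])
  obtain S where S: "1 \<le> S" "\<And>x A. finite A \<Longrightarrow> (\<Sum>k\<in>A. cmod (\<gamma> (x - lattice_pt k)) powr Q) \<le> S"
    using lattice_translates_bound[OF \<gamma> Q(1)] by metis
  define w where "w k x = cmod (\<gamma> (x - lattice_pt k)) powr Q" for k x
  have w0: "0 \<le> w k x" for k x by (simp add: w_def)
  have [measurable]: "w k \<in> borel_measurable borel" for k unfolding w_def by measurable
  define V where "V A a x = (\<Sum>k\<in>A. a k powr Q * w k x)" for A a x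
  have V0: "0 \<le> V A a x" for A a x unfolding V_def using w0 by (intro sum_nonneg) auto
  have inner: "Lp_norm (count_space UNIV) (ereal Q)
      (\<lambda>k. ennreal (a k * of_bool (k \<in> A) * cmod (\<gamma> (x - lattice_pt k)))) = ennreal (V A a x powr (1 / Q))"
    if A: "finite A" and a: "\<And>k. 0 \<le> a k" for A a x
  proof -
    have "(\<integral>\<^sup>+k. ennreal_powr (ennreal (a k * of_bool (k \<in> A) * cmod (\<gamma> (x - lattice_pt k)))) Q \<partial>count_space UNIV) =
        (\<integral>\<^sup>+k. ennreal_powr (ennreal ((a k * cmod (\<gamma> (x - lattice_pt k))) * of_bool (k \<in> A))) Q \<partial>count_space UNIV)"
      by (simp add: mult_ac)
    also have "\<dots> = (\<Sum>k\<in>A. ennreal_powr (ennreal (a k * cmod (\<gamma> (x - lattice_pt k)))) Q)"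
      by (rule nn_integral_count_space_supported[OF A])
    also have "\<dots> = ennreal (V A a x)"
      using a by (simp add: ennreal_powr_ennreal sum_ennreal V_def w_def powr_mult)
    finally show ?thesis by (simp add: Lp_norm_ereal ennreal_powr_ennreal V0)
  qed
  from p show ?thesis
  proof (cases rule: ereal_pos_cases)
    case inf
    have "Lp_norm lborel p (\<lambda>x. Lp_norm (count_space UNIV) (ereal Q)
      (\<lambda>k. ennreal (a k * of_bool (k \<in> A) * cmod (\<gamma> (x - lattice_pt k))))) \<le>
      ennreal (S powr (1 / Q)) * Lp_norm (count_space UNIV) p (\<lambda>k. ennreal (a k * of_bool (k \<in> A)))"
      if A: "finite A" and a: "\<And>k. 0 \<le> a k" for A a
    proof -
      obtain n where n: "Lp_norm (count_space UNIV) p (\<lambda>k. ennreal (a k * of_bool (k \<in> A))) = ennreal n" "0 \<le> n"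
        using sequence_norm_finite[where a=a, OF A a p] unfolding less_top_ennreal by blast
      have an: "a k \<le> n" if "k \<in> A" for k
        using Lp_norm_count_ge[OF p, of "\<lambda>k. ennreal (a k * of_bool (k \<in> A))" k] that n by simp
      have "V A a x powr (1 / Q) \<le> S powr (1 / Q) * n" for x
      proof -
        have "V A a x \<le> (\<Sum>k\<in>A. n powr Q * w k x)"
          unfolding V_def using an a w0 Q by (intro sum_mono mult_right_mono powr_mono2) auto
        also have "\<dots> \<le> n powr Q * S"
          using S(2)[OF A, of x] by (simp add: sum_distrib_left[symmetric] w_def mult_left_mono)
        finally have "V A a x powr (1 / Q) \<le> (n powr Q * S) powr (1 / Q)"
          using V0 Q by (intro powr_mono2) auto
        then show ?thesis using n S(1) Q by (simp add: powr_mult powr_powr mult.commute)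
      qed
      then have "ennreal (V A a x powr (1 / Q)) \<le> ennreal (S powr (1 / Q) * n)" for x by (rule ennreal_leI)
      then have "esssup lborel (\<lambda>x. ennreal (V A a x powr (1 / Q))) \<le> ennreal (S powr (1 / Q) * n)"
        by (intro esssup_I) (auto simp: V_def)
      then show ?thesis unfolding inner[OF A a] n(1) using n(2) by (simp add: inf Lp_norm_infty ennreal_mult)
    qed
    then show ?thesis using S(1) by (intro exI[of _ "S powr (1 / Q)"]) auto
  next
    case (fin P)
    define c where "c = P / Q"
    have c: "1 < c" "Q * c = P" using fin Q by (auto simp: c_def)
    obtain G where G: "(\<integral>\<^sup>+x. ennreal (cmod (\<gamma> x) powr Q) \<partial>lborel) = ennreal G" "0 \<le> G"
    proof -
      have "ennreal_powr (Lp_norm lborel (ereal Q) (\<lambda>x. ennreal (cmod (\<gamma> x)))) Q < \<top>"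
        using schwartz_Lp_norm_finite[OF \<gamma>, of "ereal Q"] Q by (simp add: less_top[symmetric])
      then have "(\<integral>\<^sup>+x. ennreal (cmod (\<gamma> x) powr Q) \<partial>lborel) < \<top>"
        using Q by (simp add: Lp_norm_powr ennreal_powr_ennreal)
      then show ?thesis using that unfolding less_top_ennreal by blast
    qed
    have wG: "(\<integral>\<^sup>+x. ennreal (w k x) \<partial>lborel) = ennreal G" for k
    proof -
      have "(\<integral>\<^sup>+x. ennreal (cmod (\<gamma> (- lattice_pt k + x)) powr Q) \<partial>lborel) = ennreal G"
        unfolding G(1)[symmetric] by (rule lborel_nn_integral_shift) measurable
      then show ?thesis by (simp add: w_def)
    qed
    \<comment> \<open>The maximum with 1 keeps \<open>K\<close> positive even if \<open>G\<close>
      vanishes.\<close>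
    define K where "K = max 1 ((S powr (c - 1) * G) powr (1 / P))"
    have "Lp_norm lborel p (\<lambda>x. Lp_norm (count_space UNIV) (ereal Q)
      (\<lambda>k. ennreal (a k * of_bool (k \<in> A) * cmod (\<gamma> (x - lattice_pt k))))) \<le>
      ennreal K * Lp_norm (count_space UNIV) p (\<lambda>k. ennreal (a k * of_bool (k \<in> A)))"
      if A: "finite A" and a: "\<And>k. 0 \<le> a k" for A a
    proof -
      have pt: "V A a x powr c \<le> S powr (c - 1) * (\<Sum>k\<in>A. a k powr P * w k x)" for x
      proof -
        have e: "w k x powr ((c - 1) / c) * w k x powr (1 / c) = w k x" for k
        proof -
          have "w k x powr ((c - 1) / c) * w k x powr (1 / c) = w k x powr ((c - 1) / c + 1 / c)"
            by (simp only: powr_add)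
          also have "(c - 1) / c + 1 / c = 1" using c by (simp add: field_simps)
          finally show ?thesis using w0 by simp
        qed
        \<comment> \<open>Each weight is split as w^((c - 1)/c) w^(1/c): the first part is summed
          separately and controlled by \<open>S\<close>, the second stays with the
          coefficients.\<close>
        have "V A a x = (\<Sum>k\<in>A. (w k x powr (1 / c)) powr (c - 1) * (a k powr Q * w k x powr (1 / c)))"
          unfolding V_def
        proof (rule sum.cong[OF refl])
          fix k
          have "(w k x powr (1 / c)) powr (c - 1) * (a k powr Q * w k x powr (1 / c)) =
              a k powr Q * (w k x powr ((c - 1) / c) * w k x powr (1 / c))"
            by (simp add: powr_powr)
          then show "a k powr Q * w k x = (w k x powr (1 / c)) powr (c - 1) * (a k powr Q * w k x powr (1 / c))"
            by (simp only: e)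
        qed
        also have "\<dots> \<le> (\<Sum>k\<in>A. (w k x powr (1 / c)) powr c) powr ((c - 1) / c) *
            (\<Sum>k\<in>A. (a k powr Q * w k x powr (1 / c)) powr c) powr (1 / c)"
          by (rule holder_sum[OF A c(1)]) auto
        also have "(\<Sum>k\<in>A. (w k x powr (1 / c)) powr c) = (\<Sum>k\<in>A. w k x)"
          using c w0 by (intro sum.cong) (auto simp: powr_powr)
        also have "(\<Sum>k\<in>A. (a k powr Q * w k x powr (1 / c)) powr c) = (\<Sum>k\<in>A. a k powr P * w k x)"
          using c w0 by (intro sum.cong) (auto simp: powr_mult powr_powr)
        also have "(\<Sum>k\<in>A. w k x) powr ((c - 1) / c) * (\<Sum>k\<in>A. a k powr P * w k x) powr (1 / c) \<le>
            S powr ((c - 1) / c) * (\<Sum>k\<in>A. a k powr P * w k x) powr (1 / c)"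
          using S(2)[OF A, of x] c w0 by (intro mult_right_mono powr_mono2) (auto simp: w_def sum_nonneg)
        finally have "V A a x powr c \<le> (S powr ((c - 1) / c) * (\<Sum>k\<in>A. a k powr P * w k x) powr (1 / c)) powr c"
          using V0 c by (intro powr_mono2) auto
        also have "\<dots> = S powr (c - 1) * (\<Sum>k\<in>A. a k powr P * w k x)"
          using S(1) c w0 by (simp add: powr_mult powr_powr sum_nonneg)
        finally show ?thesis .
      qed
      have "(\<integral>\<^sup>+x. ennreal_powr (ennreal (V A a x powr (1 / Q))) P \<partial>lborel) \<le>
          (\<integral>\<^sup>+x. ennreal (S powr (c - 1)) * (\<Sum>k\<in>A. ennreal (a k powr P) * ennreal (w k x)) \<partial>lborel)"
      proof (intro nn_integral_mono)
        fix x
        have "ennreal_powr (ennreal (V A a x powr (1 / Q))) P = ennreal (V A a x powr c)"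
          by (simp add: ennreal_powr_ennreal powr_powr c_def)
        also have "\<dots> \<le> ennreal (S powr (c - 1) * (\<Sum>k\<in>A. a k powr P * w k x))" by (rule ennreal_leI[OF pt])
        also have "\<dots> = ennreal (S powr (c - 1)) * (\<Sum>k\<in>A. ennreal (a k powr P) * ennreal (w k x))"
        proof -
          have "ennreal (\<Sum>k\<in>A. a k powr P * w k x) = (\<Sum>k\<in>A. ennreal (a k powr P) * ennreal (w k x))"
            by (subst sum_ennreal[symmetric]) (use w0 in \<open>auto simp: ennreal_mult\<close>)
          then show ?thesis using w0 by (simp only: ennreal_mult' powr_ge_zero)
        qed
        finally show "ennreal_powr (ennreal (V A a x powr (1 / Q))) P \<le>
            ennreal (S powr (c - 1)) * (\<Sum>k\<in>A. ennreal (a k powr P) * ennreal (w k x))" .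
      qed
      also have "\<dots> = ennreal (S powr (c - 1)) * (\<Sum>k\<in>A. ennreal (a k powr P) * ennreal G)"
        by (simp add: nn_integral_cmult nn_integral_sum wG)
      also have "\<dots> = ennreal (S powr (c - 1) * G) * (\<Sum>k\<in>A. ennreal_powr (ennreal (a k)) P)"
      proof -
        have "(\<Sum>k\<in>A. ennreal (a k powr P) * ennreal G) = ennreal G * (\<Sum>k\<in>A. ennreal_powr (ennreal (a k)) P)"
          using a by (simp add: ennreal_powr_ennreal sum_distrib_left mult.commute del: sum_ennreal)
        then show ?thesis using G(2) by (simp only: ennreal_mult powr_ge_zero mult.assoc)
      qed
      also have "\<dots> \<le> ennreal_powr (ennreal K) P * (\<Sum>k\<in>A. ennreal_powr (ennreal (a k)) P)"
      proof (rule mult_right_mono)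
        have "((S powr (c - 1) * G) powr (1 / P)) powr P \<le> K powr P"
          using fin by (intro powr_mono2) (auto simp: K_def)
        then have "S powr (c - 1) * G \<le> K powr P" using fin G by (simp add: powr_powr)
        then show "ennreal (S powr (c - 1) * G) \<le> ennreal_powr (ennreal K) P"
          by (simp add: ennreal_powr_ennreal K_def ennreal_leI)
      qed simp
      also have "\<dots> = ennreal_powr (ennreal K * Lp_norm (count_space UNIV) p (\<lambda>k. ennreal (a k * of_bool (k \<in> A)))) P"
        using fin by (simp add: ennreal_powr_mult Lp_norm_powr nn_integral_count_space_supported[OF A])
      finally show ?thesis
        unfolding inner[OF A a] using fin by (simp add: Lp_norm_le_iff)
    qed
    then show ?thesis by (intro exI[of _ K]) (auto simp: K_def)
  qed
qed

section \<open>Consequences of an assumed embedding\<close>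

context
  fixes \<sigma> :: "real ^ 'n::finite \<Rightarrow> complex" and p q p\<^sub>1 q\<^sub>1 :: ereal and s :: real
  assumes \<sigma>: "decomposition_window \<sigma>" and pos: "0 < p" "0 < q" "0 < p\<^sub>1" "0 < q\<^sub>1"
    and embedded: "continuously_embedded (amalgam_space \<sigma> p q 0) (amalgam_norm \<sigma> p q 0)
      (modulation_space \<sigma> p\<^sub>1 q\<^sub>1 s) (modulation_norm \<sigma> p\<^sub>1 q\<^sub>1 s)"
begin

text \<open>The factor 4 shrinks the support from |\<xi>_i| \<le> 3/4 to |\<xi>_i| \<le> 3/16,
  inside the cube |\<xi>_i| < 1/4 where the window is 1 and its other translates vanish.\<close>

definition bump :: "real ^ 'n \<Rightarrow> complex" where
  "bump \<xi> = \<sigma> (4 *\<^sub>R \<xi>)"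

lemma test_fun_bump: "test_fun bump"
  unfolding bump_def[abs_def] using test_fun_affine[OF test_fun_window[OF \<sigma>], of 4 0] by simp

lemma bump_support: "bump \<xi> \<noteq> 0 \<Longrightarrow> \<bar>\<xi> $ i\<bar> < 1 / 4"
  using window_support[OF \<sigma>, of "4 *\<^sub>R \<xi>" i] unfolding bump_def by (cases "\<bar>\<xi> $ i\<bar> < 1 / 4") (auto simp: abs_mult)

abbreviation "atom \<equiv> inv_fourier bump"

lemma schwartz_atom: "schwartz atom"
  by (rule schwartz_inv_fourier[OF test_fun_bump])

lemma atom_measurable [measurable]: "atom \<in> borel_measurable borel"
  by (rule schwartz_measurable[OF schwartz_atom])

text \<open>By Fourier inversion a vanishing atom would force \<open>bump\<close> to vanish, but its
  value at 0 is that of the window, namely 1.\<close>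

lemma atom_nonzero: "\<exists>x. atom x \<noteq> 0"
proof (rule ccontr)
  assume "\<not> ?thesis"
  then have z: "inv_fourier bump x = 0" for x by simp
  have "fourier bump x = 0" for x using z[of "- x"] by (simp add: inv_fourier_eq)
  then have "inv_fourier (fourier bump) 0 = 0" by (simp add: inv_fourier_def)
  then show False by (simp add: fourier_inversion[OF test_fun_bump] bump_def window_zero[OF \<sigma>])
qed

lemma atom_norm:
  assumes "0 < r" obtains g where "0 < g" "Lp_norm lborel r (\<lambda>x. ennreal (cmod (atom x))) = ennreal g"
proof -
  obtain x where "atom x \<noteq> 0" using atom_nonzero by blast
  then have "0 < Lp_norm lborel r (\<lambda>x. ennreal (cmod (atom x)))"
    by (intro continuous_Lp_norm_pos smooth_continuous_on schwartz_smooth schwartz_atom assms)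
  moreover have "Lp_norm lborel r (\<lambda>x. ennreal (cmod (atom x))) < \<top>"
    by (rule schwartz_Lp_norm_finite[OF schwartz_atom assms])
  ultimately show ?thesis using that
    by (cases "Lp_norm lborel r (\<lambda>x. ennreal (cmod (atom x)))") (auto simp: ennreal_less_zero_iff)
qed

text \<open>The real constant in \<open>continuously_embedded\<close> may be negative; its maximum
  with 1 is positive and still admissible.\<close>

lemma embedding_constant:
  obtains C where "0 < C" "\<And>u. tempered u \<Longrightarrow> amalgam_norm \<sigma> p q 0 u < \<top> \<Longrightarrow>
    modulation_norm \<sigma> p\<^sub>1 q\<^sub>1 s u \<le> ennreal C * amalgam_norm \<sigma> p q 0 u"
proof -
  obtain C where C: "\<And>u. u \<in> amalgam_space \<sigma> p q 0 \<Longrightarrow>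
      modulation_norm \<sigma> p\<^sub>1 q\<^sub>1 s u \<le> ennreal C * amalgam_norm \<sigma> p q 0 u"
    using embedded unfolding continuously_embedded_def by blast
  have "modulation_norm \<sigma> p\<^sub>1 q\<^sub>1 s u \<le> ennreal (max 1 C) * amalgam_norm \<sigma> p q 0 u"
    if "tempered u" "amalgam_norm \<sigma> p q 0 u < \<top>" for u
  proof -
    have "modulation_norm \<sigma> p\<^sub>1 q\<^sub>1 s u \<le> ennreal C * amalgam_norm \<sigma> p q 0 u"
      using that by (intro C) (simp add: amalgam_space_def)
    also have "\<dots> \<le> ennreal (max 1 C) * amalgam_norm \<sigma> p q 0 u"
      by (intro mult_right_mono ennreal_leI) auto
    finally show ?thesis .
  qed
  then show ?thesis using that[of "max 1 C"] by simp
qed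

text \<open>The point \<open>t k\<close> is where the k-th atom sits. Since L^(p_1) norms are
  translation invariant, it does not affect the lower bound of the modulation norm by a multiple of
  the weighted l^(q_1) norm of the coefficients. So \<open>t\<close> may be chosen to make the
  amalgam norm small, and hypothesis \<open>W\<close> measures the outcome by an l^r norm.\<close>

lemma sequence_test:
  fixes t :: "int ^ 'n \<Rightarrow> real ^ 'n"
  assumes W: "\<And>A a. finite A \<Longrightarrow> (\<And>k. 0 \<le> a k) \<Longrightarrow>
    Lp_norm lborel p (\<lambda>x. Lp_norm (count_space UNIV) q
      (\<lambda>k. ennreal (a k * of_bool (k \<in> A) * cmod (atom (x - t k))))) \<le>
    ennreal K * Lp_norm (count_space UNIV) r (\<lambda>k. ennreal (a k * of_bool (k \<in> A)))"
    and K: "0 < K" and r: "0 < r"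
  shows "sequence_condition (real CARD('n)) r q\<^sub>1 s"
proof -
  obtain C where C: "0 < C" "\<And>u. tempered u \<Longrightarrow> amalgam_norm \<sigma> p q 0 u < \<top> \<Longrightarrow>
    modulation_norm \<sigma> p\<^sub>1 q\<^sub>1 s u \<le> ennreal C * amalgam_norm \<sigma> p q 0 u"
    using embedding_constant by metis
  obtain g where g: "0 < g" "Lp_norm lborel p\<^sub>1 (\<lambda>x. ennreal (cmod (atom x))) = ennreal g"
    using atom_norm[OF pos(3)] by metis
  show ?thesis
  proof (rule sequence_condition_necessary[OF r pos(4)])
    fix A :: "(int ^ 'n) set" and a :: "int ^ 'n \<Rightarrow> real" assume A: "finite A" and a: "\<And>k. 0 \<le> a k"
    let ?b = "\<lambda>k. a k * of_bool (k \<in> A)" and ?w = "\<lambda>k. japanese (lattice_pt k :: real ^ 'n) powr s"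
    let ?L = "Lp_norm (count_space UNIV) q\<^sub>1 (\<lambda>k. ennreal (?w k) * ennreal (?b k))"
    let ?R = "Lp_norm (count_space UNIV) r (\<lambda>k. ennreal (?b k))"
    define \<eta> where "\<eta> k \<xi> = of_real (a k) * (cis (- (2 * pi * (\<xi> \<bullet> t k))) * bump \<xi>)" for k \<xi>
    have "test_fun (\<eta> k)" for k
      unfolding \<eta>_def[abs_def] by (intro test_fun_mult test_fun_bump) auto
    moreover have "\<bar>\<xi> $ i\<bar> < 1 / 4" if "\<eta> k \<xi> \<noteq> 0" for k \<xi> i
      using that by (intro bump_support) (auto simp: \<eta>_def)
    ultimately obtain u where u: "tempered u"
      "\<And>k x. cmod (box_fun \<sigma> k u x) = (if k \<in> A then cmod (inv_fourier (\<eta> k) x) else 0)"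
      using exists_block_distribution[OF \<sigma> A, of \<eta>] by blast
    have box: "cmod (box_fun \<sigma> k u x) = ?b k * cmod (atom (x - t k))" for k x
      using a[of k] by (simp add: u(2) \<eta>_def[abs_def] cmod_inv_fourier_modulate)
    have Wn: "amalgam_norm \<sigma> p q 0 u \<le> ennreal K * ?R"
      unfolding amalgam_norm_0 box by (rule W[OF A a])
    \<comment> \<open>The embedding inequality is available only for members of the amalgam space,
      hence the finiteness check.\<close>
    have "ennreal K * ?R < \<top>" using sequence_norm_finite[where a=a, OF A a r] by (simp add: ennreal_mult_less_top)
    then have Wfin: "amalgam_norm \<sigma> p q 0 u < \<top>" using Wn by (rule le_less_trans[rotated])
    have "ennreal g * ?L \<le> Lp_norm (count_space UNIV) q\<^sub>1 (\<lambda>k. ennreal g * (ennreal (?w k) * ennreal (?b k)))"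
      using g by (intro Lp_norm_cmult_ge pos) auto
    also have "\<dots> \<le> modulation_norm \<sigma> p\<^sub>1 q\<^sub>1 s u"
      unfolding modulation_norm_def
    proof (intro Lp_norm_mono pos)
      fix k
      have "ennreal (?b k) * ennreal g \<le> ennreal (?b k) * Lp_norm lborel p\<^sub>1 (\<lambda>x. ennreal (cmod (atom (- t k + x))))"
        unfolding g(2)[symmetric] by (intro mult_left_mono Lp_norm_shift_ge pos) auto
      also have "\<dots> \<le> Lp_norm lborel p\<^sub>1 (\<lambda>x. ennreal (?b k) * ennreal (cmod (atom (- t k + x))))"
        using a[of k] by (intro Lp_norm_cmult_ge pos) auto
      also have "\<dots> = Lp_norm lborel p\<^sub>1 (\<lambda>x. ennreal (cmod (box_fun \<sigma> k u x)))"
        using a[of k] by (simp add: box ennreal_mult)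
      finally have "ennreal (?w k) * (ennreal (?b k) * ennreal g) \<le>
          ennreal (?w k) * Lp_norm lborel p\<^sub>1 (\<lambda>x. ennreal (cmod (box_fun \<sigma> k u x)))"
        by (rule mult_left_mono) simp
      then show "ennreal g * (ennreal (?w k) * ennreal (?b k)) \<le>
          ennreal (?w k) * Lp_norm lborel p\<^sub>1 (\<lambda>x. ennreal (cmod (box_fun \<sigma> k u x)))"
        by (simp add: mult_ac)
    qed auto
    also have "\<dots> \<le> ennreal C * (ennreal K * ?R)"
      using C(2)[OF u(1) Wfin] mult_left_mono[OF Wn, of "ennreal C"] by (meson order_trans zero_le)
    finally have "ennreal (1 / g) * (ennreal g * ?L) \<le> ennreal (1 / g) * (ennreal C * (ennreal K * ?R))"
      by (rule mult_left_mono) simp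
    moreover have "ennreal (1 / g) * (ennreal g * ?L) = ?L"
      using g by (simp add: mult.assoc[symmetric] ennreal_mult[symmetric])
    moreover have "ennreal (1 / g) * (ennreal C * (ennreal K * ?R)) = ennreal (1 / g * C * K) * ?R"
      using g C K by (simp add: mult.assoc[symmetric] ennreal_mult[symmetric])
    ultimately show "?L \<le> ennreal (1 / g * C * K) * ?R" by simp
  qed
qed

text \<open>With all atoms at the origin the amalgam norm factorises into the l^q norm of the
  coefficients and the L^p norm of the atom. With the atoms spread over the lattice, rapid decay
  makes their overlaps harmless and the l^p norm results. The larger of the two exponents is the one
  to use.\<close>

lemma embedding_sequence_condition: "sequence_condition (real CARD('n)) (max p q) q\<^sub>1 s"
proof (cases "p \<le> q")
  case True
  obtain g where g: "0 < g" "Lp_norm lborel p (\<lambda>x. ennreal (cmod (atom x))) = ennreal g"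
    using atom_norm[OF pos(1)] by metis
  have "sequence_condition (real CARD('n)) q q\<^sub>1 s"
  proof (rule sequence_test[where t="\<lambda>_. 0" and K=g])
    fix A :: "(int ^ 'n) set" and a :: "int ^ 'n \<Rightarrow> real" assume A: "finite A" and a: "\<And>k. 0 \<le> a k"
    let ?b = "\<lambda>k. a k * of_bool (k \<in> A)"
    let ?R = "Lp_norm (count_space UNIV) q (\<lambda>k. ennreal (?b k))"
    have "Lp_norm (count_space UNIV) q (\<lambda>k. ennreal (?b k * cmod (atom (x - 0)))) \<le> ?R * ennreal (cmod (atom x))" for x
    proof -
      have "(\<lambda>k. ennreal (?b k * cmod (atom (x - 0)))) = (\<lambda>k. ennreal (cmod (atom x)) * ennreal (?b k))"
        using a by (simp add: fun_eq_iff ennreal_mult[symmetric] mult_ac)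
      then show ?thesis using Lp_norm_cmult_le[OF pos(2), of "\<lambda>k. ennreal (?b k)" "count_space UNIV" "ennreal (cmod (atom x))"]
        by (simp add: mult.commute)
    qed
    then have "Lp_norm lborel p (\<lambda>x. Lp_norm (count_space UNIV) q (\<lambda>k. ennreal (?b k * cmod (atom (x - 0))))) \<le>
        Lp_norm lborel p (\<lambda>x. ?R * ennreal (cmod (atom x)))"
    proof (intro Lp_norm_mono pos)
      \<comment> \<open>Monotonicity of the outer norm includes the essential supremum and asks for
        measurability: the inner integral is a finite sum for finite exponent, and the inner norm is
        a countable supremum otherwise.\<close>
      from pos(2) show "(\<lambda>x. Lp_norm (count_space UNIV) q (\<lambda>k. ennreal (?b k * cmod (atom (x - 0))))) \<in> borel_measurable lborel"
      proof (cases rule: ereal_pos_cases)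
        case (fin Q)
        have "(\<integral>\<^sup>+k. ennreal_powr (ennreal (?b k * cmod (atom (x - 0)))) Q \<partial>count_space UNIV) =
            (\<Sum>k\<in>A. ennreal_powr (ennreal (a k * cmod (atom x))) Q)" for x
          using A by (subst nn_integral_count_space'[of A]) auto
        then show ?thesis unfolding fin(1) Lp_norm_ereal by simp
      next
        case inf
        show ?thesis unfolding inf Lp_norm_count_infty by measurable
      qed
    qed
    also have "\<dots> \<le> ?R * ennreal g" unfolding g(2)[symmetric] by (intro Lp_norm_cmult_le pos) auto
    finally show "Lp_norm lborel p (\<lambda>x. Lp_norm (count_space UNIV) q (\<lambda>k. ennreal (?b k * cmod (atom (x - 0))))) \<le>
        ennreal g * ?R" by (simp add: mult.commute)
  qed (use g pos in auto)
  then show ?thesis using True by (simp add: max_def)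
next
  case False
  then have qp: "q < p" by simp
  obtain Q where Q: "q = ereal Q" "0 < Q" using pos(2) qp by (cases q) auto
  obtain K where K: "0 < K" "\<And>A a. finite A \<Longrightarrow> (\<And>k. 0 \<le> a k) \<Longrightarrow>
    Lp_norm lborel p (\<lambda>x. Lp_norm (count_space UNIV) (ereal Q)
      (\<lambda>k. ennreal (a k * of_bool (k \<in> A) * cmod (atom (x - lattice_pt k))))) \<le>
    ennreal K * Lp_norm (count_space UNIV) p (\<lambda>k. ennreal (a k * of_bool (k \<in> A)))"
    using translates_amalgam_bound[OF schwartz_atom Q(2), of p] qp Q(1) by blast
  have "sequence_condition (real CARD('n)) p q\<^sub>1 s"
    by (rule sequence_test[where t=lattice_pt, unfolded Q(1), OF K(2) K(1) pos(1)])
  moreover have "max p q = p" using qp by simp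
  ultimately show ?thesis by (simp only:)
qed

lemma dilated_atom_norm:
  assumes "0 < P" "0 < c"
  shows "Lp_norm lborel (ereal P) (\<lambda>x. ennreal (cmod (atom ((1 / c) *\<^sub>R x)))) =
    ennreal (c powr (real CARD('n) / P)) * Lp_norm lborel (ereal P) (\<lambda>x. ennreal (cmod (atom x)))"
proof -
  have "(\<integral>\<^sup>+x. ennreal_powr (ennreal (cmod (atom ((1 / c) *\<^sub>R x)))) P \<partial>lborel) =
      ennreal (\<bar>c\<bar> ^ DIM(real ^ 'n)) * (\<integral>\<^sup>+x. ennreal_powr (ennreal (cmod (atom ((1 / c) *\<^sub>R (0 + c *\<^sub>R x))))) P \<partial>lborel)"
    by (rule lborel_nn_integral_affine) (use assms in auto)
  also have "\<dots> = ennreal (c powr real CARD('n)) * (\<integral>\<^sup>+x. ennreal_powr (ennreal (cmod (atom x))) P \<partial>lborel)"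
    using assms by (simp add: powr_realpow)
  finally show ?thesis
    by (simp add: Lp_norm_ereal ennreal_powr_mult ennreal_powr_ennreal powr_powr)
qed

lemma Lp_norm_count_single:
  assumes "0 < r"
  shows "Lp_norm (count_space UNIV) r (\<lambda>k. if k = k0 then v else 0) = v"
  using assms
proof (cases rule: ereal_pos_cases)
  case (fin R)
  have "(\<integral>\<^sup>+k. ennreal_powr (if k = k0 then v else 0) R \<partial>count_space UNIV) = ennreal_powr v R"
    by (subst nn_integral_count_space'[of "{k0}"]) auto
  then show ?thesis using fin by (simp add: Lp_norm_ereal ennreal_powr_powr)
next
  case inf
  show ?thesis unfolding inf Lp_norm_count_infty
    by (rule antisym) (auto intro!: SUP_least SUP_upper2[of k0])
qed

text \<open>The test distribution has a single block, at frequency 0, with Fourier transform bump(c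
  \<xi>); for c \<ge> 1 its support stays in the admissible cube. Apart from a common factor c^(-d)
  its L^p norm grows at most like c^(d/p) and its L^(p_1) norm like c^(d/p_1), so p_1 < p is refuted
  by large c.\<close>

lemma embedding_exponents: "p \<le> p\<^sub>1"
proof (rule ccontr)
  assume "\<not> p \<le> p\<^sub>1"
  then have p1: "p\<^sub>1 < p" by simp
  let ?d = "real CARD('n)"
  obtain P\<^sub>1 where P1: "p\<^sub>1 = ereal P\<^sub>1" "0 < P\<^sub>1" using pos(3) p1 by (cases p\<^sub>1) auto
  obtain C where C: "0 < C" "\<And>u. tempered u \<Longrightarrow> amalgam_norm \<sigma> p q 0 u < \<top> \<Longrightarrow>
    modulation_norm \<sigma> p\<^sub>1 q\<^sub>1 s u \<le> ennreal C * amalgam_norm \<sigma> p q 0 u"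
    using embedding_constant by metis
  obtain g where g: "0 < g" "Lp_norm lborel p\<^sub>1 (\<lambda>x. ennreal (cmod (atom x))) = ennreal g"
    using atom_norm[OF pos(3)] by metis
  \<comment> \<open>d/p as a real number, 0 for infinite \<open>p\<close>.\<close>
  define \<theta> where "\<theta> = (case p of ereal P \<Rightarrow> ?d / P | _ \<Rightarrow> 0)"
  have \<theta>: "\<theta> < ?d / P\<^sub>1"
    using p1 P1 pos(1) by (cases p) (auto simp: \<theta>_def intro: divide_strict_left_mono)
  have "\<exists>b\<ge>0. \<forall>c>0. Lp_norm lborel p (\<lambda>x. ennreal (cmod (atom ((1 / c) *\<^sub>R x)))) \<le> ennreal (c powr \<theta> * b)"
    using pos(1)
  proof (cases rule: ereal_pos_cases)
    case (fin P)
    obtain g' where g': "0 < g'" "Lp_norm lborel p (\<lambda>x. ennreal (cmod (atom x))) = ennreal g'"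
      using atom_norm[OF pos(1)] by metis
    show ?thesis
      using fin g' by (intro exI[of _ g']) (auto simp: dilated_atom_norm \<theta>_def ennreal_mult)
  next
    case inf
    obtain b where b: "0 \<le> b" "\<And>x. cmod (atom x) \<le> b"
      using schwartz_decay[OF schwartz_atom, of 0 "[]"] by (metis iter_partial_Nil mult_1 power_0)
    have "Lp_norm lborel p (\<lambda>x. ennreal (cmod (atom ((1 / c) *\<^sub>R x)))) \<le> ennreal (c powr \<theta> * b)" if "0 < c" for c
      using b that by (auto simp: inf Lp_norm_infty \<theta>_def intro!: esssup_I ennreal_leI)
    then show ?thesis using b by blast
  qed
  then obtain b where b: "0 \<le> b" "\<And>c. 0 < c \<Longrightarrow>
      Lp_norm lborel p (\<lambda>x. ennreal (cmod (atom ((1 / c) *\<^sub>R x)))) \<le> ennreal (c powr \<theta> * b)" by blast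
  have main: "c powr (?d / P\<^sub>1 - \<theta>) * g \<le> C * b" if c: "1 \<le> c" for c
  proof -
    define e where "e = (1 / c) ^ CARD('n)"
    have e: "0 < e" using c by (simp add: e_def)
    define v where "v x = ennreal e * ennreal (cmod (atom ((1 / c) *\<^sub>R x)))" for x
    have t: "test_fun (\<lambda>\<xi>. bump (c *\<^sub>R \<xi>))" using test_fun_affine[OF test_fun_bump, of c 0] c by simp
    have supp: "\<bar>\<xi> $ i\<bar> < 1 / 4" if "bump (c *\<^sub>R \<xi>) \<noteq> 0" for \<xi> i
    proof -
      have "\<bar>\<xi> $ i\<bar> * 1 \<le> \<bar>\<xi> $ i\<bar> * c" using c by (intro mult_left_mono) auto
      also have "\<dots> < 1 / 4" using bump_support[OF that, of i] c by (simp add: abs_mult mult.commute)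
      finally show ?thesis by simp
    qed
    obtain u where u: "tempered u" "\<And>k x. cmod (box_fun \<sigma> k u x) =
        (if k \<in> {0} then cmod (inv_fourier (\<lambda>\<xi>. bump (c *\<^sub>R \<xi>)) x) else 0)"
      using exists_block_distribution[OF \<sigma>, of "{0}" "\<lambda>_ \<xi>. bump (c *\<^sub>R \<xi>)"] t supp by blast
    have box: "ennreal (cmod (box_fun \<sigma> k u x)) = (if k = 0 then v x else 0)" for k x
      using c e by (auto simp: u(2) inv_fourier_dilate[OF test_fun_measurable[OF test_fun_bump]] v_def
          e_def[symmetric] norm_mult ennreal_mult norm_power norm_divide)
    have "amalgam_norm \<sigma> p q 0 u = Lp_norm lborel p v"
      unfolding amalgam_norm_0 box by (simp add: Lp_norm_count_single[OF pos(2)])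
    also have "\<dots> \<le> ennreal e * Lp_norm lborel p (\<lambda>x. ennreal (cmod (atom ((1 / c) *\<^sub>R x))))"
      unfolding v_def by (intro Lp_norm_cmult_le pos) measurable
    also have "\<dots> \<le> ennreal e * ennreal (c powr \<theta> * b)" using b(2)[of c] c by (intro mult_left_mono) auto
    finally have W: "amalgam_norm \<sigma> p q 0 u \<le> ennreal (e * (c powr \<theta> * b))"
      using e b(1) by (simp add: ennreal_mult)
    have "ennreal (e * (c powr (?d / P\<^sub>1) * g)) = ennreal e * Lp_norm lborel p\<^sub>1 (\<lambda>x. ennreal (cmod (atom ((1 / c) *\<^sub>R x))))"
      using e c g P1 by (simp add: dilated_atom_norm ennreal_mult)
    also have "\<dots> \<le> Lp_norm lborel p\<^sub>1 v"
      unfolding v_def using e by (intro Lp_norm_cmult_ge pos) auto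
    also have "\<dots> = ennreal (japanese (lattice_pt 0 :: real ^ 'n) powr s) * Lp_norm lborel p\<^sub>1 (\<lambda>x. ennreal (cmod (box_fun \<sigma> 0 u x)))"
    proof -
      have "lattice_pt 0 = (0 :: real ^ 'n)" by (simp add: vec_eq_iff)
      then have "japanese (lattice_pt 0 :: real ^ 'n) = 1" by (simp add: japanese_def)
      then show ?thesis by (simp add: box)
    qed
    also have "\<dots> \<le> modulation_norm \<sigma> p\<^sub>1 q\<^sub>1 s u"
      unfolding modulation_norm_def
      by (rule Lp_norm_count_ge[OF pos(4), where f="\<lambda>k. ennreal (japanese (lattice_pt k :: real ^ 'n) powr s) *
          Lp_norm lborel p\<^sub>1 (\<lambda>x. ennreal (cmod (box_fun \<sigma> k u x)))"])
    also have "\<dots> \<le> ennreal C * amalgam_norm \<sigma> p q 0 u"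
      by (rule C(2)[OF u(1)]) (rule le_less_trans[OF W], simp)
    also have "\<dots> \<le> ennreal C * ennreal (e * (c powr \<theta> * b))" using W by (rule mult_left_mono) simp
    finally have "ennreal (e * (c powr (?d / P\<^sub>1) * g)) \<le> ennreal (C * (e * (c powr \<theta> * b)))"
      using C e b by (simp add: ennreal_mult)
    then have "e * (c powr (?d / P\<^sub>1) * g) \<le> C * (e * (c powr \<theta> * b))"
      using C e b by (subst (asm) ennreal_le_iff) auto
    then have "e * (c powr (?d / P\<^sub>1) * g) \<le> e * (c powr \<theta> * (C * b))" by (simp add: mult_ac)
    then have "c powr (?d / P\<^sub>1) * g \<le> c powr \<theta> * (C * b)" using e by simp
    moreover have "c powr (?d / P\<^sub>1) = c powr \<theta> * c powr (?d / P\<^sub>1 - \<theta>)"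
      by (simp add: powr_add[symmetric])
    ultimately have "c powr \<theta> * (c powr (?d / P\<^sub>1 - \<theta>) * g) \<le> c powr \<theta> * (C * b)" by (simp add: mult_ac)
    then show ?thesis using c by simp
  qed
  define h where "h = ?d / P\<^sub>1 - \<theta>"
  have h: "0 < h" using \<theta> by (simp add: h_def)
  \<comment> \<open>Chosen so that c^h \<ge> C b / g + 1, whereas the estimate \<open>main\<close>
    gives c^h \<le> C b / g.\<close>
  define c where "c = max 1 ((C * b / g + 1) powr (1 / h))"
  have Cb: "0 \<le> C * b / g" using C b g by simp
  have "C * b / g + 1 = ((C * b / g + 1) powr (1 / h)) powr h" using h Cb by (simp add: powr_powr)
  also have "\<dots> \<le> c powr h" using h by (intro powr_mono2) (auto simp: c_def)
  finally have "(C * b / g + 1) * g \<le> c powr h * g" using g by (intro mult_right_mono) auto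
  also have "\<dots> \<le> C * b" unfolding h_def by (rule main) (simp add: c_def)
  finally have "(C * b / g + 1) * g \<le> C * b" .
  moreover have "(C * b / g + 1) * g = C * b + g" using g by (simp add: distrib_right)
  ultimately show False using g by linarith
qed

end

theorem theorem10:
  fixes \<sigma> :: "real ^ 'n::finite \<Rightarrow> complex"
    and p p\<^sub>1 q q\<^sub>1 :: ereal
    and s :: real
  assumes "decomposition_window \<sigma>"
    and "0 < p" "0 < p\<^sub>1" "0 < q" "0 < q\<^sub>1"
  shows "continuously_embedded
           (amalgam_space \<sigma> p q 0) (amalgam_norm \<sigma> p q 0)
           (modulation_space \<sigma> p\<^sub>1 q\<^sub>1 s) (modulation_norm \<sigma> p\<^sub>1 q\<^sub>1 s)
         \<longleftrightarrow>
         p\<^sub>1 \<ge> p \<and>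
         ((q\<^sub>1 \<ge> max p q \<and> s \<le> 0) \<or>
          (q\<^sub>1 < max p q \<and>
           ereal s + ereal (real CARD('n)) / q\<^sub>1 < ereal (real CARD('n)) / max p q))"
  (is "?E \<longleftrightarrow> _ \<and> ?S")
proof
  have S: "?S \<longleftrightarrow> sequence_condition (real CARD('n)) (max p q) q\<^sub>1 s"
    by (simp only: sequence_condition_def)
  show "p\<^sub>1 \<ge> p \<and> ?S" if ?E
    unfolding S
    using embedding_exponents[OF assms(1,2,4,3,5) that] embedding_sequence_condition[OF assms(1,2,4,3,5) that]
    by blast
  show ?E if "p\<^sub>1 \<ge> p \<and> ?S"
    using that unfolding S by (intro amalgam_embedding assms) auto
qed

end
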